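(* Let $\mathbb{F}$ be a field, let $V$ be an infinite-dimensional vector space over $\mathbb{F}$, and let $u\in\mathrm{GL}(V)$. Then $u$ is the product of one unipotent automorphism with index $2$ and two involutions (that is, $u=abc$ with $a$ unipotent with index $2$ and $b,c$ involutions) if and only if none of the following conditions holds: (i) There is a scalar $\lambda\in\mathbb{F}$ such that $\mathrm{rk}(u-\lambda\,\mathrm{id}_V)<\dim V$ and $\lambda^2\neq 1$. (ii) There is a scalar $\lambda\in\{1,-1\}$ such that $u-\lambda\,\mathrm{id}_V$ has finite rank and the determinant of the automorphism of $\mathrm{Im}(u-\lambda\,\mathrm{id}_V)$ induced by $u$ is neither $1$ nor $-1$.
   Context: An involution of $V$ is an element $a\in\mathrm{End}(V)$ with $a^2=\mathrm{id}_V$ (the identity is allowed). An endomorphism $a$ of $V$ is called unipotent with index $2$ if $(a-\mathrm{id}_V)^2=0$ (again the identity is allowed). Ranks and dimensions are cardinals. *)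

theory Defs
  imports "Jordan_Normal_Form.Determinant"
begin

unbundle cardinal_syntax

text \<open>A vector space over a field is given by an interpretation of the locale
  \<open>vector_space\<close> on a whole type; an endomorphism is a map \<open>f\<close> with
  \<open>Vector_Spaces.linear scale scale f\<close>.\<close>

context vector_space
begin

text \<open>The library function \<open>dim\<close> is \<open>nat\<close>-valued and does not distinguish infinite
  dimensions, so dimensions are taken as cardinals in the sense of
  \<open>BNF_Cardinal_Order_Relation\<close>, compared by \<open>\<le>o\<close>, \<open><o\<close> and \<open>=o\<close>.
  The qualifier \<open>local\<close> below is needed because the library interprets \<open>vector_space\<close>
  globally as \<open>real_vector\<close>, with an optional prefix.\<close>

definition cdim :: "'b set \<Rightarrow> 'b rel" where
  "cdim S = card_of (SOME B. B \<subseteq> S \<and> independent B \<and> span B = S)"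

definition crank :: "('b \<Rightarrow> 'b) \<Rightarrow> 'b rel" where
  "crank f = local.cdim (range f)"

definition GL :: "('b \<Rightarrow> 'b) set" where
  "GL = {f. Vector_Spaces.linear scale scale f \<and> bij f}"

definition involution :: "('b \<Rightarrow> 'b) \<Rightarrow> bool" where
  "involution f \<longleftrightarrow> Vector_Spaces.linear scale scale f \<and> f \<circ> f = id"

definition unipotent_index2 :: "('b \<Rightarrow> 'b) \<Rightarrow> bool" where
  "unipotent_index2 f \<longleftrightarrow>
     Vector_Spaces.linear scale scale f \<and> (\<lambda>x. f x - x) \<circ> (\<lambda>x. f x - x) = (\<lambda>x. 0)"

text \<open>\<open>basis_list bs W\<close>: \<open>bs\<close> is an ordered basis of the finite-dimensional subspace \<open>W\<close>.\<close>

definition basis_list :: "'b list \<Rightarrow> 'b set \<Rightarrow> bool" where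
  "basis_list bs W \<longleftrightarrow> distinct bs \<and> independent (set bs) \<and> span (set bs) = W"

definition matrix_wrt :: "'b list \<Rightarrow> ('b \<Rightarrow> 'b) \<Rightarrow> 'a mat" where
  "matrix_wrt bs f =
     mat (length bs) (length bs) (\<lambda>(i, j). representation (set bs) (f (bs ! j)) (bs ! i))"

text \<open>Determinant of the endomorphism of \<open>W\<close> induced by \<open>f\<close>. Only meaningful if \<open>W\<close> is a
  finite-dimensional subspace with \<open>f ` W \<subseteq> W\<close>; it is \<open>1\<close> for \<open>W = {0}\<close>.\<close>

definition det_on :: "'b set \<Rightarrow> ('b \<Rightarrow> 'b) \<Rightarrow> 'a" where
  "det_on W f = det (local.matrix_wrt (SOME bs. local.basis_list bs W) f)"

text \<open>The choice of basis matters neither for \<open>cdim\<close> nor for \<open>det_on\<close>.\<close>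

lemma card_of_spanning_le:
  assumes B: "independent B" and C: "independent C" and eq: "span B = span C"
  shows "card_of C \<le>o card_of B"
proof (cases "finite B")
  case True
  then have "finite C \<and> card C \<le> card B"
    using independent_span_bound[of B C] C eq span_superset by auto
  then show ?thesis using True
    by (metis card_of_ordLeq inj_on_iff_card_le)
next
  case False
  have "\<forall>b\<in>B. \<exists>F. finite F \<and> F \<subseteq> C \<and> b \<in> span F"
  proof
    fix b assume "b \<in> B"
    then have "b \<in> span C" using eq span_superset by auto
    then obtain F r where "finite F" "F \<subseteq> C" "b = (\<Sum>a\<in>F. scale (r a) a)"
      unfolding span_explicit by auto
    then show "\<exists>F. finite F \<and> F \<subseteq> C \<and> b \<in> span F"
      by (intro exI[of _ F]) (auto intro: span_sum span_scale span_base)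
  qed
  then obtain F where F: "\<And>b. b \<in> B \<Longrightarrow> finite (F b) \<and> F b \<subseteq> C \<and> b \<in> span (F b)"
    by metis
  let ?U = "\<Union>b\<in>B. F b"
  have U: "?U \<subseteq> C" using F by auto
  have "B \<subseteq> span ?U" using F span_mono by (meson UN_upper subset_iff)
  then have sp: "span C \<subseteq> span ?U" using eq by (metis span_minimal subspace_span)
  have "C \<subseteq> ?U"
  proof
    fix c assume c: "c \<in> C"
    show "c \<in> ?U"
    proof (rule ccontr)
      assume "c \<notin> ?U"
      then have "span ?U \<subseteq> span (C - {c})" using U by (intro span_mono) auto
      then have "c \<in> span (C - {c})" using sp c span_superset by blast
      then show False using C c dependent_def by blast
    qed
  qed
  then have "card_of C \<le>o card_of ?U" by (rule card_of_mono1)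
  also have "card_of ?U \<le>o card_of B"
  proof (rule card_of_UNION_ordLeq_infinite[OF False])
    show "card_of B \<le>o card_of B" by (rule card_of_refl[THEN ordIso_imp_ordLeq])
    show "\<forall>b\<in>B. card_of (F b) \<le>o card_of B"
    proof
      fix b assume "b \<in> B"
      then have "card_of (F b) <o card_of B"
        using F False
        by (intro finite_ordLess_infinite card_of_Well_order) (auto simp only: Field_card_of)
      then show "card_of (F b) \<le>o card_of B" by (rule ordLess_imp_ordLeq)
    qed
  qed
  finally show ?thesis .
qed

lemma cdim_eq_card_of_basis:
  assumes "independent B" "span B = S"
  shows "local.cdim S =o card_of B"
proof -
  have "B \<subseteq> S \<and> independent B \<and> span B = S" using assms span_superset by auto
  then have "independent (SOME B. B \<subseteq> S \<and> independent B \<and> span B = S) \<and>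
      span (SOME B. B \<subseteq> S \<and> independent B \<and> span B = S) = S"
    by (metis (mono_tags, lifting) someI_ex)
  then show ?thesis
    unfolding cdim_def by (simp add: assms card_of_spanning_le ordIso_iff_ordLeq)
qed

lemma matrix_change_of_basis:
  assumes bs: "local.basis_list bs W" and cs: "local.basis_list cs W"
    and f: "Vector_Spaces.linear scale scale f" and W: "f ` W \<subseteq> W"
  shows "det (local.matrix_wrt bs f) = det (local.matrix_wrt cs f)"
proof -
  define T where "T xs ys g = mat (length xs) (length ys)
      (\<lambda>(i, j). representation (set xs) (g (ys ! j)) (xs ! i))" for xs ys :: "'b list" and g
  have mult: "T xs ys g * T ys zs h = T xs zs (g \<circ> h)"
    if xs: "local.basis_list xs W" and ys: "local.basis_list ys W" and zs: "local.basis_list zs W"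
      and g: "Vector_Spaces.linear scale scale g" "g ` W \<subseteq> W" and h: "h ` W \<subseteq> W"
    for xs ys zs g h
  proof (rule eq_matI)
    fix i j assume "i < dim_row (T xs zs (g \<circ> h))" "j < dim_col (T xs zs (g \<circ> h))"
    then have i: "i < length xs" and j: "j < length zs" by (auto simp: T_def)
    interpret g: Vector_Spaces.linear scale scale g by fact
    have xs': "independent (set xs)" "span (set xs) = W"
      and ys': "distinct ys" "independent (set ys)" "span (set ys) = W"
      and zs': "span (set zs) = W"
      using xs ys zs by (auto simp: basis_list_def)
    have inW: "y \<in> W" if "y \<in> set ys" for y using ys' that span_base by blast
    let ?v = "h (zs ! j)"
    have v: "?v \<in> W" using h zs' j span_base by (metis image_subset_iff nth_mem)
    have "g ?v = g (\<Sum>y\<in>set ys. scale (representation (set ys) ?v y) y)"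
      using sum_representation_eq[of "set ys" ?v "set ys"] ys' v by simp
    also have "\<dots> = (\<Sum>y\<in>set ys. scale (representation (set ys) ?v y) (g y))"
      by (simp add: g.sum g.scale)
    finally have "representation (set xs) (g ?v) =
        (\<lambda>x. \<Sum>y\<in>set ys. representation (set xs) (scale (representation (set ys) ?v y) (g y)) x)"
      using representation_sum[of "set xs" "set ys" "\<lambda>y. scale (representation (set ys) ?v y) (g y)"]
        xs' g(2) inW by (metis (no_types, lifting) image_subset_iff span_scale)
    then have "representation (set xs) (g ?v) (xs ! i) =
        (\<Sum>y\<in>set ys. representation (set ys) ?v y * representation (set xs) (g y) (xs ! i))"
      using xs' g(2) inW by (simp add: representation_scale image_subset_iff)
    also have "\<dots> = (\<Sum>k<length ys. representation (set ys) ?v (ys ! k) *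
        representation (set xs) (g (ys ! k)) (xs ! i))"
      using ys'(1) by (intro sum.reindex_bij_betw[symmetric] bij_betw_nth) auto
    finally show "(T xs ys g * T ys zs h) $$ (i, j) = T xs zs (g \<circ> h) $$ (i, j)"
      using i j by (simp add: T_def scalar_prod_def mult.commute lessThan_atLeast0)
  qed (auto simp: T_def)
  have one: "T xs xs id = 1\<^sub>m (length xs)" if "local.basis_list xs W" for xs
    using that
    by (auto simp: T_def basis_list_def representation_basis nth_eq_iff_index_eq intro!: eq_matI)
  have id: "Vector_Spaces.linear scale scale id" "id ` W \<subseteq> W"
    by (auto simp: linear_id)
  have len: "length cs = length bs"
    using bs cs dim_eq_card[of "set bs" "set bs"] dim_eq_card[of "set cs" "set cs"]
      dim_span[of "set bs"] dim_span[of "set cs"]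
    by (metis basis_list_def dim_eq_card distinct_card)
  let ?n = "length bs"
  have car: "T bs cs g \<in> carrier_mat ?n ?n" "T cs bs g \<in> carrier_mat ?n ?n"
    "T cs cs g \<in> carrier_mat ?n ?n" for g by (auto simp: T_def len)
  have "T bs bs f = T bs cs id * (T cs cs f * T cs bs id)"
    by (simp add: mult bs cs f W id)
  then have "det (T bs bs f) = det (T bs cs id) * (det (T cs cs f) * det (T cs bs id))"
    using det_mult[OF car(1) mult_carrier_mat[OF car(3) car(2)]] det_mult[OF car(3) car(2)]
    by simp
  also have "\<dots> = det (T cs cs f) * det (T bs cs id * T cs bs id)"
    using det_mult[OF car(1) car(2)] by (simp add: ac_simps)
  also have "T bs cs id * T cs bs id = 1\<^sub>m ?n"
    by (simp add: mult bs cs id one)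
  finally show ?thesis by (simp add: T_def matrix_wrt_def)
qed

lemma det_on_eq_det_matrix_wrt:
  assumes "local.basis_list bs W" "Vector_Spaces.linear scale scale f" "f ` W \<subseteq> W"
  shows "local.det_on W f = det (local.matrix_wrt bs f)"
  unfolding det_on_def
  by (rule matrix_change_of_basis[OF someI[of "\<lambda>bs. local.basis_list bs W"]]) (fact assms)+

end

end

theory Submission imports Defs begin

text \<open>Write \<open>u = a b c\<close> with \<open>a = 1 - n\<close>, \<open>n\<^sup>2 = 0\<close>. Then \<open>g = (1 + n) u\<close> has to be inverted by an involution
  \<open>s\<close>, since \<open>g = (g s) s\<close>. Conversely, any map \<open>g = u + N\<close> is of this form if \<open>N\<close> has range in a subspace
  \<open>A\<close> and vanishes on the preimage of \<open>A\<close> under \<open>u\<close>, so one looks for a choice of \<open>N\<close> that makes \<open>g\<close>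
  reversible.

  If there are as many vectors \<open>x\<close> with the \<open>x\<close> and \<open>u x\<close> jointly independent as the dimension requires, let
  \<open>A\<close> be spanned by the \<open>u x\<close> and let \<open>N\<close> send the other basis vectors injectively to vectors \<open>u x\<close> of much
  higher level: \<open>g\<close> becomes a sum of bilateral shifts, and \<open>s\<close> is found by recursion on the level. This
  settles every \<open>u\<close> that is not a perturbation of a scalar of rank less than the dimension, and also every
  perturbation of \<open>1\<close> of smaller but infinite rank.

  If \<open>D\<close>, the range of \<open>u - 1\<close>, has finite dimension, then in suitable coordinates on \<open>D \<times> D\<close> one has
  \<open>g (p, q) = (K q, p + L q)\<close> with \<open>K = - u\<close> on \<open>D\<close> and \<open>L\<close> arbitrary. For \<open>K\<close> a sum of companion blocks,
  \<open>L\<close> can be chosen such that \<open>g\<close> is cyclic and its characteristic polynomial is, up to factors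
  \<open>t - \<delta>\<close> that telescope over the blocks, palindromic; the last factor is governed by the determinant of
  \<open>u\<close> on \<open>D\<close>. If that determinant is \<open>1\<close> or \<open>-1\<close>, the whole polynomial is self-reciprocal up to sign, and
  \<open>g\<close> is reversible.

  For the converse, \<open>b c\<close> is conjugate to its inverse. If \<open>u - \<lambda>\<close> is small then \<open>b c\<close> is annihilated by
  \<open>(t - \<lambda>)\<^sup>2\<close> up to a small error, which forces \<open>\<lambda> = \<lambda>\<^sup>-\<^sup>1\<close>. If \<open>u - 1\<close> has finite rank, then
  \<open>(b a b) a = (b u b) (a\<^sup>-\<^sup>1 u a)\<close>, and comparing determinants gives \<open>1 = (det u)\<^sup>2\<close>.\<close>

section \<open>Reversible perturbations\<close>

text \<open>The notation \<open>inv\<close> is occupied by the group inverse of \<open>HOL-Algebra\<close>.\<close>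

abbreviation (input) finv :: "('c \<Rightarrow> 'd) \<Rightarrow> 'd \<Rightarrow> 'c" where
  "finv \<equiv> inv_into UNIV"

text \<open>A copy of \<open>vector_space\<close> that is not affected by the global interpretation as \<open>real_vector\<close>, which
  would capture the constants declared below.\<close>

locale endomorphism_space = vector_space scale
  for scale :: "'a::field \<Rightarrow> 'b::ab_group_add \<Rightarrow> 'b"
begin

sublocale endo: vector_space_pair scale scale by unfold_locales

abbreviation lin :: "('b \<Rightarrow> 'b) \<Rightarrow> bool" where
  "lin \<equiv> Vector_Spaces.linear scale scale"

definition factorizable :: "('b \<Rightarrow> 'b) \<Rightarrow> bool" where
  "factorizable u \<longleftrightarrow> (\<exists>a b c. local.unipotent_index2 a \<and> local.involution b \<and> local.involution c \<and> u = a \<circ> b \<circ> c)"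

lemma linI:
  assumes "\<And>x y. f (x + y) = f x + f y" "\<And>c x. f (scale c x) = scale c (f x)"
  shows "lin f"
  using assms by (simp add: Vector_Spaces.linear_iff vector_space_axioms)

lemma lin_comp: "lin f \<Longrightarrow> lin g \<Longrightarrow> lin (\<lambda>x. f (g x))"
  by (intro linI) (simp_all add: endo.linear_add endo.linear_scale)

lemma lin_inv:
  assumes "lin f" "bij f" shows "lin (finv f)"
  by (rule linI; rule inv_f_eq)
    (use assms in \<open>auto simp: bij_def endo.linear_add endo.linear_scale surj_f_inv_f\<close>)

lemmas lin_simps = endo.linear_0 endo.linear_add endo.linear_scale endo.linear_diff
  endo.linear_neg endo.linear_sum

lemma lin_eq_on_basis:
  assumes "lin f" "lin g" "span B = UNIV" "\<And>b. b \<in> B \<Longrightarrow> f b = g b"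
  shows "f v = g v"
  using endo.linear_eq_on_span[OF assms(1,2,4), of B] assms(3) by auto

text \<open>Since \<open>N\<close> maps into \<open>A\<close>, the map n = N u^-1 has square zero,
  so 1 + n is invertible with inverse 1 - n, and g = (1 + n) u.\<close>

lemma perturbed_inverse:
  assumes u: "lin u" "bij u" and N: "lin N" "range N \<subseteq> A" "\<And>y. y \<in> A \<Longrightarrow> N (finv u y) = 0"
  defines "g \<equiv> \<lambda>v. u v + N v"
  shows "lin g" "bij g"
proof -
  have iu: "lin (finv u)" by (rule lin_inv[OF u])
  have [simp]: "finv u (u v) = v" "u (finv u v) = v" for v
    using u(2) by (simp_all add: bij_is_inj bij_is_surj surj_f_inv_f)
  have [simp]: "N (finv u (N v)) = 0" for v using N by blast
  show "lin g" unfolding g_def using u N by (intro endo.linear_compose_add)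
  show "bij g"
    by (rule o_bij[of "\<lambda>w. finv u (w - N (finv u w))"])
      (auto simp: g_def fun_eq_iff lin_simps[OF u(1)] lin_simps[OF iu] lin_simps[OF N(1)])
qed

text \<open>With n = N u^-1 one has u = (1 - n) (g s) s. The factor 1 - n is unipotent because n^2 =
  0, and g s g = s makes \<open>g \<circ> s\<close> an involution once \<open>s\<close> is
  one.\<close>

lemma factorizable_if_perturbation_reversible:
  assumes u: "lin u" "bij u" and N: "lin N" "range N \<subseteq> A" "\<And>y. y \<in> A \<Longrightarrow> N (finv u y) = 0"
    and s: "lin s" "\<And>v. s (s v) = v"
  defines "g \<equiv> \<lambda>v. u v + N v"
  assumes sg: "\<And>v. g (s (g v)) = s v"
  shows "factorizable u"
proof -
  have iu: "lin (finv u)" by (rule lin_inv[OF u])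
  have [simp]: "finv u (u v) = v" "u (finv u v) = v" for v
    using u(2) by (simp_all add: bij_is_inj bij_is_surj surj_f_inv_f)
  have NN [simp]: "N (finv u (N v)) = 0" for v using N by blast
  have g: "lin g" unfolding g_def by (rule perturbed_inverse(1)[OF u N])
  let ?a = "\<lambda>v. v - N (finv u v)"
  have "lin ?a" by (rule endo.linear_compose_sub[OF linear_ident lin_comp[OF N(1) iu]])
  then have "local.unipotent_index2 ?a"
    unfolding unipotent_index2_def fun_eq_iff
    by (auto simp: lin_simps[OF iu] lin_simps[OF N(1)])
  moreover have "local.involution (g \<circ> s)" "local.involution s"
    using s sg Vector_Spaces.linear_compose[OF s(1) g] by (auto simp: involution_def fun_eq_iff)
  moreover have "u = ?a \<circ> (g \<circ> s) \<circ> s"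
    by (auto simp: fun_eq_iff s g_def lin_simps[OF iu] lin_simps[OF N(1)])
  ultimately show ?thesis unfolding factorizable_def by blast
qed

end

text \<open>An infinite \<open>X\<close> contains an injective copy of T \<times> nat, whose second
  coordinate serves as level. So every \<open>t\<close> has representatives at all levels, and one
  above the finite set \<open>S t\<close> is taken.\<close>

lemma ex_level_raising_injection:
  fixes X :: "'x set" and T :: "'t set"
  assumes X: "infinite X" and T: "|T| \<le>o |X|" and S: "\<And>t. t \<in> T \<Longrightarrow> finite (S t)"
  obtains l :: "'t \<Rightarrow> 'x" and lev :: "'x \<Rightarrow> nat"
  where "inj_on l T" "l ` T \<subseteq> X" "\<And>t s. t \<in> T \<Longrightarrow> s \<in> S t \<Longrightarrow> lev s < lev (l t)"
proof -
  have "|T \<times> (UNIV :: nat set)| \<le>o |X|"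
    using X T by (intro card_of_Times_ordLeq_infinite_Field[OF _ _ _ card_of_Card_order])
      (simp_all add: Field_card_of infinite_iff_card_of_nat[symmetric])
  then obtain j where j: "inj_on j (T \<times> (UNIV :: nat set))" "j ` (T \<times> UNIV) \<subseteq> X"
    by (auto simp: card_of_ordLeq[symmetric])
  define lev where "lev x = snd (inv_into (T \<times> (UNIV :: nat set)) j x)" for x
  \<comment> \<open>Inserting 0 keeps \<open>Max\<close> meaningful when \<open>S t\<close> is
    empty. Off the range of \<open>j\<close> the values of \<open>lev\<close> are arbitrary, but the
    maximum covers them as well.\<close>
  define l where "l t = j (t, Suc (Max (insert 0 (lev ` S t))))" for t
  have l: "lev (l t) = Suc (Max (insert 0 (lev ` S t)))" if "t \<in> T" for t
    unfolding lev_def l_def using that j(1) by (subst inv_into_f_f) auto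
  show thesis
  proof
    show "inj_on l T" using j(1) by (auto simp: l_def inj_on_def)
    show "l ` T \<subseteq> X" using j(2) by (auto simp: l_def)
    show "lev s < lev (l t)" if "t \<in> T" "s \<in> S t" for t s
      using that S by (auto simp: l less_Suc_eq_le intro!: Max_ge)
  qed
qed

context endomorphism_space
begin

text \<open>Makes visible that the value at \<open>v\<close> depends only on \<open>f\<close> at the
  basis vectors in the support of \<open>v\<close>; the level recursion relies on this.\<close>

lemma construct_eq_sum:
  assumes "independent B" "span B = UNIV"
  shows "endo.construct B f v =
    (\<Sum>b | representation B v b \<noteq> 0. scale (representation B v b) (f b))"
proof -
  have c: "lin (endo.construct B f)" by (rule endo.linear_construct[OF assms(1)])
  have "endo.construct B f (\<Sum>b | representation B v b \<noteq> 0. scale (representation B v b) b) =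
    (\<Sum>b | representation B v b \<noteq> 0. scale (representation B v b) (endo.construct B f b))"
    by (simp add: lin_simps[OF c])
  also have "\<dots> = (\<Sum>b | representation B v b \<noteq> 0. scale (representation B v b) (f b))"
    by (rule sum.cong) (auto simp: endo.construct_basis[OF assms(1)] representation_ne_zero)
  finally show ?thesis
    using sum_nonzero_representation_eq[OF assms(1), of v] assms(2) by simp
qed

text \<open>The perturbed map \<open>g\<close> agrees with \<open>u\<close> on \<open>X\<close>,
  sends every \<open>t\<close> in \<open>T\<close> to u t + u (l t), and fixes \<open>R\<close>. The
  relation g s g = s leaves \<open>s\<close> free on \<open>Z\<close> and on the part of
  \<open>X\<close> not hit by \<open>l\<close>, and determines \<open>s (l t)\<close> by vectors of
  lower level. So \<open>s\<close> arises by recursion on the level, and s^2 = 1 follows by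
  induction on it.\<close>

lemma factorizable_if_shiftable:
  assumes u: "lin u" "bij u" and X: "infinite X"
    and disj: "X \<inter> u ` X = {}" "(X \<union> u ` X) \<inter> Z = {}" "(X \<union> u ` X \<union> Z) \<inter> R = {}"
    and B: "independent (X \<union> u ` X \<union> Z \<union> R)" "span (X \<union> u ` X \<union> Z \<union> R) = UNIV"
    and Z: "|Z| \<le>o |X|" and R: "\<And>r. r \<in> R \<Longrightarrow> u r = r"
  shows "factorizable u"
proof -
  define B where "B = X \<union> u ` X \<union> Z \<union> R"
  have B: "independent B" "span B = UNIV" using assms(7,8) by (simp_all add: B_def)
  have iu: "lin (finv u)" by (rule lin_inv[OF u])
  have [simp]: "finv u (u v) = v" "u (finv u v) = v" for v
    using u(2) by (simp_all add: bij_is_inj bij_is_surj surj_f_inv_f)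
  define T where "T = u ` X \<union> Z"
  \<comment> \<open>These are the elements \<open>x\<close> of \<open>X\<close> whose values enter
    \<open>s t\<close> and \<open>s (u t)\<close>: \<open>x\<close> or \<open>u x\<close> occurs in
    the expansion of \<open>u t\<close>, or \<open>t\<close> is \<open>u x\<close> itself.\<close>
  define S where "S t = {x \<in> X. representation B (u t) x \<noteq> 0 \<or> representation B (u t) (u x) \<noteq> 0
    \<or> u x = t}" for t
  have "finite (S t)" for t
  proof -
    have "S t \<subseteq> {b. representation B (u t) b \<noteq> 0} \<union>
        finv u ` {b. representation B (u t) b \<noteq> 0} \<union> {finv u t}"
      by (force simp: S_def image_iff)
    then show ?thesis by (rule finite_subset) (auto simp: finite_representation)
  qed
  moreover have "|T| \<le>o |X|"
    unfolding T_def using X Z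
    by (intro card_of_Un_ordLeq_infinite_Field[OF _ _ _ card_of_Card_order])
      (simp_all add: Field_card_of card_of_image)
  ultimately obtain l and lev :: "'b \<Rightarrow> nat"
    where l: "inj_on l T" "l ` T \<subseteq> X" and lev: "\<And>t x. t \<in> T \<Longrightarrow> x \<in> S t \<Longrightarrow> lev x < lev (l t)"
    using ex_level_raising_injection[OF X, of T S] by blast
  define N where "N = endo.construct B (\<lambda>b. if b \<in> T then u (l b) else 0)"
  have N: "lin N" unfolding N_def by (rule endo.linear_construct[OF B(1)])
  have NB: "N b = (if b \<in> T then u (l b) else 0)" if "b \<in> B" for b
    unfolding N_def by (rule endo.construct_basis[OF B(1) that])
  have NT: "N t = u (l t)" if "t \<in> T" for t
    using that by (subst NB) (auto simp: B_def T_def)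
  have NXR: "N b = 0" if "b \<in> X \<union> R" for b
    using that disj by (subst NB) (auto simp: B_def T_def)
  define A where "A = span (u ` X)"
  have "range N \<subseteq> span ((\<lambda>b. if b \<in> T then u (l b) else 0) ` B)"
    unfolding N_def using endo.construct_in_span[OF B(1)] by blast
  also have "\<dots> \<subseteq> A"
    unfolding A_def by (rule span_minimal) (use l in \<open>auto intro: span_base span_zero\<close>)
  finally have NA: "range N \<subseteq> A" .
  have AN: "N (finv u y) = 0" if "y \<in> A" for y
    by (rule endo.linear_eq_on_span[OF lin_comp[OF N iu] endo.linear_zero _ that[unfolded A_def]])
      (auto simp: NXR)
  define g where "g = (\<lambda>v. u v + N v)"
  have g: "lin g" "bij g" unfolding g_def by (rule perturbed_inverse[OF u N NA AN]; assumption)+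
  define g' where "g' = finv g"
  have g': "lin g'" unfolding g'_def by (rule lin_inv[OF g])
  have [simp]: "g' (g v) = v" "g (g' v) = v" for v
    using g(2) by (simp_all add: g'_def bij_is_inj bij_is_surj surj_f_inv_f)
  have gX: "g x = u x" if "x \<in> X" for x using that by (simp add: g_def NXR)
  have gT: "g t = u t + u (l t)" if "t \<in> T" for t using that by (simp add: g_def NT)
  have gR: "g r = r" if "r \<in> R" for r using that R by (simp add: g_def NXR)
  \<comment> \<open>Extends values prescribed on \<open>X\<close> to the whole basis: on images
    \<open>u x\<close> = \<open>g x\<close> the relation s g = g^-1 s forces the value, on
    \<open>Z\<close> and \<open>R\<close> the identity is taken.\<close>
  define ph where "ph s b = (if b \<in> X then s b else if b \<in> u ` X then g' (s (finv u b)) else b)" for s b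
  define ex where "ex s = endo.construct B (ph s)" for s
  have ex: "lin (ex s)" for s unfolding ex_def by (rule endo.linear_construct[OF B(1)])
  have exB: "ex s b = ph s b" if "b \<in> B" for s b
    unfolding ex_def by (rule endo.construct_basis[OF B(1) that])
  have ex_cong: "ex s v = ex s' v"
    if "\<And>x. x \<in> X \<Longrightarrow> representation B v x \<noteq> 0 \<or> representation B v (u x) \<noteq> 0 \<Longrightarrow> s x = s' x" for s s' v
    unfolding ex_def construct_eq_sum[OF B]
    by (rule sum.cong) (use that in \<open>auto simp: ph_def\<close>)
  \<comment> \<open>Solving g (s (g t)) = s t for the value at \<open>l t\<close>, with g t = u t +
    u (l t) and s (u (l t)) = g^-1 (s (l t)), gives this formula. Elsewhere on \<open>X\<close> the
    identity is chosen.\<close>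
  define F where "F s x = (if x \<in> l ` T then ex s (inv_into T l x) - g (ex s (u (inv_into T l x))) else x)"
    for s x
  define s where "s = wfrec (measure lev) F"
  have F_cong: "F s x = F s' x" if "\<And>x'. lev x' < lev x \<Longrightarrow> s x' = s' x'" for s s' x
  proof (cases "x \<in> l ` T")
    case True
    then obtain t where t: "t \<in> T" "x = l t" by auto
    have eq: "s x' = s' x'" if "x' \<in> S t" for x'
      using lev[OF t(1) that] t(2) that \<open>\<And>x'. lev x' < lev x \<Longrightarrow> s x' = s' x'\<close> by auto
    have tB: "t \<in> B" using t by (auto simp: T_def B_def)
    have "ex s t = ex s' t" unfolding exB[OF tB] ph_def
      using t(1) disj by (auto simp: T_def intro!: arg_cong[of _ _ g'] eq) (auto simp: S_def)
    moreover have "ex s (u t) = ex s' (u t)"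
      by (rule ex_cong, rule eq) (auto simp: S_def)
    ultimately show ?thesis using t l(1) by (simp add: F_def)
  qed (simp add: F_def)
  have s: "s x = F s x" for x
    unfolding s_def by (subst wfrec[OF wf_measure], rule F_cong) (simp add: cut_apply)
  define sg where "sg = ex s"
  have sg: "lin sg" by (simp add: sg_def ex)
  have sgX: "sg x = s x" if "x \<in> X" for x
    using that by (simp add: sg_def exB B_def ph_def)
  have sguX: "sg (u x) = g' (s x)" if "x \<in> X" for x
    using that disj by (auto simp: sg_def exB B_def ph_def)
  have sgZR: "sg b = b" if "b \<in> Z \<union> R" for b
    using that disj by (auto simp: sg_def exB B_def ph_def)
  have sl: "s (l t) = sg t - g (sg (u t))" if "t \<in> T" for t
    using that l(1) by (subst s) (simp add: F_def sg_def)
  have sxid: "s x = x" if "x \<notin> l ` T" for x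
    using that by (subst s) (simp add: F_def)
  have gsg: "g (sg (g v)) = sg v" for v
  proof (rule lin_eq_on_basis[OF lin_comp[OF g(1) lin_comp[OF sg g(1)]] sg B(2)])
    fix b assume "b \<in> B"
    then consider "b \<in> X" | "b \<in> T" | "b \<in> R" by (auto simp: B_def T_def)
    then show "g (sg (g b)) = sg b"
    proof cases
      case 2
      then have "l b \<in> X" using l by auto
      then show ?thesis
        by (simp add: gT[OF 2] lin_simps[OF sg] lin_simps[OF g(1)] sguX sl[OF 2])
    qed (simp_all add: gX sgX sguX gR sgZR)
  qed
  \<comment> \<open>The fixed space of the square of \<open>sg\<close> is stable under
    \<open>g\<close> and g^-1 because \<open>sg\<close> conjugates one into the other.\<close>
  define Fix where "Fix = {v. sg (sg v) = v}"
  have Fix: "subspace Fix" unfolding Fix_def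
    by (rule subspaceI) (simp_all add: lin_simps[OF sg])
  have sgg': "sg (g' v) = g (sg v)" for v using gsg[of "g' v"] by simp
  have sgg: "sg (g v) = g' (sg v)" for v using gsg[of v] by (metis \<open>\<And>v. g' (g v) = v\<close>)
  have Fg: "g v \<in> Fix" "g' v \<in> Fix" if "v \<in> Fix" for v
    using that by (simp_all add: Fix_def sgg sgg')
  have FZR: "b \<in> Fix" if "b \<in> Z \<union> R" for b using sgZR[OF that] by (simp add: Fix_def)
  have FX: "x \<in> X \<Longrightarrow> x \<in> Fix" for x
  proof (induction "lev x" arbitrary: x rule: less_induct)
    case less
    show ?case
    proof (cases "x \<in> l ` T")
      case False
      then have "sg x = x" using less.prems by (simp add: sgX sxid)
      then show ?thesis by (simp add: Fix_def)
    next
      case True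
      then obtain t where t: "t \<in> T" "x = l t" by auto
      have IH: "x' \<in> Fix" if "x' \<in> S t" for x'
        using that less.hyps lev[OF t(1)] t(2) by (auto simp: S_def)
      have tF: "t \<in> Fix"
      proof (cases "t \<in> Z")
        case False
        then obtain x' where "x' \<in> X" "t = u x'" using t by (auto simp: T_def)
        then show ?thesis using Fg(1)[of x'] IH[of x'] by (simp add: gX S_def)
      qed (use FZR in auto)
      have "(\<Sum>b | representation B (u t) b \<noteq> 0. scale (representation B (u t) b) b) \<in> Fix"
      proof (intro subspace_sum[OF Fix] subspace_scale[OF Fix])
        fix b assume b: "b \<in> {b. representation B (u t) b \<noteq> 0}"
        then consider "b \<in> X" | x' where "b = u x'" "x' \<in> X" | "b \<in> Z \<union> R"
          using representation_ne_zero[of B "u t" b] by (auto simp: B_def)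
        then show "b \<in> Fix"
        proof cases
          case 1
          then show ?thesis using IH b by (auto simp: S_def)
        next
          case 2
          then show ?thesis using IH[of x'] Fg(1)[of x'] b by (auto simp: S_def gX)
        qed (use FZR in auto)
      qed
      then have "u t \<in> Fix" using sum_nonzero_representation_eq[OF B(1), of "u t"] B(2) by simp
      \<comment> \<open>This difference is u (l t) = g (l t), so g^-1 carries the membership from
        lower levels to \<open>l t\<close>.\<close>
      then have "g t - u t \<in> Fix" using Fg(1)[OF tF] subspace_diff[OF Fix] by blast
      then have "g' (u (l t)) \<in> Fix" using Fg(2) gT[OF t(1)] by simp
      moreover have "g' (u (l t)) = l t"
        using gX[of "l t"] l(2) t(1) by (metis \<open>\<And>v. g' (g v) = v\<close> image_subset_iff)
      ultimately show ?thesis using t by simp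
    qed
  qed
  have "B \<subseteq> Fix"
    using FX FZR Fg(1) gX by (force simp: B_def)
  from span_minimal[OF this Fix] have "sg (sg v) = v" for v
    unfolding B(2) by (auto simp: Fix_def)
  then show ?thesis
    using factorizable_if_perturbation_reversible[OF u N NA AN sg] gsg by (simp add: g_def)
qed

section \<open>Cardinalities of independent sets and direct sums of spans\<close>

lemma card_independent_le:
  assumes A: "independent A" "A \<subseteq> span S" shows "|A| \<le>o |S|"
proof -
  obtain S0 where S0: "S0 \<subseteq> S" "independent S0" "S \<subseteq> span S0"
    by (rule maximal_independent_subset)
  have sp: "span S0 = span S" using S0 by (metis span_mono span_minimal subspace_span subset_antisym)
  obtain C where C: "A \<subseteq> C" "C \<subseteq> span S" "independent C" "span S \<subseteq> span C"
    using maximal_independent_subset_extend[OF A(2,1)] by blast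
  have "span S0 = span C" unfolding sp using C by (metis span_minimal subspace_span subset_antisym)
  then have "|C| \<le>o |S0|" using card_of_spanning_le[OF S0(2) C(3)] by blast
  then show ?thesis
    using card_of_mono1[OF C(1)] card_of_mono1[OF S0(1)] ordLeq_transitive by blast
qed

lemma basis_of_subspace:
  assumes "subspace W" obtains B where "independent B" "span B = W"
  using maximal_independent_subset[of W] assms by (metis span_subspace)

text \<open>An expansion over \<open>A \<union> B\<close> that is supported both in \<open>A\<close>
  and in \<open>B\<close> is empty.\<close>

lemma span_Int_independent:
  assumes "independent (A \<union> B)" "A \<inter> B = {}" "x \<in> span A" "x \<in> span B"
  shows "x = 0"
proof -
  have A: "representation (A \<union> B) x = representation A x"
    and B: "representation (A \<union> B) x = representation B x"
    using representation_extend[OF assms(1)] assms(3,4) by blast+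
  have "{b. representation (A \<union> B) x b \<noteq> 0} = {}"
    using representation_ne_zero[of A x] representation_ne_zero[of B x] assms(2) A B by auto
  moreover have "x \<in> span (A \<union> B)" using assms(3) span_mono by blast
  ultimately show ?thesis using sum_nonzero_representation_eq[OF assms(1), of x] by simp
qed

lemma independent_Un:
  assumes A: "independent A" and B: "independent B"
    and AB: "\<And>x. x \<in> span A \<Longrightarrow> x \<in> span B \<Longrightarrow> x = 0"
  shows "independent (A \<union> B)" "A \<inter> B = {}"
proof -
  have aux: "a \<notin> span ((A - {a}) \<union> B)"
    if A: "independent A" and a: "a \<in> A" and AB: "\<And>x. x \<in> span A \<Longrightarrow> x \<in> span B \<Longrightarrow> x = 0" for A B a
  proof
    assume "a \<in> span ((A - {a}) \<union> B)"
    then obtain x y where xy: "a = x + y" "x \<in> span (A - {a})" "y \<in> span B"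
      unfolding span_Un by auto
    have "y = a - x" using xy by simp
    moreover have "a \<in> span A" "x \<in> span A"
      using a span_base xy(2) span_mono[of "A - {a}" A] by blast+
    ultimately have "y = 0" using AB xy(3) span_diff by metis
    then show False using xy A a unfolding dependent_def by auto
  qed
  show "A \<inter> B = {}" using AB A dependent_zero span_base by blast
  show "independent (A \<union> B)"
  proof
    assume "dependent (A \<union> B)"
    then obtain a where a: "a \<in> A \<union> B" "a \<in> span (A \<union> B - {a})" unfolding dependent_def by blast
    have "A \<union> B - {a} \<subseteq> (A - {a}) \<union> B" "A \<union> B - {a} \<subseteq> (B - {a}) \<union> A" by auto
    then have "a \<in> span ((A - {a}) \<union> B)" "a \<in> span ((B - {a}) \<union> A)"
      using a(2) span_mono by blast+
    then show False using a(1) aux[OF A _ AB] aux[OF B _ AB] by blast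
  qed
qed

end

section \<open>Automorphisms far from scalars or infinitely near the identity\<close>

context endomorphism_space
begin

lemma card_Un_image_less:
  assumes "infinite C" "|X| <o |C|" shows "|X \<union> f ` X| <o |C|"
  using assms card_of_Un_ordLess_infinite ordLeq_ordLess_trans[OF card_of_image] by blast

text \<open>Take \<open>X\<close> maximal by Zorn's lemma. If it were small, maximality would force
  \<open>u v\<close> to be a multiple of \<open>v\<close> modulo the span of \<open>X\<close> and
  its image, for every \<open>v\<close> outside that span. The multiplier is then the same for all
  \<open>v\<close>, so \<open>u\<close> differs from a scalar by small rank, contrary to
  \<open>large\<close>.\<close>

lemma ex_shift_set:
  assumes u: "lin u" "bij u" and Bs: "independent Bs" "span Bs = UNIV" "infinite Bs"
    and large: "\<And>l E. |E| <o |Bs| \<Longrightarrow> \<not> range (\<lambda>x. u x - scale l x) \<subseteq> span E"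
  obtains X where "X \<inter> u ` X = {}" "independent (X \<union> u ` X)" "|Bs| \<le>o |X|"
proof -
  let ?P = "{X. X \<inter> u ` X = {} \<and> independent (X \<union> u ` X)}"
  have "\<exists>X\<in>?P. \<forall>Y\<in>?P. X \<subseteq> Y \<longrightarrow> Y = X"
  proof (rule subset_Zorn')
    fix C assume "subset.chain ?P C"
    then have C: "\<And>X. X \<in> C \<Longrightarrow> X \<inter> u ` X = {} \<and> independent (X \<union> u ` X)"
      "\<And>X Y. X \<in> C \<Longrightarrow> Y \<in> C \<Longrightarrow> X \<subseteq> Y \<or> Y \<subseteq> X"
      unfolding subset.chain_def by blast+
    have "\<Union>C \<inter> u ` \<Union>C = {}"
    proof (rule ccontr)
      assume "\<Union>C \<inter> u ` \<Union>C \<noteq> {}"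
      then obtain x y X Y where "x \<in> X" "X \<in> C" "y \<in> Y" "Y \<in> C" "x = u y" by blast
      then have "\<exists>Z\<in>C. x \<in> Z \<and> y \<in> Z" using C(2)[of X Y] by blast
      then show False using C(1) \<open>x = u y\<close> by blast
    qed
    moreover have "independent (\<Union>((\<lambda>X. X \<union> u ` X) ` C))"
    proof (rule independent_Union_directed)
      fix c d assume "c \<in> (\<lambda>X. X \<union> u ` X) ` C" "d \<in> (\<lambda>X. X \<union> u ` X) ` C"
      then obtain X Y where "c = X \<union> u ` X" "d = Y \<union> u ` Y" "X \<in> C" "Y \<in> C" by blast
      then show "c \<subseteq> d \<or> d \<subseteq> c" using C(2)[of X Y] by blast
    qed (use C(1) in blast)
    moreover have "\<Union>((\<lambda>X. X \<union> u ` X) ` C) = \<Union>C \<union> u ` \<Union>C" by blast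
    ultimately show "\<Union>C \<in> ?P" by simp
  qed
  then obtain X where X: "X \<inter> u ` X = {}" "independent (X \<union> u ` X)"
    and max: "\<And>Y. Y \<inter> u ` Y = {} \<Longrightarrow> independent (Y \<union> u ` Y) \<Longrightarrow> X \<subseteq> Y \<Longrightarrow> Y = X"
    by (smt (verit) mem_Collect_eq)
  have "\<not> |X| <o |Bs|"
  proof
    assume small: "|X| <o |Bs|"
    define S where "S = X \<union> u ` X"
    have S: "|S| <o |Bs|" unfolding S_def by (rule card_Un_image_less[OF Bs(3) small])
    have fin: "|insert x S| <o |Bs|" for x
      using card_of_Un_ordLess_infinite[OF Bs(3) _ S, of "{x}"] Bs(3)
        finite_ordLess_infinite[of "|{x}|" "|Bs|"]
      by (simp add: card_of_well_order_on Field_card_of)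
    have notUNIV: "\<exists>v. v \<notin> span E" if "|E| <o |Bs|" for E
    proof (rule ccontr)
      assume "\<nexists>v. v \<notin> span E"
      then have "|Bs| \<le>o |E|" using card_independent_le[OF Bs(1), of E] by blast
      then show False using that not_ordLess_ordLeq by blast
    qed
    have "\<exists>k. u v - scale k v \<in> span S" if v: "v \<notin> span S" for v
    proof (rule ccontr)
      assume *: "\<nexists>k. u v - scale k v \<in> span S"
      then have uv: "u v \<notin> span (insert v S)" by (simp add: span_breakdown_eq)
      have "independent (insert (u v) (insert v S))"
        using uv v X(2) by (intro independent_insertI) (auto simp: S_def)
      moreover have "insert v X \<union> u ` insert v X = insert (u v) (insert v S)"
        by (auto simp: S_def)
      moreover have "insert v X \<inter> u ` insert v X = {}"
      proof -
        have "v \<notin> S" using v span_base by blast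
        moreover have "u v \<notin> insert v S" using uv span_base by blast
        ultimately show ?thesis using X(1) by (auto simp: S_def)
      qed
      ultimately have "insert v X = X" using max[of "insert v X"] by auto
      then have "v \<in> S" unfolding S_def by blast
      then show False using v span_base by blast
    qed
    then obtain k where k: "\<And>v. v \<notin> span S \<Longrightarrow> u v - scale (k v) v \<in> span S" by metis
    \<comment> \<open>The relations for \<open>v\<close>, \<open>w\<close> and \<open>v + w\<close>
      are compared; \<open>v\<close> and \<open>w\<close> are independent modulo the span of
      \<open>S\<close>.\<close>
    have k_eq: "k v = k w" if v: "v \<notin> span S" and w: "w \<notin> span (insert v S)" for v w
    proof -
      have w': "w \<notin> span S" using w span_mono[of S "insert v S"] by blast
      have vw: "v + w \<notin> span S"
      proof
        assume "v + w \<in> span S"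
        then have "v + w - v \<in> span (insert v S)"
          by (intro span_diff) (use span_mono[of S "insert v S"] span_base in blast)+
        then show False using w by simp
      qed
      let ?m = "k (v + w)"
      have "(u (v + w) - scale ?m (v + w)) - (u v - scale (k v) v) - (u w - scale (k w) w) \<in> span S"
        by (intro span_diff k v w' vw)
      moreover have "(u (v + w) - scale ?m (v + w)) - (u v - scale (k v) v) - (u w - scale (k w) w)
          = scale (k v - ?m) v + scale (k w - ?m) w"
        by (simp add: lin_simps[OF u(1)] scale_left_diff_distrib scale_right_distrib)
      ultimately have *: "scale (k v - ?m) v + scale (k w - ?m) w \<in> span S" by simp
      have "k w = ?m"
      proof (rule ccontr)
        assume ne: "k w \<noteq> ?m"
        have "scale (k v - ?m) v + scale (k w - ?m) w \<in> span (insert v S)"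
          using * span_mono[of S "insert v S"] by blast
        then have "scale (k v - ?m) v + scale (k w - ?m) w - scale (k v - ?m) v \<in> span (insert v S)"
          using span_diff[OF _ span_scale[OF span_base]] by blast
        then have "scale (k w - ?m) w \<in> span (insert v S)" by simp
        from span_scale[OF this, of "inverse (k w - ?m)"] show False using ne w by simp
      qed
      with * have "scale (k v - ?m) v \<in> span S" by simp
      then have "k v = ?m"
        using v span_scale[of "scale (k v - ?m) v" S "inverse (k v - ?m)"]
        by (cases "k v = ?m") simp_all
      with \<open>k w = ?m\<close> show ?thesis by simp
    qed
    obtain w0 where w0: "w0 \<notin> span S" using notUNIV[OF S] by blast
    \<comment> \<open>A second reference vector: a \<open>v\<close> in the span of \<open>w0\<close>
      and \<open>S\<close> cannot be compared with \<open>w0\<close>, but it can be compared with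
      \<open>w1\<close>.\<close>
    obtain w1 where w1: "w1 \<notin> span (insert w0 S)" using notUNIV[OF fin] by blast
    have w1': "w1 \<notin> span S" using w1 span_mono[of S "insert w0 S"] by blast
    have kv: "k v = k w0" if v: "v \<notin> span S" for v
    proof (cases "v \<in> span (insert w0 S)")
      case False
      then show ?thesis using k_eq[OF w0] by simp
    next
      case True
      have "v \<notin> span (insert w1 S)"
      proof
        assume "v \<in> span (insert w1 S)"
        then have "w1 \<in> span (insert v S)" using in_span_insert[OF _ v] by blast
        also have "\<dots> \<subseteq> span (insert w0 S)"
          using True by (intro span_minimal) (auto intro: span_base)
        finally show False using w1 by simp
      qed
      then have "k v = k w1" using k_eq[OF w1'] by simp
      then show ?thesis using k_eq[OF w0 w1] by simp
    qed
    have "range (\<lambda>x. u x - scale (k w0) x) \<subseteq> span S"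
    proof (rule image_subsetI)
      fix v
      show "u v - scale (k w0) v \<in> span S"
      proof (cases "v \<in> span S")
        case False
        then show ?thesis using k[of v] kv[of v] by simp
      next
        case True
        \<comment> \<open>Vectors inside the span of \<open>S\<close> have no multiplier of their
          own; translation by \<open>w0\<close> moves them outside.\<close>
        then have "v + w0 \<notin> span S" using w0 span_add_eq by blast
        then have "(u (v + w0) - scale (k w0) (v + w0)) - (u w0 - scale (k w0) w0) \<in> span S"
          using k[of "v + w0"] kv[of "v + w0"] by (metis span_diff k[OF w0])
        then show ?thesis by (simp add: lin_simps[OF u(1)] scale_right_distrib)
      qed
    qed
    then show False using large[OF S] by blast
  qed
  then have "|Bs| \<le>o |X|" by (simp add: not_ordLess_iff_ordLeq card_of_Well_order)
  with X that show thesis by blast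
qed

lemma factorizable_if_far_from_scalars:
  assumes u: "lin u" "bij u" and Bs: "independent Bs" "span Bs = UNIV" "infinite Bs"
    and large: "\<And>l E. |E| <o |Bs| \<Longrightarrow> \<not> range (\<lambda>x. u x - scale l x) \<subseteq> span E"
  shows "factorizable u"
proof -
  obtain X where X: "X \<inter> u ` X = {}" "independent (X \<union> u ` X)" "|Bs| \<le>o |X|"
    using ex_shift_set[OF assms] .
  obtain B where B: "X \<union> u ` X \<subseteq> B" "independent B" "span B = UNIV"
    using maximal_independent_subset_extend[OF subset_UNIV X(2)] by (metis top.extremum_uniqueI)
  let ?Z = "B - (X \<union> u ` X)"
  have eq: "X \<union> u ` X \<union> ?Z \<union> {} = B" using B(1) by auto
  have "|B| \<le>o |Bs|" using card_independent_le[OF B(2), of Bs] Bs(2) by simp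
  then have "|?Z| \<le>o |X|"
    using card_of_mono1[of ?Z B] X(3) ordLeq_transitive by blast
  moreover have "infinite X" using Bs(3) X(3) card_of_ordLeq_infinite by blast
  ultimately show ?thesis
    using B(2,3) by (intro factorizable_if_shiftable[OF u _ X(1), of ?Z "{}"]) (simp_all only: eq, auto)
qed

text \<open>A linear section \<open>c\<close> of u - 1 over D = \<open>span E\<close> is corrected
  by an injective map \<open>f\<close> from D into fixed vectors independent of D and c D. The
  corrected section \<open>h\<close> makes h D and u h D independent, and fixed vectors complete
  them to the whole space. There is room for \<open>f\<close> because \<open>E\<close> is smaller
  than the dimension.\<close>

lemma near_identity_normal_form:
  assumes u: "lin u" "bij u" and Bs: "independent Bs" "span Bs = UNIV" "infinite Bs"
    and E: "independent E" "span E = range (\<lambda>x. u x - x)" "|E| <o |Bs|"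
  obtains h R where "lin h" "\<And>d. d \<in> span E \<Longrightarrow> u (h d) = h d + d" "inj_on h (span E)"
    "h ` E \<inter> u ` h ` E = {}" "(h ` E \<union> u ` h ` E) \<inter> R = {}"
    "independent (h ` E \<union> u ` h ` E \<union> R)" "span (h ` E \<union> u ` h ` E \<union> R) = UNIV"
    "\<And>r. r \<in> R \<Longrightarrow> u r = r"
proof -
  define c where "c = endo.construct E (\<lambda>e. SOME v. u v - v = e)"
  have c: "lin c" unfolding c_def by (rule endo.linear_construct[OF E(1)])
  have "u (c e) - c e = e" if "e \<in> E" for e
  proof -
    have "e \<in> range (\<lambda>x. u x - x)" using that E(2) span_base by blast
    then have "\<exists>v. u v - v = e" by blast
    then show ?thesis
      unfolding c_def endo.construct_basis[OF E(1) that] by (rule someI_ex)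
  qed
  then have cd: "u (c d) - c d = d" if "d \<in> span E" for d
    using endo.linear_eq_on_span[OF endo.linear_compose_sub[OF lin_comp[OF u(1) c] c] linear_ident _ that]
    by blast
  define W where "W = {v. u v = v}"
  have split: "v - c (u v - v) \<in> W" for v
    using cd[of "u v - v"] E(2) by (auto simp: W_def lin_simps[OF u(1)] lin_simps[OF c] algebra_simps)
  obtain BT where BT: "BT \<subseteq> c ` E \<union> E" "independent BT" "c ` E \<union> E \<subseteq> span BT"
    by (rule maximal_independent_subset)
  obtain B where B: "BT \<subseteq> B" "B \<subseteq> BT \<union> W" "independent B" "BT \<union> W \<subseteq> span B"
    using maximal_independent_subset_extend[of BT "BT \<union> W"] BT(2) by blast
  have cE: "c ` span E \<subseteq> span BT" "span E \<subseteq> span BT"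
  proof -
    show "span E \<subseteq> span BT" using BT(3) by (intro span_minimal) auto
    show "c ` span E \<subseteq> span BT"
      using BT(3) unfolding endo.linear_span_image[OF c, symmetric] by (intro span_minimal) auto
  qed
  have "span B = UNIV"
  proof -
    have "v \<in> span B" for v
    proof -
      have "u v - v \<in> span E" using E(2) by blast
      then have "c (u v - v) \<in> span B" using cE(1) span_mono[OF B(1)] by blast
      moreover have "v - c (u v - v) \<in> span B" using split B(4) by blast
      ultimately show ?thesis using span_add by fastforce
    qed
    then show ?thesis by blast
  qed
  \<comment> \<open>Fixed basis vectors independent of D and c D. As \<open>BT\<close> is small,
    their number is at least the dimension, so \<open>E\<close> embeds into them.\<close>
  define F where "F = B - BT"
  have F: "F \<subseteq> W" "F \<union> BT = B" "F \<inter> BT = {}" using B(1,2) by (auto simp: F_def)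
  have BTless: "|BT| <o |Bs|"
  proof -
    have "|E \<union> c ` E| <o |Bs|" by (rule card_Un_image_less[OF Bs(3) E(3)])
    then show ?thesis using card_of_mono1[of BT "E \<union> c ` E"] BT(1) ordLeq_ordLess_trans by blast
  qed
  have "|Bs| \<le>o |B|" using card_independent_le[OF Bs(1), of B] \<open>span B = UNIV\<close> by simp
  then have "\<not> |B| <o |Bs|" using not_ordLess_ordLeq by blast
  then have "\<not> |F| <o |Bs|"
    using card_of_Un_ordLess_infinite[OF Bs(3) _ BTless, of F] F(2) by metis
  then have "|Bs| \<le>o |F|" by (simp add: not_ordLess_iff_ordLeq card_of_Well_order)
  then have "|E| \<le>o |F|" using E(3) ordLess_ordLeq_trans ordLess_imp_ordLeq by blast
  then obtain i where i: "inj_on i E" "i ` E \<subseteq> F" by (auto simp: card_of_ordLeq[symmetric])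
  define f where "f = endo.construct E i"
  have f: "lin f" unfolding f_def by (rule endo.linear_construct[OF E(1)])
  have fE: "f e = i e" if "e \<in> E" for e unfolding f_def by (rule endo.construct_basis[OF E(1) that])
  have "inj_on f E" using i(1) fE by (simp add: inj_on_def)
  moreover have fEF: "f ` E \<subseteq> F" using fE i(2) by auto
  moreover have "independent (f ` E)" using fEF F(2) B(3) independent_mono by blast
  ultimately have f_inj: "inj_on f (span E)"
    using endo.linear_inj_on_span_iff_independent_image[OF f] by blast
  have fW: "f d \<in> span F" "u (f d) = f d" if "d \<in> span E" for d
  proof -
    show "f d \<in> span F"
      using that endo.linear_span_image[OF f, of E] span_mono[OF fEF] by blast
    have "u (f e) = f e" if "e \<in> E" for e using that fEF F(1) by (auto simp: W_def)
    then show "u (f d) = f d"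
      using endo.linear_eq_on_span[OF lin_comp[OF u(1) f] f _ that] by blast
  qed
  define h where "h v = c v + f v" for v
  have h: "lin h" unfolding h_def by (rule endo.linear_compose_add[OF c f])
  have uh: "u (h d) = h d + d" if "d \<in> span E" for d
    using cd[OF that] fW(2)[OF that] by (simp add: h_def lin_simps[OF u(1)] algebra_simps)
  have inj: "p = 0 \<and> q = 0" if p: "p \<in> span E" and q: "q \<in> span E" and "h p + u (h q) = 0" for p q
  proof -
    have pq: "p + q \<in> span E" using p q by (rule span_add)
    \<comment> \<open>By u (h q) = h q + q. The \<open>f\<close> part of this vector lies in the
      span of \<open>F\<close> and the rest in that of \<open>BT\<close>, so both vanish.\<close>
    have "h (p + q) + q = 0" using that uh[OF q] by (simp add: lin_simps[OF h] algebra_simps)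
    then have eq: "f (p + q) = - (c (p + q) + q)"
      by (simp add: h_def eq_neg_iff_add_eq_0 algebra_simps)
    have "c (p + q) + q \<in> span BT" using cE pq q by (intro span_add) auto
    then have "f (p + q) \<in> span BT" unfolding eq by (rule span_neg)
    then have "f (p + q) = 0"
      using span_Int_independent[of F BT "f (p + q)"] fW(1)[OF pq] F(2,3) B(3) by simp
    then have pq0: "p + q = 0" using f_inj pq by (metis endo.linear_inj_on_iff_eq_0 f subspace_span)
    then have "q = 0" using \<open>h (p + q) + q = 0\<close> by (simp add: lin_simps[OF h])
    then show ?thesis using pq0 by simp
  qed
  have uhl: "lin (\<lambda>v. u (h v))" by (rule lin_comp[OF u(1) h])
  have hinj: "inj_on h (span E)"
    using inj[OF _ span_zero] by (subst endo.linear_inj_on_iff_eq_0[OF h]) (auto simp: lin_simps[OF h] lin_simps[OF u(1)])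
  have uhinj: "inj_on (\<lambda>v. u (h v)) (span E)"
    using inj[OF span_zero] by (subst endo.linear_inj_on_iff_eq_0[OF uhl]) (auto simp: lin_simps[OF h])
  have uhE: "u ` h ` E = (\<lambda>v. u (h v)) ` E" by auto
  have meet: "x = 0" if x: "x \<in> span (h ` E)" "x \<in> span (u ` h ` E)" for x
  proof -
    obtain p q where "p \<in> span E" "q \<in> span E" "x = h p" "x = u (h q)"
      using x unfolding uhE endo.linear_span_image[OF h] endo.linear_span_image[OF uhl] by blast
    then have "p = 0" using inj[of p "- q"] span_neg
      by (auto simp: lin_simps[OF h] lin_simps[OF u(1)])
    then show ?thesis using \<open>x = h p\<close> by (simp add: lin_simps[OF h])
  qed
  have ind: "independent (h ` E \<union> u ` h ` E)" "h ` E \<inter> u ` h ` E = {}"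
    using independent_Un[of "h ` E" "u ` h ` E"] meet
      endo.linear_independent_injective_image[OF h E(1) hinj]
      endo.linear_independent_injective_image[OF uhl E(1) uhinj, folded uhE] by blast+
  \<comment> \<open>Only fixed vectors are added. They suffice since \<open>c\<close> and
    \<open>h\<close> differ on \<open>E\<close> by fixed vectors.\<close>
  obtain C where C: "h ` E \<union> u ` h ` E \<subseteq> C" "C \<subseteq> h ` E \<union> u ` h ` E \<union> W" "independent C"
    "h ` E \<union> u ` h ` E \<union> W \<subseteq> span C"
    using maximal_independent_subset_extend[of "h ` E \<union> u ` h ` E" "h ` E \<union> u ` h ` E \<union> W"] ind(1)
    by blast
  define R where "R = C - (h ` E \<union> u ` h ` E)"
  have CR: "h ` E \<union> u ` h ` E \<union> R = C" using C(1) by (auto simp: R_def)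
  have "v \<in> span C" for v
  proof -
    have "c e \<in> span C" if "e \<in> E" for e
    proof -
      have "h e \<in> span C" "f e \<in> span C" using that C(4) fEF F(1) by blast+
      then have "h e - f e \<in> span C" by (rule span_diff)
      then show ?thesis by (simp add: h_def)
    qed
    then have "span (c ` E) \<subseteq> span C" by (intro span_minimal) auto
    moreover have "c (u v - v) \<in> span (c ` E)"
      using E(2) unfolding endo.linear_span_image[OF c] by blast
    moreover have "v - c (u v - v) \<in> span C" using split C(4) by blast
    ultimately have "v - c (u v - v) + c (u v - v) \<in> span C" by (intro span_add) auto
    then show ?thesis by simp
  qed
  then have "span C = UNIV" by blast
  moreover have "u r = r" if "r \<in> R" for r using that C(2) by (auto simp: R_def W_def)
  moreover have "(h ` E \<union> u ` h ` E) \<inter> R = {}" by (auto simp: R_def)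
  ultimately show thesis
    using that[of h R] h uh hinj ind(2) CR C(3) by metis
qed

text \<open>The normal form is a shiftable decomposition with the image of \<open>E\<close> under
  \<open>h\<close> as \<open>X\<close>, which is infinite here, and with empty
  \<open>Z\<close>.\<close>

lemma factorizable_if_infinitely_near_identity:
  assumes u: "lin u" "bij u" and Bs: "independent Bs" "span Bs = UNIV" "infinite Bs"
    and E: "independent E" "span E = range (\<lambda>x. u x - x)" "|E| <o |Bs|" "infinite E"
  shows "factorizable u"
proof -
  obtain h R where h: "lin h" "\<And>d. d \<in> span E \<Longrightarrow> u (h d) = h d + d" "inj_on h (span E)"
    "h ` E \<inter> u ` h ` E = {}" "(h ` E \<union> u ` h ` E) \<inter> R = {}"
    "independent (h ` E \<union> u ` h ` E \<union> R)" "span (h ` E \<union> u ` h ` E \<union> R) = UNIV"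
    "\<And>r. r \<in> R \<Longrightarrow> u r = r"
    using near_identity_normal_form[OF u Bs E(1-3)] by blast
  have "inj_on h E" using h(3) span_superset inj_on_subset by blast
  then have "infinite (h ` E)" using E(4) finite_imageD by blast
  then show ?thesis
    using h by (intro factorizable_if_shiftable[OF u, of "h ` E" "{}" R]) (auto simp: card_of_empty)
qed

end

section \<open>Polynomials acting on a vector space\<close>

text \<open>A prescribed odd coefficient of the product links two neighbouring coefficients of \<open>q\<close>. Read directly
  or through the symmetry of \<open>q\<close>, these conditions determine the coefficients of \<open>q\<close> successively.\<close>

lemma ex_palindromic_factor:
  fixes \<gamma> :: "'a::field" and f :: "nat \<Rightarrow> 'a"
  assumes \<gamma>: "\<gamma> \<noteq> 0" and m: "m > 0"
  obtains q v where "reflect_poly q = q" "coeff q 0 = 1"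
    "[:- \<gamma>, 1:] * q = [:- \<gamma>:] + (\<Sum>j=1..<m. monom (f j) (2 * j - 1) - monom (v j) (2 * j))
      + monom 1 (2 * m - 1)"
proof -
  \<comment> \<open>For even \<open>i\<close> the condition at degree i + 1 is solved for the next
    coefficient of \<open>q\<close>. For odd \<open>i\<close> the condition at degree 2 m - 2 - i is
    used, with both coefficients of \<open>q\<close> replaced by their mirror images.\<close>
  define c where "c = rec_nat 1 (\<lambda>i x. if even i then (x - f (i div 2 + 1)) / \<gamma>
    else \<gamma> * x + f ((2 * m - 1 - i) div 2))"
  have c0: "c 0 = 1" and cS: "c (Suc i) = (if even i then (c i - f (i div 2 + 1)) / \<gamma>
    else \<gamma> * c i + f ((2 * m - 1 - i) div 2))" for i
    by (simp_all add: c_def)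
  define n where "n = 2 * m - 2"
  define q where "q = (\<Sum>k\<le>n. monom (c (min k (n - k))) k)"
  have q: "coeff q k = (if k \<le> n then c (min k (n - k)) else 0)" for k
    by (auto simp: q_def coeff_sum)
  have "degree q = n"
    by (rule antisym[OF degree_le le_degree]) (auto simp: q c0)
  then have refl: "reflect_poly q = q"
    by (intro poly_eqI) (auto simp: coeff_reflect_poly q min.commute)
  define r where "r = [:- \<gamma>, 1:] * q"
  have r: "coeff r k = (if k = 0 then 0 else coeff q (k - 1)) - \<gamma> * coeff q k" for k
    by (cases k) (simp_all add: r_def)
  have odd: "coeff r (2 * j - 1) = f j" if j: "1 \<le> j" "j < m" for j
  proof -
    obtain i where i: "j = Suc i" using j by (cases j) auto
    have rj: "coeff r (2 * j - 1) = coeff q (2 * i) - \<gamma> * coeff q (Suc (2 * i))"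
      by (simp add: r i)
    have le: "2 * i \<le> n" "Suc (2 * i) \<le> n" using j by (auto simp: n_def i)
    show ?thesis
    \<comment> \<open>Distinguishes whether the two coefficients involved lie in the first half of
      \<open>q\<close> or are read as mirror images.\<close>
    proof (cases "2 * j \<le> m")
      case True
      then have "min (2 * i) (n - 2 * i) = 2 * i" "min (Suc (2 * i)) (n - Suc (2 * i)) = Suc (2 * i)"
        by (auto simp: n_def i)
      then show ?thesis using \<gamma> le unfolding rj by (simp add: q cS i)
    next
      case False
      define k where "k = 2 * m - 1 - 2 * j"
      have "min (2 * i) (n - 2 * i) = Suc k" "min (Suc (2 * i)) (n - Suc (2 * i)) = k"
        using False j by (auto simp: n_def i k_def)
      moreover have "odd k" "(2 * m - 1 - k) div 2 = j" using j by (auto simp: k_def)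
      ultimately show ?thesis using le unfolding rj by (simp add: q cS)
    qed
  qed
  \<comment> \<open>The even coefficients strictly between the ends are unconstrained and define
    \<open>v\<close>; the constant and the leading one come from \<open>c 0 = 1\<close>.\<close>
  have eq: "r = [:- \<gamma>:] + (\<Sum>j=1..<m. monom (f j) (2 * j - 1) - monom (- coeff r (2 * j)) (2 * j))
      + monom 1 (2 * m - 1)" (is "_ = ?r")
  proof (rule poly_eqI)
    fix k
    have sum: "coeff (\<Sum>j=1..<m. monom (f j) (2 * j - 1) - monom (- coeff r (2 * j)) (2 * j)) k =
      (\<Sum>j=1..<m. (if 2 * j - 1 = k then f j else 0) + (if 2 * j = k then coeff r k else 0))"
      by (auto simp: coeff_sum intro!: sum.cong)
    show "coeff r k = coeff ?r k"
    proof (cases "even k")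
      case True
      then obtain i where i: "k = 2 * i" by blast
      have "(\<Sum>j=1..<m. (if 2 * j - 1 = k then f j else 0) + (if 2 * j = k then coeff r k else 0)) =
        (\<Sum>j=1..<m. if j = i then coeff r k else 0)"
        by (rule sum.cong) (auto simp: i, presburger+)
      also have "\<dots> = (if 1 \<le> i \<and> i < m then coeff r k else 0)" by auto
      finally have *: "coeff (\<Sum>j=1..<m. monom (f j) (2 * j - 1) - monom (- coeff r (2 * j)) (2 * j)) k
        = (if 1 \<le> i \<and> i < m then coeff r k else 0)" using sum by simp
      have "2 * m - 1 \<noteq> k" using True m by auto
      moreover have "coeff r 0 = - \<gamma>" by (simp add: r q c0)
      moreover have "coeff r k = 0" if "i \<ge> m"
      proof -
        have "\<not> 2 * i \<le> n" "\<not> 2 * i - 1 \<le> n" "i \<noteq> 0" using that m by (auto simp: n_def)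
        then show ?thesis by (simp add: r q i)
      qed
      ultimately show ?thesis using i m unfolding coeff_add * by (cases i) auto
    next
      case False
      then obtain i' where "k = 2 * i' + 1" by (rule oddE)
      then obtain i where i: "k = 2 * i - 1" "i \<ge> 1" by (intro that[of "Suc i'"]) auto
      have "(\<Sum>j=1..<m. (if 2 * j - 1 = k then f j else 0) + (if 2 * j = k then coeff r k else 0)) =
        (\<Sum>j=1..<m. if j = i then f i else 0)"
        by (rule sum.cong) (use i in \<open>auto, presburger+\<close>)
      also have "\<dots> = (if i < m then f i else 0)" using i by auto
      finally have *: "coeff (\<Sum>j=1..<m. monom (f j) (2 * j - 1) - monom (- coeff r (2 * j)) (2 * j)) k
        = (if i < m then f i else 0)" using sum by simp
      have "coeff r k = 1" if "i = m"
      proof -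
        have "\<not> 2 * i - 1 \<le> n" "2 * i - 1 - 1 = n" "2 * i - 1 \<noteq> 0" using that m by (auto simp: n_def)
        then show ?thesis by (simp add: r q i c0)
      qed
      moreover have "coeff r k = 0" if "i > m"
      proof -
        have "\<not> 2 * i - 1 \<le> n" "\<not> 2 * i - 1 - 1 \<le> n" using that m by (auto simp: n_def)
        then show ?thesis by (simp add: r q i)
      qed
      moreover have "coeff r k = f i" if "i < m" using odd[OF i(2) that] i(1) by simp
      ultimately show ?thesis using i m unfolding coeff_add *
        by (cases i m rule: linorder_cases) (auto simp: coeff_pCons split: nat.split)
    qed
  qed
  have "coeff q 0 = 1" by (simp add: q c0)
  with refl show thesis by (rule that[OF _ _ eq[unfolded r_def]])
qed

section \<open>Evaluation of polynomials at an endomorphism\<close>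

context endomorphism_space
begin

text \<open>Horner evaluation: for linear \<open>h\<close> this is p(h) v, the module structure over
  the polynomial ring in which the variable acts as \<open>h\<close>.\<close>

definition pact :: "('b \<Rightarrow> 'b) \<Rightarrow> 'a poly \<Rightarrow> 'b \<Rightarrow> 'b" where
  "pact h p v = fold_coeffs (\<lambda>a w. scale a v + h w) p 0"

lemma pact_0 [simp]: "pact h 0 v = 0"
  by (simp add: pact_def)

context
  fixes h assumes h: "lin h"
begin

lemma pact_pCons [simp]: "pact h (pCons a p) v = scale a v + h (pact h p v)"
  by (cases "a = 0 \<and> p = 0") (auto simp: pact_def lin_simps[OF h])

lemma pact_lin: "lin (pact h p)"
  by (rule linI; induction p)
    (simp_all add: lin_simps[OF h] scale_right_distrib algebra_simps)

lemmas pact_simps = lin_simps[OF pact_lin]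

lemma pact_add: "pact h (p + q) v = pact h p v + pact h q v"
proof (induction p arbitrary: q)
  case (pCons a p)
  show ?case
    by (cases q) (simp add: pCons lin_simps[OF h] scale_left_distrib)
qed simp

lemma pact_smult: "pact h (smult c p) v = scale c (pact h p v)"
  by (induction p) (simp_all add: lin_simps[OF h] scale_right_distrib)

lemma pact_uminus: "pact h (- p) v = - pact h p v"
  using pact_smult[of "-1" p] by simp

lemma pact_diff: "pact h (p - q) v = pact h p v - pact h q v"
  using pact_add[of p "- q"] by (simp add: pact_uminus)

lemma pact_sum: "pact h (sum p I) v = (\<Sum>i\<in>I. pact h (p i) v)"
  by (induction I rule: infinite_finite_induct) (simp_all add: pact_add)

lemma pact_commute: "pact h p (h v) = h (pact h p v)"
  by (induction p) (simp_all add: lin_simps[OF h])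

lemma pact_mult: "pact h (p * q) v = pact h p (pact h q v)"
  by (induction p) (simp_all add: pact_add pact_smult)

lemma pact_monom: "pact h (monom c n) v = scale c ((h ^^ n) v)"
  by (induction n) (simp_all add: monom_0 monom_Suc lin_simps[OF h])

lemma pact_mem:
  assumes "subspace S" "\<And>v. v \<in> S \<Longrightarrow> h v \<in> S" "v \<in> S" shows "pact h p v \<in> S"
  by (induction p) (use assms in \<open>auto intro: subspace_add subspace_scale subspace_0\<close>)

end

text \<open>The reflected polynomial is t^n p(1/t) with n the degree, and \<open>h\<close> undoes
  \<open>g\<close>. This transfers annihilation by a self-reciprocal polynomial from
  \<open>g\<close> to its inverse.\<close>

lemma pact_reflect_poly:
  assumes g: "lin g" and h: "lin h" and hg: "\<And>v. h (g v) = v"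
  shows "pact h (reflect_poly p) v = (h ^^ degree p) (pact g p v)"
proof (induction p)
  case (pCons a p)
  have hn: "lin (h ^^ n)" for n
    by (induction n) (auto simp: comp_def intro: linear_ident lin_comp[OF h])
  show ?case
  proof (cases "p = 0")
    case False
    then show ?thesis
      using pCons.IH by (simp add: reflect_poly_pCons' pact_add[OF h] pact_monom[OF h] pact_pCons[OF g]
        lin_simps[OF hn] lin_simps[OF h] funpow_swap1 hg)
  qed (simp add: pact_pCons[OF g] pact_pCons[OF h] lin_simps[OF g] lin_simps[OF h])
qed simp

end

section \<open>Cyclic decomposition\<close>

context endomorphism_space
begin

text \<open>For finite \<open>I\<close>, the submodule over the polynomial ring generated by the
  family \<open>y\<close>.\<close>

definition poly_span :: "('b \<Rightarrow> 'b) \<Rightarrow> 'i set \<Rightarrow> ('i \<Rightarrow> 'b) \<Rightarrow> 'b set" where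
  "poly_span K I y = {\<Sum>i\<in>I. pact K (h i) (y i) | h. True}"

text \<open>The scalar argument is the product of the constant coefficients of the block polynomials.\<close>

inductive cyclic_sum :: "('b \<Rightarrow> 'b) \<Rightarrow> 'b set \<Rightarrow> 'a \<Rightarrow> bool" for K where
  zero: "cyclic_sum K {0} 1"
| add: "cyclic_sum K W c \<Longrightarrow> pact K f d = 0 \<Longrightarrow> lead_coeff f = 1 \<Longrightarrow> degree f > 0 \<Longrightarrow>
    (\<And>h. pact K h d \<in> W \<Longrightarrow> f dvd h) \<Longrightarrow>
    cyclic_sum K {pact K h d + w | h w. w \<in> W} (coeff f 0 * c)"

context
  fixes K assumes K: "lin K"
begin

lemmas K_simps = pact_add[OF K] pact_mult[OF K] pact_smult[OF K] pact_uminus[OF K] pact_diff[OF K]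
  pact_sum[OF K]

lemma poly_spanI: "(\<Sum>i\<in>I. pact K (h i) (y i)) \<in> poly_span K I y"
  unfolding poly_span_def by (intro CollectI exI[of _ h] conjI refl TrueI)

lemma poly_span_add:
  assumes "v \<in> poly_span K I y" "w \<in> poly_span K I y" shows "v + w \<in> poly_span K I y"
proof -
  obtain g h where "v = (\<Sum>i\<in>I. pact K (g i) (y i))" "w = (\<Sum>i\<in>I. pact K (h i) (y i))"
    using assms unfolding poly_span_def by blast
  then have "v + w = (\<Sum>i\<in>I. pact K (g i + h i) (y i))" by (simp add: K_simps sum.distrib)
  then show ?thesis by (simp only: poly_spanI)
qed

lemma poly_span_pact:
  assumes "v \<in> poly_span K I y" shows "pact K p v \<in> poly_span K I y"
proof -
  obtain g where "v = (\<Sum>i\<in>I. pact K (g i) (y i))" using assms unfolding poly_span_def by blast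
  then have "pact K p v = (\<Sum>i\<in>I. pact K (p * g i) (y i))" by (simp add: K_simps pact_simps[OF K])
  then show ?thesis by (simp only: poly_spanI)
qed

lemma poly_span_uminus: "v \<in> poly_span K I y \<Longrightarrow> - v \<in> poly_span K I y"
  using poly_span_pact[of v I y "[:-1:]"] by (simp add: pact_pCons[OF K] lin_simps[OF K])

lemma poly_span_cong: "(\<And>i. i \<in> I \<Longrightarrow> y i = z i) \<Longrightarrow> poly_span K I y = poly_span K I z"
  unfolding poly_span_def by (auto intro!: exI sum.cong)

lemma poly_span_base:
  assumes "finite I" "i \<in> I" shows "pact K p (y i) \<in> poly_span K I y"
proof -
  have "(\<Sum>j\<in>I. pact K (if j = i then p else 0) (y j)) = (\<Sum>j\<in>I. if j = i then pact K p (y i) else 0)"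
    by (rule sum.cong) auto
  also have "\<dots> = pact K p (y i)" using assms by simp
  finally show ?thesis by (metis poly_spanI)
qed

lemma poly_span_remove:
  assumes "finite I" "j \<in> I"
  shows "poly_span K I y = {pact K h (y j) + w | h w. w \<in> poly_span K (I - {j}) y}" (is "_ = ?R")
proof
  show "poly_span K I y \<subseteq> ?R"
  proof
    fix v assume "v \<in> poly_span K I y"
    then obtain h where "v = (\<Sum>i\<in>I. pact K (h i) (y i))" unfolding poly_span_def by blast
    then have "v = pact K (h j) (y j) + (\<Sum>i\<in>I - {j}. pact K (h i) (y i))"
      by (simp only: sum.remove[OF assms])
    then show "v \<in> ?R" using poly_spanI by blast
  qed
  show "?R \<subseteq> poly_span K I y"
  proof clarify
    fix h w assume "w \<in> poly_span K (I - {j}) y"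
    then obtain g where "w = (\<Sum>i\<in>I - {j}. pact K (g i) (y i))" unfolding poly_span_def by auto
    also have "\<dots> = (\<Sum>i\<in>I - {j}. pact K ((g(j := h)) i) (y i))" by (rule sum.cong) auto
    finally have "pact K h (y j) + w = (\<Sum>i\<in>I. pact K ((g(j := h)) i) (y i))"
      by (simp add: sum.remove[OF assms])
    then show "pact K h (y j) + w \<in> poly_span K I y" by (simp only: poly_spanI)
  qed
qed

text \<open>Adding to one generator a combination of the others is reversible, so the inclusion
  \<open>sub\<close>, used a second time with - w, gives equality.\<close>

lemma poly_span_update:
  assumes I: "finite I" "j \<in> I" and w: "w \<in> poly_span K (I - {j}) y"
  shows "poly_span K I (y(j := y j + w)) = poly_span K I y"
proof -
  have sub: "poly_span K I (y(j := y j + w)) \<subseteq> poly_span K I y"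
    if w: "w \<in> poly_span K (I - {j}) y" for y w
  proof
    fix v assume "v \<in> poly_span K I (y(j := y j + w))"
    moreover have "poly_span K (I - {j}) (y(j := y j + w)) = poly_span K (I - {j}) y"
      by (rule poly_span_cong) auto
    ultimately obtain h x where "v = pact K h (y j + w) + x" "x \<in> poly_span K (I - {j}) y"
      unfolding poly_span_remove[OF I, of "y(j := y j + w)"] by auto
    then have "v = pact K h (y j) + (pact K h w + x)" "pact K h w + x \<in> poly_span K (I - {j}) y"
      using poly_span_add[OF poly_span_pact[OF w]] by (auto simp: pact_simps[OF K])
    then show "v \<in> poly_span K I y" unfolding poly_span_remove[OF I] by blast
  qed
  have "poly_span K (I - {j}) (y(j := y j + w)) = poly_span K (I - {j}) y"
    by (rule poly_span_cong) auto
  then have "poly_span K I ((y(j := y j + w))(j := (y(j := y j + w)) j + - w)) \<subseteq>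
      poly_span K I (y(j := y j + w))"
    using w poly_span_uminus by (intro sub) auto
  then show ?thesis using sub[OF w] by simp
qed

text \<open>The division algorithm on the coefficients of a relation of minimal degree splits off a
  cyclic summand; this replaces the structure theory of modules over principal ideal domains.\<close>

lemma poly_span_cyclic_sum:
  assumes "finite I" "\<And>v. v \<in> poly_span K I y \<Longrightarrow> \<exists>f. f \<noteq> 0 \<and> pact K f v = 0"
  shows "\<exists>c. cyclic_sum K (poly_span K I y) c"
  using assms
proof (induction "card I" arbitrary: I y)
  case 0
  then have "poly_span K I y = {0}" by (auto simp: poly_span_def)
  then show ?case using cyclic_sum.zero by metis
next
  case (Suc n)
  note fin = \<open>finite I\<close>
  \<comment> \<open>A relation \<open>F\<close> between generators \<open>z\<close> of the same
    submodule, with a marked nonzero coefficient \<open>F j\<close>. Generators and relation both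
    vary when the degree of that coefficient is minimized.\<close>
  define rel where "rel z F j \<longleftrightarrow> poly_span K I z = poly_span K I y \<and>
    (\<Sum>i\<in>I. pact K (F i) (z i)) = 0 \<and> j \<in> I \<and> F j \<noteq> 0" for z :: "'c \<Rightarrow> 'b" and F and j :: 'c
  obtain j0 where j0: "j0 \<in> I" using Suc.hyps(2) by fastforce
  have "y j0 \<in> poly_span K I y"
    using poly_span_base[OF fin j0, of "[:1:]" y] by (simp add: pact_pCons[OF K] lin_simps[OF K])
  then obtain f0 where f0: "f0 \<noteq> 0" "pact K f0 (y j0) = 0" using Suc.prems(2) by blast
  have "(\<Sum>i\<in>I. pact K (if i = j0 then f0 else 0) (y i)) = 0"
    using f0 by (intro sum.neutral) auto
  then have "rel y (\<lambda>i. if i = j0 then f0 else 0) j0" using j0 f0 by (simp add: rel_def)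
  then have "(\<lambda>(z, F, j). rel z F j) (y, \<lambda>i. if i = j0 then f0 else 0, j0)" by (simp only: prod.case)
  from ex_has_least_nat[of "\<lambda>(z, F, j). rel z F j" _ "\<lambda>(z, F, j). degree (F j)", OF this]
  obtain x where x: "(\<lambda>(z, F, j). rel z F j) x" "\<And>x'. (\<lambda>(z, F, j). rel z F j) x' \<Longrightarrow>
      (\<lambda>(z, F, j). degree (F j)) x \<le> (\<lambda>(z, F, j). degree (F j)) x'" by blast
  obtain z F j where [simp]: "x = (z, F, j)" by (rule prod_cases3)
  have zF: "rel z F j" using x(1) by simp
  have min: "degree (F j) \<le> degree (F' j')" if "rel z' F' j'" for z' F' j'
    using x(2)[of "(z', F', j')"] that by simp
  have z: "poly_span K I z = poly_span K I y" "(\<Sum>i\<in>I. pact K (F i) (z i)) = 0" "j \<in> I" "F j \<noteq> 0"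
    using zF by (auto simp: rel_def)
  \<comment> \<open>Otherwise replacing \<open>z j\<close> by z j + q z i turns the coefficient at
    \<open>i\<close> into the remainder \<open>r\<close>, a marked coefficient of smaller
    degree.\<close>
  have dvd: "F j dvd F i" if i: "i \<in> I" for i
  proof (rule ccontr)
    assume ndvd: "\<not> F j dvd F i"
    then have ij: "i \<noteq> j" by auto
    define q r where "q = F i div F j" and "r = F i mod F j"
    have Fi: "F i = q * F j + r" by (simp only: q_def r_def div_mult_mod_eq)
    have split: "sum g I = g j + (g i + sum g (I - {j} - {i}))" for g :: "'c \<Rightarrow> 'b"
    proof -
      have "finite (I - {j})" "i \<in> I - {j}" using fin i ij by auto
      from sum.remove[OF this, of g] show ?thesis unfolding sum.remove[OF fin z(3), of g] by (rule arg_cong)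
    qed
    have "(\<Sum>k\<in>I. pact K ((F(i := r)) k) ((z(j := z j + pact K q (z i))) k)) =
      pact K (F j) (z j + pact K q (z i)) + (pact K r (z i) +
      (\<Sum>k\<in>I - {j} - {i}. pact K ((F(i := r)) k) ((z(j := z j + pact K q (z i))) k)))"
      unfolding split by (simp only: fun_upd_same fun_upd_other[OF ij] fun_upd_other[OF ij[symmetric]])
    also have "(\<Sum>k\<in>I - {j} - {i}. pact K ((F(i := r)) k) ((z(j := z j + pact K q (z i))) k)) =
      (\<Sum>k\<in>I - {j} - {i}. pact K (F k) (z k))" by (rule sum.cong) auto
    also have "pact K (F j) (z j + pact K q (z i)) = pact K (F j) (z j) + pact K (q * F j) (z i)"
      by (simp add: pact_simps[OF K] pact_mult[OF K, symmetric] mult.commute)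
    also have "\<dots> + (pact K r (z i) + (\<Sum>k\<in>I - {j} - {i}. pact K (F k) (z k))) =
      pact K (F j) (z j) + (pact K (F i) (z i) + (\<Sum>k\<in>I - {j} - {i}. pact K (F k) (z k)))"
      unfolding Fi by (simp only: pact_add[OF K] add.assoc)
    also have "\<dots> = (\<Sum>k\<in>I. pact K (F k) (z k))" unfolding split ..
    finally have "(\<Sum>k\<in>I. pact K ((F(i := r)) k) ((z(j := z j + pact K q (z i))) k)) = 0"
      using z(2) by simp
    moreover have "poly_span K I (z(j := z j + pact K q (z i))) = poly_span K I y"
      unfolding z(1)[symmetric]
      by (rule poly_span_update[OF fin z(3) poly_span_base]) (use fin i ij in auto)
    moreover have r0: "r \<noteq> 0" using ndvd by (auto simp: r_def mod_eq_0_iff_dvd)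
    ultimately have "rel (z(j := z j + pact K q (z i))) (F(i := r)) i" using i by (simp add: rel_def)
    from min[OF this] have "degree (F j) \<le> degree r" by simp
    then show False using degree_mod_less'[OF z(4), of "F i"] r0 by (simp add: r_def)
  qed
  \<comment> \<open>Dividing the relation formally by \<open>F j\<close> exhibits a generator
    \<open>d\<close> that may replace \<open>z j\<close> and is annihilated by
    \<open>F j\<close>.\<close>
  define w where "w = (\<Sum>i\<in>I - {j}. pact K (F i div F j) (z i))"
  define d where "d = z j + w"
  define W where "W = poly_span K (I - {j}) z"
  have w: "w \<in> poly_span K (I - {j}) z" unfolding w_def by (rule poly_spanI)
  have span_d: "poly_span K I (z(j := d)) = poly_span K I y"
    unfolding d_def using poly_span_update[OF fin z(3) w] z(1) by simp
  have "pact K (F j) d = pact K (F j) (z j) + (\<Sum>i\<in>I - {j}. pact K (F j * (F i div F j)) (z i))"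
    by (simp add: d_def w_def K_simps pact_simps[OF K])
  also have "(\<Sum>i\<in>I - {j}. pact K (F j * (F i div F j)) (z i)) = (\<Sum>i\<in>I - {j}. pact K (F i) (z i))"
    by (rule sum.cong) (use dvd in auto)
  finally have Fd: "pact K (F j) d = 0" using z(2) by (simp add: sum.remove[OF fin z(3)])
  have W': "W = poly_span K (I - {j}) (z(j := d))"
    unfolding W_def by (rule poly_span_cong) auto
  \<comment> \<open>A nonzero remainder moving \<open>d\<close> into \<open>W\<close> would again
    give a relation with a marked coefficient of smaller degree.\<close>
  have Fdvd: "F j dvd h" if "pact K h d \<in> W" for h
  proof (rule ccontr)
    assume "\<not> F j dvd h"
    define q r where "q = h div F j" and "r = h mod F j"
    have r0: "r \<noteq> 0" using \<open>\<not> F j dvd h\<close> by (auto simp: r_def mod_eq_0_iff_dvd)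
    have "h = q * F j + r" by (simp only: q_def r_def div_mult_mod_eq)
    then have "pact K r d \<in> W" using that by (simp add: K_simps Fd lin_simps[OF pact_lin[OF K]])
    then obtain g where g: "pact K r d = (\<Sum>i\<in>I - {j}. pact K (g i) (z i))"
      unfolding W_def poly_span_def by auto
    define G where "G i = (if i = j then r else - g i)" for i
    have "(\<Sum>i\<in>I. pact K (G i) ((z(j := d)) i)) =
      pact K r d + (\<Sum>i\<in>I - {j}. pact K (G i) ((z(j := d)) i))"
      by (simp add: sum.remove[OF fin z(3)] G_def)
    also have "(\<Sum>i\<in>I - {j}. pact K (G i) ((z(j := d)) i)) = (\<Sum>i\<in>I - {j}. - pact K (g i) (z i))"
      by (rule sum.cong) (auto simp: G_def K_simps)
    finally have "rel (z(j := d)) G j"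
      using span_d z(3) r0 g by (simp add: rel_def G_def sum_negf)
    from min[OF this] have "degree (F j) \<le> degree r" by (simp add: G_def)
    then show False using degree_mod_less'[OF z(4), of h] r0 by (simp add: r_def)
  qed
  have total: "poly_span K I y = {pact K h d + w | h w. w \<in> W}"
    using poly_span_remove[OF fin z(3), of "z(j := d)"] W' span_d by simp
  have "n = card (I - {j})" using Suc.hyps(2) fin z(3) by simp
  moreover have "W \<subseteq> poly_span K I y"
  proof
    fix x assume "x \<in> W"
    then have "pact K 0 d + x \<in> {pact K h d + w | h w. w \<in> W}" by blast
    then show "x \<in> poly_span K I y" unfolding total by simp
  qed
  ultimately obtain c where c: "cyclic_sum K W c"
    using Suc.hyps(1)[of "I - {j}" z] Suc.prems fin unfolding W_def by blast
  show ?case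
  proof (cases "degree (F j) = 0")
    case True
    then obtain a where a: "F j = [:a:]" by (rule degree_eq_zeroE)
    then have "d = 0" using Fd z(4) by (simp add: pact_pCons[OF K] lin_simps[OF K])
    then have "poly_span K I y = W" unfolding total by (auto simp: pact_simps[OF K])
    then show ?thesis using c by metis
  next
    case False
    define f where "f = smult (inverse (lead_coeff (F j))) (F j)"
    have "cyclic_sum K {pact K h d + w | h w. w \<in> W} (coeff f 0 * c)"
    proof (rule cyclic_sum.add[OF c])
      show "f dvd h" if "pact K h d \<in> W" for h
        using Fdvd[OF that] z(4) by (simp add: f_def smult_dvd_iff)
    qed (use False z(4) Fd in \<open>auto simp: f_def K_simps\<close>)
    then show ?thesis unfolding total by blast
  qed
qed

text \<open>Among the first card E + 1 iterates of \<open>v\<close>, either two coincide or there is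
  a linear dependence; both give a nonzero annihilating polynomial.\<close>

lemma torsion_if_finite_dimensional:
  assumes E: "finite E" "span E = W" and KW: "\<And>v. v \<in> W \<Longrightarrow> K v \<in> W" and v: "v \<in> W"
  shows "\<exists>f. f \<noteq> 0 \<and> pact K f v = 0"
proof (cases "inj_on (\<lambda>i. (K ^^ i) v) {..card E}")
  case False
  then obtain i j where ij: "i \<noteq> j" "(K ^^ i) v = (K ^^ j) v" by (auto simp: inj_on_def)
  let ?f = "monom 1 i - monom 1 j :: 'a poly"
  have "coeff ?f i \<noteq> 0" using ij by simp
  then have "?f \<noteq> 0" by (metis coeff_0)
  then show ?thesis using ij by (intro exI[of _ ?f]) (simp add: K_simps pact_monom[OF K])
next
  case True
  let ?S = "(\<lambda>i. (K ^^ i) v) ` {..card E}"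
  have "(K ^^ i) v \<in> W" for i by (induction i) (auto simp: v KW)
  then have "?S \<subseteq> span E" using E by auto
  then have "dependent ?S"
    using independent_span_bound[OF E(1), of ?S] card_image[OF True] by auto
  then obtain u x where u: "(\<Sum>x\<in>?S. scale (u x) x) = 0" "x \<in> ?S" "u x \<noteq> 0"
    using dependent_finite[of ?S] by auto
  let ?f = "\<Sum>i\<le>card E. monom (u ((K ^^ i) v)) i"
  obtain i where i: "i \<le> card E" "x = (K ^^ i) v" using u(2) by auto
  have "coeff ?f i \<noteq> 0" using i u(3) by (simp add: coeff_sum)
  then have "?f \<noteq> 0" by (metis coeff_0)
  moreover have "pact K ?f v = (\<Sum>x\<in>?S. scale (u x) x)"
    by (simp add: K_simps pact_monom[OF K] sum.reindex[OF True])
  ultimately show ?thesis using u(1) by auto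
qed

lemma finite_dimensional_cyclic_sum:
  assumes E: "finite E" "span E = W" and KW: "\<And>v. v \<in> W \<Longrightarrow> K v \<in> W"
  shows "\<exists>c. cyclic_sum K W c"
proof -
  have W: "subspace W" using E by auto
  have "poly_span K E id = W"
  proof
    show "poly_span K E id \<subseteq> W"
    proof
      fix v assume "v \<in> poly_span K E id"
      then obtain h where v: "v = (\<Sum>i\<in>E. pact K (h i) i)" unfolding poly_span_def by auto
      show "v \<in> W" unfolding v
        by (intro subspace_sum[OF W] pact_mem[OF K W KW]) (use E span_base in auto)
    qed
    have "subspace (poly_span K E id)"
    proof (rule subspaceI)
      show "0 \<in> poly_span K E id" unfolding poly_span_def by (auto intro!: exI[of _ "\<lambda>i. 0"])
      show "scale c x \<in> poly_span K E id" if "x \<in> poly_span K E id" for c x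
        using poly_span_pact[OF that, of "[:c:]"] by (simp add: pact_pCons[OF K] lin_simps[OF K])
    qed (rule poly_span_add)
    moreover have "E \<subseteq> poly_span K E id"
      using poly_span_base[OF E(1), of _ "[:1:]" id] by (auto simp: pact_pCons[OF K] lin_simps[OF K])
    ultimately show "W \<subseteq> poly_span K E id" using E(2) span_minimal by blast
  qed
  then show ?thesis
    using poly_span_cyclic_sum[OF E(1), of id] torsion_if_finite_dimensional[OF E KW] by metis
qed

end

end

section \<open>Chains of companion blocks\<close>

text \<open>In a realization \<open>l\<close> of a block generated by \<open>d\<close>, the vector l
  (K^j d) is A_j(h) (l d). The first identity is the recursion for these polynomials. The second
  identifies \<open>p\<close> as the defect at the top of the block, where \<open>f\<close> reduces
  the next power of \<open>K\<close>.\<close>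

lemma chain_block_polynomials:
  fixes \<alpha> \<gamma> :: "'a::field" and f v :: "nat \<Rightarrow> 'a"
  defines "A \<equiv> \<lambda>j. if j = 0 then 1 else monom 1 (2 * j - 1) * [:- \<alpha>, 1:]"
    and "X \<equiv> [:0, 1:]"
  assumes f0: "f 0 = \<alpha> * \<gamma>"
    and p: "p = [:- \<alpha>, 1:] * ([:- \<gamma>:] + (\<Sum>j=1..<Suc n. monom (f j) (2 * j - 1) - monom (v j) (2 * j))
      + monom 1 (2 * Suc n - 1))"
  shows "X * (X * A j) = A (Suc j) + (if j = 0 then smult \<alpha> X else 0)"
    and "X * (X * A n) + (\<Sum>j<Suc n. smult (f j) (A j)) =
      (if n = 0 then smult \<alpha> X else 0) + X * (\<Sum>j<Suc n. smult (if j = 0 then \<gamma> else v j) (A j)) + p"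
proof -
  define M where "M = [:- \<alpha>, 1:]"
  have A: "A j = (if j = 0 then 1 else monom 1 (2 * j - 1) * M)" for j by (simp only: A_def M_def)
  have X: "X = monom 1 1" by (simp add: X_def monom_Suc)
  have XX: "X * (X * A j) = monom 1 (2 * Suc j - 1) * M + (if j = 0 then smult \<alpha> X else 0)" for j
  proof (cases j)
    case 0
    then show ?thesis by (simp add: A X_def M_def monom_Suc)
  next
    case (Suc i)
    then have "X * X * monom 1 (2 * j - 1) = monom 1 (2 * Suc j - 1)" by (simp add: X mult_monom)
    then show ?thesis using Suc by (simp add: A mult.assoc[symmetric])
  qed
  show 1: "X * (X * A j) = A (Suc j) + (if j = 0 then smult \<alpha> X else 0)" for j
    unfolding XX by (simp add: A)
  have split: "(\<Sum>j<Suc n. g j) = g 0 + (\<Sum>j=1..<Suc n. g j)" for g :: "nat \<Rightarrow> 'a poly"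
    by (simp add: lessThan_atLeast0 sum.atLeast_Suc_lessThan)
  have "(\<Sum>j=1..<Suc n. smult (f j) (A j)) =
      (\<Sum>j=1..<Suc n. monom (f j) (2 * j - 1)) * M"
    unfolding sum_distrib_right by (rule sum.cong) (auto simp: A smult_monom simp flip: mult_smult_left)
  moreover have "X * (\<Sum>j=1..<Suc n. smult (if j = 0 then \<gamma> else v j) (A j)) =
      (\<Sum>j=1..<Suc n. monom (v j) (2 * j)) * M"
    unfolding sum_distrib_right sum_distrib_left
    by (rule sum.cong) (auto simp: A X smult_monom mult_monom mult.assoc[symmetric] simp flip: mult_smult_left)
  moreover have "smult (f 0) (A 0) - X * smult \<gamma> (A 0) = [:- \<gamma>:] * M"
    by (simp add: A X_def M_def f0 mult.commute)
  ultimately show "X * (X * A n) + (\<Sum>j<Suc n. smult (f j) (A j)) =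
      (if n = 0 then smult \<alpha> X else 0) + X * (\<Sum>j<Suc n. smult (if j = 0 then \<gamma> else v j) (A j)) + p"
    unfolding split distrib_left XX p M_def[symmetric] by (simp add: sum_subtractf algebra_simps)
qed

context endomorphism_space
begin

text \<open>The last two clauses say that \<open>(p, q) \<mapsto> (K q, p + L q)\<close> on \<open>W \<times> W\<close> is cyclic with generator \<open>(e, 0)\<close>
  annihilated by \<open>p\<close>: in every realization \<open>l\<close> of the first factor the generator is killed by \<open>p\<close> and
  generates, and every vector killed by \<open>p\<close> is the image of the generator in some realization.\<close>

definition realizes_chain ::
    "('b \<Rightarrow> 'b) \<Rightarrow> 'b set \<Rightarrow> ('b \<Rightarrow> 'b) \<Rightarrow> 'b \<Rightarrow> 'a poly \<Rightarrow> bool" where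
  "realizes_chain K W L e p \<longleftrightarrow> lin L \<and> (\<forall>w\<in>W. L w \<in> W) \<and> e \<in> W \<and>
    (\<forall>h l. lin h \<and> lin l \<and> (\<forall>w\<in>W. h (h (l w)) = l (K w) + h (l (L w))) \<longrightarrow>
      pact h p (l e) = 0 \<and>
      (\<forall>S. subspace S \<and> (\<forall>v. h v \<in> S \<longleftrightarrow> v \<in> S) \<and> l e \<in> S \<longrightarrow> (\<forall>w\<in>W. l w \<in> S))) \<and>
    (\<forall>h v. lin h \<and> bij h \<and> pact h p v = 0 \<longrightarrow>
      (\<exists>s. lin s \<and> s e = v \<and> (\<forall>w\<in>W. h (h (s w)) = s (K w) + h (s (L w)))))"

context
  fixes K assumes K: "lin K"
begin

lemma subspace_cyclic_extension:
  assumes W: "subspace W" shows "subspace {pact K h d + w | h w. w \<in> W}"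
proof (rule subspaceI)
  show "0 \<in> {pact K h d + w | h w. w \<in> W}"
    using subspace_0[OF W] by (auto intro!: exI[of _ 0])
  fix x assume "x \<in> {pact K h d + w | h w. w \<in> W}"
  then obtain h w where x: "x = pact K h d + w" "w \<in> W" by auto
  have "scale c x = pact K (smult c h) d + scale c w" for c
    using x by (simp add: pact_smult[OF K] scale_right_distrib)
  then show "scale c x \<in> {pact K h d + w | h w. w \<in> W}" for c
    using subspace_scale[OF W x(2)] by blast
  fix y assume "y \<in> {pact K h d + w | h w. w \<in> W}"
  then obtain h' w' where y: "y = pact K h' d + w'" "w' \<in> W" by auto
  have "x + y = pact K (h + h') d + (w + w')"
    using x y by (simp add: pact_add[OF K])
  then show "x + y \<in> {pact K h d + w | h w. w \<in> W}"
    using subspace_add[OF W x(2) y(2)] by blast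
qed

lemma cyclic_sum_subspace:
  "cyclic_sum K W c \<Longrightarrow> subspace W \<and> (\<forall>v\<in>W. K v \<in> W)"
proof (induction rule: cyclic_sum.induct)
  case zero
  then show ?case by (simp add: lin_simps[OF K])
next
  case (add W c f d)
  have "subspace {pact K h d + w | h w. w \<in> W}" using add.IH by (intro subspace_cyclic_extension) simp
  moreover have "K (pact K h d + w) \<in> {pact K h d + w | h w. w \<in> W}" if "w \<in> W" for h w
  proof -
    have "K (pact K h d + w) = pact K (pCons 0 h) d + K w"
      by (simp add: pact_pCons[OF K] lin_simps[OF K])
    then show ?thesis using add.IH that by blast
  qed
  ultimately show ?case by blast
qed

context
  fixes W f d m
  assumes W: "subspace W" and f: "pact K f d = 0" "lead_coeff f = 1" "degree f = m"
    and dvd: "\<forall>h. pact K h d \<in> W \<longrightarrow> f dvd h"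
begin

lemma pact_sum_monom: "pact K (\<Sum>j<m. monom (a j) j) d = (\<Sum>j<m. scale (a j) ((K ^^ j) d))"
  by (simp add: pact_sum[OF K] pact_monom[OF K])

text \<open>The polynomial with coefficients \<open>a\<close> is divisible by \<open>f\<close> but
  has smaller degree.\<close>

lemma cyclic_powers_zero:
  assumes "(\<Sum>j<m. scale (a j) ((K ^^ j) d)) \<in> W" "j < m" shows "a j = 0"
proof -
  let ?p = "\<Sum>j<m. monom (a j) j"
  have "f dvd ?p" using dvd assms(1) pact_sum_monom by metis
  moreover have "degree ?p < degree f"
  proof -
    have "degree ?p \<le> m - 1"
      by (rule degree_le) (auto simp: coeff_sum)
    then show ?thesis using assms(2) f(3) by linarith
  qed
  ultimately have "?p = 0" using dvd_imp_degree_le[of f ?p] by linarith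
  then have "coeff ?p j = 0" by simp
  then show ?thesis using assms(2) by (simp add: coeff_sum)
qed

lemma cyclic_form:
  obtains a where "pact K h d = (\<Sum>j<m. scale (a j) ((K ^^ j) d))"
proof -
  let ?r = "h mod f"
  have f0: "f \<noteq> 0" using f(2) by auto
  have "h = h div f * f + ?r" by (simp only: div_mult_mod_eq)
  then have "pact K h d = pact K ?r d"
    using pact_add[OF K, of "h div f * f" ?r d] f(1)
    by (simp add: pact_mult[OF K] lin_simps[OF pact_lin[OF K]])
  also have "?r = (\<Sum>j<m. monom (coeff ?r j) j)"
  proof (rule poly_eqI)
    fix k
    have "coeff ?r k = 0" if "m \<le> k"
      using degree_mod_less[OF f0, of h] that f(3) by (auto intro: coeff_eq_0)
    then show "coeff ?r k = coeff (\<Sum>j<m. monom (coeff ?r j) j) k"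
      by (auto simp: coeff_sum)
  qed
  finally show thesis using that unfolding pact_sum_monom by blast
qed

lemma cyclic_top_power: "(K ^^ m) d = - (\<Sum>j<m. scale (coeff f j) ((K ^^ j) d))"
proof -
  have "f = (\<Sum>j\<le>m. monom (coeff f j) j)" using poly_as_sum_of_monoms[of f] f(3) by simp
  then have "pact K (\<Sum>j\<le>m. monom (coeff f j) j) d = 0" using f(1) by simp
  then have "(\<Sum>j<m. scale (coeff f j) ((K ^^ j) d)) + (K ^^ m) d = 0"
    using f(2,3) by (simp add: pact_add[OF K] pact_sum[OF K] pact_monom[OF K] lessThan_Suc_atMost[symmetric])
  then show ?thesis by (metis add.commute eq_neg_iff_add_eq_0)
qed

lemma cyclic_basis:
  shows "inj_on (\<lambda>j. (K ^^ j) d) {..<m}" "independent ((\<lambda>j. (K ^^ j) d) ` {..<m})"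
    "\<And>x. x \<in> span ((\<lambda>j. (K ^^ j) d) ` {..<m}) \<Longrightarrow> x \<in> W \<Longrightarrow> x = 0"
proof -
  let ?D = "\<lambda>j. (K ^^ j) d"
  show inj: "inj_on ?D {..<m}"
  proof (rule inj_onI, rule ccontr)
    fix i j assume ij: "i \<in> {..<m}" "j \<in> {..<m}" "?D i = ?D j" "i \<noteq> j"
    have "(\<Sum>k<m. scale ((if k = i then 1 else 0) - (if k = j then 1 else 0)) (?D k)) =
      (\<Sum>k<m. (if k = i then ?D i else 0) - (if k = j then ?D j else 0))"
      by (rule sum.cong) (auto simp: scale_left_diff_distrib)
    also have "\<dots> = 0" using ij by (simp add: sum_subtractf)
    finally have "(\<Sum>k<m. scale ((if k = i then 1 else 0) - (if k = j then 1 else 0)) (?D k)) \<in> W"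
      using subspace_0[OF W] by simp
    from cyclic_powers_zero[OF this, of i] ij show False by simp
  qed
  show "independent (?D ` {..<m})"
  proof
    assume "dependent (?D ` {..<m})"
    then obtain u x where u: "x \<in> ?D ` {..<m}" "u x \<noteq> 0" "(\<Sum>v\<in>?D ` {..<m}. scale (u v) v) = 0"
      using dependent_finite[of "?D ` {..<m}"] by auto
    then have "(\<Sum>j<m. scale (u (?D j)) (?D j)) \<in> W"
      using subspace_0[OF W] by (simp add: sum.reindex[OF inj])
    from cyclic_powers_zero[OF this] u show False by auto
  qed
  show "x = 0" if x: "x \<in> span (?D ` {..<m})" "x \<in> W" for x
  proof -
    obtain u where "x = (\<Sum>v\<in>?D ` {..<m}. scale (u v) v)"
      using x(1) span_finite[of "?D ` {..<m}"] by auto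
    then have x': "x = (\<Sum>j<m. scale (u (?D j)) (?D j))" by (simp add: sum.reindex[OF inj])
    from cyclic_powers_zero[OF x(2)[unfolded this]] show ?thesis unfolding x' by (intro sum.neutral) simp
  qed
qed

text \<open>The first \<open>m\<close> iterates of \<open>d\<close> are independent and their span
  meets \<open>W\<close> trivially, so values on them and on \<open>W\<close> can be prescribed
  separately.\<close>

lemma cyclic_extend:
  assumes s': "lin s'"
  obtains s where "lin s" "\<And>j. j < m \<Longrightarrow> s ((K ^^ j) d) = z j" "\<And>w. w \<in> W \<Longrightarrow> s w = s' w"
proof -
  let ?D = "\<lambda>j. (K ^^ j) d"
  let ?B = "?D ` {..<m}"
  obtain E where E: "independent E" "span E = W" by (rule basis_of_subspace[OF W])
  have un: "independent (?B \<union> E)" "?B \<inter> E = {}"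
    using independent_Un[OF cyclic_basis(2) E(1)] cyclic_basis(3) E(2) by blast+
  obtain s where s: "lin s" "\<And>x. x \<in> ?B \<union> E \<Longrightarrow>
      s x = (if x \<in> ?B then z (the_inv_into {..<m} ?D x) else s' x)"
    using endo.linear_independent_extend[OF un(1),
        of "\<lambda>x. if x \<in> ?B then z (the_inv_into {..<m} ?D x) else s' x"] by blast
  show thesis
  proof (rule that[OF s(1)])
    show "s (?D j) = z j" if "j < m" for j
      using s(2)[of "?D j"] that by (simp add: the_inv_into_f_f[OF cyclic_basis(1)])
    show "s w = s' w" if "w \<in> W" for w
      by (rule endo.linear_eq_on_span[OF s(1) s', of E]) (use s(2) un(2) that E(2) in auto)
  qed
qed

end

text \<open>On the new block \<open>L\<close> acts only at the two ends: it scales \<open>d\<close>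
  by \<alpha>, and it sends the last iterate to a combination of the block plus the old generator
  \<open>e'\<close>. This link gives h (l e') = p(h) (l d), so \<open>d\<close> generates everything
  and the annihilating polynomials multiply.\<close>

lemma realizes_chain_add:
  assumes W: "subspace W" "\<And>w. w \<in> W \<Longrightarrow> K w \<in> W"
    and f: "pact K f d = 0" "lead_coeff f = 1" "degree f > 0"
    and dvd: "\<forall>h. pact K h d \<in> W \<longrightarrow> f dvd h"
    and ch: "realizes_chain K W L' e' p'"
    and \<alpha>: "coeff f 0 = \<alpha> * \<gamma>"
    and p: "p = [:- \<alpha>, 1:] * ([:- \<gamma>:] + (\<Sum>j=1..<degree f. monom (coeff f j) (2 * j - 1) - monom (v j) (2 * j))
      + monom 1 (2 * degree f - 1))"
  shows "\<exists>L. realizes_chain K {pact K h d + w | h w. w \<in> W} L d (p * p')"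
proof -
  obtain n where n: "degree f = Suc n" using f(3) by (cases "degree f") auto
  define A where "A j = (if j = 0 then 1 else monom 1 (2 * j - 1) * [:- \<alpha>, 1:])" for j :: nat
  define X where "X = ([:0, 1:] :: 'a poly)"
  define V where "V j = (if j = 0 then \<gamma> else v j)" for j
  note poly = chain_block_polynomials[of "coeff f", OF \<alpha> p[unfolded n], folded A_def X_def V_def]
  let ?D = "\<lambda>j. (K ^^ j) d"
  note ext = cyclic_extend[OF W(1) f(1,2) n dvd]
  have L': "lin L'" "\<And>w. w \<in> W \<Longrightarrow> L' w \<in> W" "e' \<in> W" using ch by (auto simp: realizes_chain_def)
  \<comment> \<open>For n = 0 the two ends coincide and the summands add up.\<close>
  obtain L where L: "lin L" "\<And>w. w \<in> W \<Longrightarrow> L w = L' w" "\<And>j. j < Suc n \<Longrightarrow> L (?D j) =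
    (if j = 0 then scale \<alpha> d else 0) + (if j = n then (\<Sum>i<Suc n. scale (V i) (?D i)) + e' else 0)"
    by (rule ext[OF L'(1), where z = "\<lambda>j. (if j = 0 then scale \<alpha> d else 0) +
      (if j = n then (\<Sum>i<Suc n. scale (V i) (?D i)) + e' else 0)"]) blast
  define U where "U = {pact K h d + w | h w. w \<in> W}"
  have W1: "subspace U" unfolding U_def by (rule subspace_cyclic_extension[OF W(1)])
  have D_W: "?D j \<in> U" for j
  proof -
    have "?D j = pact K (monom 1 j) d + 0" by (simp add: pact_monom[OF K])
    then show ?thesis using subspace_0[OF W(1)] unfolding U_def by blast
  qed
  have W_W: "w \<in> U" if "w \<in> W" for w
  proof -
    have "w = pact K 0 d + w" by simp
    then show ?thesis using that unfolding U_def by blast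
  qed
  have form: "\<exists>a w. w \<in> W \<and> x = (\<Sum>j<Suc n. scale (a j) (?D j)) + w" if "x \<in> U" for x
  proof -
    obtain h w where "x = pact K h d + w" "w \<in> W" using \<open>x \<in> U\<close> unfolding U_def by auto
    then show ?thesis using cyclic_form[OF W(1) f(1,2) n dvd, of h] by metis
  qed
  have top: "K (?D n) = - (\<Sum>j<Suc n. scale (coeff f j) (?D j))"
    using cyclic_top_power[OF W(1) f(1,2) n dvd] by simp
  have L_W: "L x \<in> U" if "x \<in> U" for x
  proof -
    obtain a w where x: "w \<in> W" "x = (\<Sum>j<Suc n. scale (a j) (?D j)) + w" using form \<open>x \<in> U\<close> by blast
    have "L (?D j) \<in> U" if "j < Suc n" for j
    proof -
      have "d \<in> U" "e' \<in> U" "(\<Sum>i<Suc n. scale (V i) (?D i)) \<in> U"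
        using D_W[of 0] W_W[OF L'(3)] by (auto intro: subspace_sum[OF W1] subspace_scale[OF W1] D_W simp del: sum.lessThan_Suc)
      then show ?thesis unfolding L(3)[OF that]
        by (simp add: subspace_add[OF W1] subspace_scale[OF W1] subspace_0[OF W1] del: sum.lessThan_Suc)
    qed
    then have "(\<Sum>j<Suc n. scale (a j) (L (?D j))) \<in> U"
      by (intro subspace_sum[OF W1] subspace_scale[OF W1]) simp
    moreover have "L w \<in> U" using x(1) L'(2) L(2) W_W by simp
    ultimately show ?thesis
      using subspace_add[OF W1] unfolding x(2) by (simp only: lin_simps[OF L(1)])
  qed
  have pX: "pact h (X * q) x = h (pact h q x)" if "lin h" for h q x
    using that by (simp add: X_def pact_pCons lin_simps[OF that] pact_add[OF that])
  have p1: "h (h (pact h (A j) x)) = pact h (A (Suc j)) x + (if j = 0 then scale \<alpha> (h x) else 0)" if h: "lin h" for h j x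
    using arg_cong[OF poly(1)[of j], of "\<lambda>q. pact h q x"]
    by (auto simp: pX[OF h] pact_add[OF h] pact_smult[OF h] X_def pact_pCons[OF h] lin_simps[OF h] split: if_splits)
  have p2: "h (h (pact h (A n) x)) + (\<Sum>j<Suc n. scale (coeff f j) (pact h (A j) x)) =
    (if n = 0 then scale \<alpha> (h x) else 0) + h (\<Sum>j<Suc n. scale (V j) (pact h (A j) x)) + pact h p x"
    if h: "lin h" for h x
    using arg_cong[OF poly(2), of "\<lambda>q. pact h q x"]
    by (cases "n = 0") (simp_all add: pX[OF h] pact_add[OF h] pact_smult[OF h] pact_sum[OF h] X_def pact_pCons[OF h] lin_simps[OF h]
        del: sum.lessThan_Suc)
  have A0: "pact h (A 0) x = x" if "lin h" for h x
    by (simp add: A_def one_pCons pact_pCons[OF that] lin_simps[OF that])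
  have pos: "pact h (p * p') (l d) = 0 \<and>
      (\<forall>S. subspace S \<and> (\<forall>v. h v \<in> S \<longleftrightarrow> v \<in> S) \<and> l d \<in> S \<longrightarrow> (\<forall>w\<in>U. l w \<in> S))"
    if h: "lin h" and l: "lin l" and rel: "\<And>w. w \<in> U \<Longrightarrow> h (h (l w)) = l (K w) + h (l (L w))" for h l
  proof -
    have lD: "j < Suc n \<Longrightarrow> l (?D j) = pact h (A j) (l d)" for j
    proof (induction j)
      case (Suc j)
      have "l (?D (Suc j)) = h (h (l (?D j))) - h (l (L (?D j)))"
        using rel[OF D_W[of j]] by simp
      also have "L (?D j) = (if j = 0 then scale \<alpha> d else 0)" using Suc.prems by (simp add: L(3))
      also have "l (?D j) = pact h (A j) (l d)" using Suc by simp
      finally show ?case by (simp add: p1[OF h] lin_simps[OF h] lin_simps[OF l])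
    qed (simp add: A0[OF h])
    have "h (h (l (?D n))) = l (K (?D n)) + h (l (L (?D n)))" using rel[OF D_W] .
    also have "l (K (?D n)) = - (\<Sum>j<Suc n. scale (coeff f j) (pact h (A j) (l d)))"
      unfolding top by (simp add: lin_simps[OF l] lD del: sum.lessThan_Suc)
    also have "l (L (?D n)) = (if n = 0 then scale \<alpha> (l d) else 0) +
        (\<Sum>i<Suc n. scale (V i) (pact h (A i) (l d))) + l e'"
      by (simp add: L(3) lin_simps[OF l] lD del: sum.lessThan_Suc)
    \<comment> \<open>The relation at the top of the block: up to a factor \<open>h\<close>, the new
      generator reaches the old one through \<open>p\<close>.\<close>
    finally have he': "h (l e') = pact h p (l d)"
      using p2[OF h, of "l d"] by (auto simp: lD lin_simps[OF h] algebra_simps simp del: sum.lessThan_Suc split: if_splits)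
    have rel': "\<forall>w\<in>W. h (h (l w)) = l (K w) + h (l (L' w))"
      using rel W_W L(2) by auto
    then have R': "pact h p' (l e') = 0"
      "\<And>S. subspace S \<Longrightarrow> (\<forall>v. h v \<in> S \<longleftrightarrow> v \<in> S) \<Longrightarrow> l e' \<in> S \<Longrightarrow> \<forall>w\<in>W. l w \<in> S"
      using ch h l unfolding realizes_chain_def by blast+
    have "pact h (p * p') (l d) = pact h p' (h (l e'))"
      by (simp add: he' pact_mult[OF h, symmetric] mult.commute)
    also have "\<dots> = 0" using R'(1) by (simp add: pact_commute[OF h] lin_simps[OF h])
    finally have "pact h (p * p') (l d) = 0" .
    moreover have "\<forall>w\<in>U. l w \<in> S"
      if S: "subspace S" and Sh: "\<forall>v. h v \<in> S \<longleftrightarrow> v \<in> S" and "l d \<in> S" for S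
    proof
      fix x assume "x \<in> U"
      then obtain a w where x: "w \<in> W" "x = (\<Sum>j<Suc n. scale (a j) (?D j)) + w" using form by blast
      have mem: "pact h q (l d) \<in> S" for q using pact_mem[OF h S] Sh \<open>l d \<in> S\<close> by blast
      then have "h (l e') \<in> S" by (simp add: he')
      then have "l w \<in> S" using R'(2)[OF S Sh] Sh x(1) by blast
      then show "l x \<in> S" unfolding x(2)
        using lD mem by (auto simp: lin_simps[OF l] intro!: subspace_add[OF S] subspace_sum[OF S] subspace_scale[OF S]
          simp del: sum.lessThan_Suc)
    qed
    ultimately show ?thesis by blast
  qed
  have univ: "\<exists>s. lin s \<and> s d = v \<and> (\<forall>w\<in>U. h (h (s w)) = s (K w) + h (s (L w)))"
    if h: "lin h" "bij h" and v: "pact h (p * p') v = 0" for h v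
  proof -
    \<comment> \<open>The link between the blocks dictates this image of \<open>e'\<close>. It is
      killed by \<open>p'\<close>, so the old part can be realized with it.\<close>
    obtain v' where v': "h v' = pact h p v" using h(2) by (metis bij_pointE)
    have "h (pact h p' v') = pact h (p * p') v"
      by (simp add: pact_commute[OF h(1), symmetric] v' pact_mult[OF h(1), symmetric] mult.commute)
    then have "h (pact h p' v') = h 0" using v by (simp add: lin_simps[OF h(1)])
    then have "pact h p' v' = 0" using h(2) by (metis bij_pointE)
    then obtain s' where s': "lin s'" "s' e' = v'" "\<And>w. w \<in> W \<Longrightarrow> h (h (s' w)) = s' (K w) + h (s' (L' w))"
      using ch h unfolding realizes_chain_def by blast
    obtain s where s: "lin s" "\<And>j. j < Suc n \<Longrightarrow> s (?D j) = pact h (A j) v" "\<And>w. w \<in> W \<Longrightarrow> s w = s' w"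
      by (rule ext[OF s'(1), where z = "\<lambda>j. pact h (A j) v"]) blast
    have sW: "h (h (s w)) = s (K w) + h (s (L w))" if "w \<in> W" for w
      using that s'(3) by (simp add: s(3) W(2) L(2) L'(2))
    have sD: "h (h (s (?D j))) = s (K (?D j)) + h (s (L (?D j)))" if j: "j < Suc n" for j
    proof (cases "j = n")
      case False
      then show ?thesis using j s(2)[of "Suc j"] s(2)[of 0]
        by (simp add: s(2) p1[OF h(1)] L(3) lin_simps[OF h(1)] lin_simps[OF s(1)] A0[OF h(1)])
    next
      case True
      have "s (K (?D n)) = - (\<Sum>j<Suc n. scale (coeff f j) (pact h (A j) v))"
        unfolding top by (simp add: lin_simps[OF s(1)] s(2) del: sum.lessThan_Suc)
      moreover have "s (L (?D n)) = (if n = 0 then scale \<alpha> v else 0) +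
          (\<Sum>i<Suc n. scale (V i) (pact h (A i) v)) + v'"
        using s(2)[of 0] A0[OF h(1)]
        by (simp add: L(3) lin_simps[OF s(1)] s(2,3) s'(2) L'(3) del: sum.lessThan_Suc)
      ultimately show ?thesis
        using p2[OF h(1), of v] v' s(2)[of n]
        by (auto simp: True lin_simps[OF h(1)] algebra_simps simp del: sum.lessThan_Suc funpow.simps split: if_splits)
    qed
    have "h (h (s x)) = s (K x) + h (s (L x))" if x: "x \<in> U" for x
    proof -
      obtain a w where "w \<in> W" "x = (\<Sum>j<Suc n. scale (a j) (?D j)) + w" using form[OF x] by blast
      then show ?thesis
        by (simp add: lin_simps[OF h(1)] lin_simps[OF s(1)] lin_simps[OF K] lin_simps[OF L(1)] sW sD
            scale_right_distrib sum.distrib algebra_simps del: sum.lessThan_Suc)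
    qed
    moreover have "s d = v" using s(2)[of 0] A0[OF h(1)] by simp
    ultimately show ?thesis using s(1) by blast
  qed
  show ?thesis
    unfolding realizes_chain_def U_def[symmetric]
  proof (intro exI[of _ L] conjI)
    show "\<forall>w\<in>U. L w \<in> U" "d \<in> U" using L_W D_W[of 0] by auto
    show "\<forall>h l. lin h \<and> lin l \<and> (\<forall>w\<in>U. h (h (l w)) = l (K w) + h (l (L w))) \<longrightarrow>
      pact h (p * p') (l d) = 0 \<and>
      (\<forall>S. subspace S \<and> (\<forall>v. h v \<in> S \<longleftrightarrow> v \<in> S) \<and> l d \<in> S \<longrightarrow> (\<forall>w\<in>U. l w \<in> S))"
      using pos by blast
    show "\<forall>h v. lin h \<and> bij h \<and> pact h (p * p') v = 0 \<longrightarrow>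
      (\<exists>s. lin s \<and> s d = v \<and> (\<forall>w\<in>U. h (h (s w)) = s (K w) + h (s (L w))))"
      using univ by blast
  qed (rule L(1))
qed

text \<open>The induction runs over arbitrary \<delta>. The new block contributes (t - 1/\<delta>)
  (t - \<gamma>) q with \<gamma> = \<delta> f(0) and \<open>q\<close> palindromic, and the
  hypothesis is used for \<gamma>. Then t - \<gamma> is absorbed by the old part, and (t - \<delta>)
  (t - 1/\<delta>) joins the palindromic factor.\<close>

lemma cyclic_sum_chain:
  assumes "cyclic_sum K W c" "inj K" "\<delta> \<noteq> 0"
  shows "\<exists>L e p Q. realizes_chain K W L e p \<and> c \<noteq> 0 \<and>
    [:- \<delta>, 1:] * p = [:- (\<delta> * c), 1:] * Q \<and> reflect_poly Q = Q \<and> Q \<noteq> 0"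
  using assms
proof (induction arbitrary: \<delta> rule: cyclic_sum.induct)
  case zero
  have "realizes_chain K {0} (\<lambda>x. 0) 0 1"
    unfolding realizes_chain_def
    by (auto simp: endo.linear_zero lin_simps[OF K] lin_simps subspace_0 one_pCons pact_pCons intro!: exI[of _ "\<lambda>x. 0"])
  then show ?case by (intro exI[of _ "\<lambda>x. 0"] exI[of _ 0] exI[of _ 1]) simp
next
  case (add W c f d)
  have W: "subspace W" "\<And>w. w \<in> W \<Longrightarrow> K w \<in> W" using cyclic_sum_subspace[OF add.hyps(1)] by auto
  \<comment> \<open>A factor t of \<open>f\<close> could be cancelled because \<open>K\<close> is
    injective, contradicting that \<open>f\<close> divides every annihilator of
    \<open>d\<close>.\<close>
  have f0: "coeff f 0 \<noteq> 0"
  proof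
    assume "coeff f 0 = 0"
    then obtain f' where f': "f = pCons 0 f'" by (metis coeff_pCons_0 pCons_cases)
    then have "K (pact K f' d) = K 0" using add.hyps(2) by (simp add: pact_pCons[OF K] lin_simps[OF K])
    then have "pact K f' d = 0" using add.prems(1) by (simp add: inj_eq)
    then have "f dvd f'" using add.hyps(5)[of f'] subspace_0[OF W(1)] by simp
    moreover have "f' \<noteq> 0" using f' add.hyps(4) by auto
    ultimately have "degree f \<le> degree f'" by (rule dvd_imp_degree_le)
    then show False using f' \<open>f' \<noteq> 0\<close> by simp
  qed
  define \<gamma> where "\<gamma> = \<delta> * coeff f 0"
  define \<alpha> where "\<alpha> = inverse \<delta>"
  have \<gamma>: "\<gamma> \<noteq> 0" using f0 add.prems(2) by (simp add: \<gamma>_def)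
  have \<alpha>: "coeff f 0 = \<alpha> * \<gamma>" "\<delta> * \<alpha> = 1" "\<alpha> \<noteq> 0" using add.prems(2) by (simp_all add: \<gamma>_def \<alpha>_def)
  obtain L' e' p' Q' where ch: "realizes_chain K W L' e' p'" and c: "c \<noteq> 0" and
    p'Q': "[:- \<gamma>, 1:] * p' = [:- (\<gamma> * c), 1:] * Q'" and Q': "reflect_poly Q' = Q'" "Q' \<noteq> 0"
    using add.IH[OF add.prems(1) \<gamma>] by blast
  obtain q v where q: "reflect_poly q = q" "coeff q 0 = 1" and qv: "[:- \<gamma>, 1:] * q = [:- \<gamma>:] +
      (\<Sum>j=1..<degree f. monom (coeff f j) (2 * j - 1) - monom (v j) (2 * j)) + monom 1 (2 * degree f - 1)"
    by (rule ex_palindromic_factor[OF \<gamma> add.hyps(4), of "coeff f"])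
  let ?p = "[:- \<alpha>, 1:] * ([:- \<gamma>, 1:] * q)"
  let ?Q = "([:- \<delta>, 1:] * [:- \<alpha>, 1:]) * (q * Q')"
  obtain L where L: "realizes_chain K {pact K h d + w | h w. w \<in> W} L d (?p * p')"
    using realizes_chain_add[OF W add.hyps(2-4) _ ch \<alpha>(1), of ?p v] add.hyps(5) qv by auto
  have "[:- \<delta>, 1:] * (?p * p') = [:- \<delta>, 1:] * [:- \<alpha>, 1:] * q * ([:- \<gamma>, 1:] * p')"
    by (simp only: ac_simps)
  also have "\<dots> = [:- (\<delta> * (coeff f 0 * c)), 1:] * ?Q"
    by (subst p'Q') (simp only: \<gamma>_def ac_simps)
  finally have 1: "[:- \<delta>, 1:] * (?p * p') = [:- (\<delta> * (coeff f 0 * c)), 1:] * ?Q" .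
  have "reflect_poly ([:- \<delta>, 1:] * [:- \<alpha>, 1:]) = [:- \<delta>, 1:] * [:- \<alpha>, 1:]"
    using add.prems(2) \<alpha>(2,3) by (simp add: reflect_poly_pCons algebra_simps)
  then have 2: "reflect_poly ?Q = ?Q" by (simp only: reflect_poly_mult[of _ "q * Q'"] reflect_poly_mult[of q] q Q')
  have "q \<noteq> 0" using q(2) by auto
  then have 3: "?Q \<noteq> 0" using Q'(2) by (simp only: mult_eq_0_iff) simp
  have "coeff f 0 * c \<noteq> 0" using f0 c by simp
  with L 1 2 3 show ?case by blast
qed

end

end

section \<open>Determinants of finitary automorphisms\<close>

context endomorphism_space
begin

definition finite_dim :: "'b set \<Rightarrow> bool" where
  "finite_dim W \<longleftrightarrow> (\<exists>E. finite E \<and> span E = W)"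

lemma finite_dim_subspace: "finite_dim W \<Longrightarrow> subspace W"
  by (auto simp: finite_dim_def)

lemma finite_independent: "finite_dim W \<Longrightarrow> independent B \<Longrightarrow> B \<subseteq> W \<Longrightarrow> finite B"
  using independent_span_bound by (auto simp: finite_dim_def)

lemma finite_dim_subset:
  assumes "finite_dim W" "subspace D" "D \<subseteq> W" shows "finite_dim D"
proof -
  obtain B where B: "independent B" "span B = D" by (rule basis_of_subspace[OF assms(2)])
  have "B \<subseteq> W" using B(2) assms(3) span_superset by blast
  then show ?thesis using finite_independent[OF assms(1) B(1)] B(2) by (auto simp: finite_dim_def)
qed

lemma finite_dim_image: "lin f \<Longrightarrow> finite_dim W \<Longrightarrow> finite_dim (f ` W)"
  unfolding finite_dim_def using endo.linear_span_image by (metis finite_imageI)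

lemma finite_dim_Un: "finite_dim V \<Longrightarrow> finite_dim W \<Longrightarrow> finite_dim (span (V \<union> W))"
proof -
  assume "finite_dim V" "finite_dim W"
  then obtain E F where "finite E" "finite F" "span E = V" "span F = W" by (auto simp: finite_dim_def)
  moreover have "span (span E \<union> span F) = span (E \<union> F)"
    by (rule antisym; rule span_minimal) (auto intro: span_base dest: span_mono[THEN subsetD, rotated])
  ultimately show ?thesis unfolding finite_dim_def by (metis finite_UnI)
qed

lemma basis_list_extend:
  assumes "finite_dim W" "local.basis_list bs D" "D \<subseteq> W"
  obtains cs where "local.basis_list (bs @ cs) W"
proof -
  have bs: "distinct bs" "independent (set bs)" "span (set bs) = D"
    using assms(2) by (auto simp: basis_list_def)
  then have "set bs \<subseteq> W" using assms(3) span_superset by blast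
  then obtain B where B: "set bs \<subseteq> B" "B \<subseteq> W" "independent B" "W \<subseteq> span B"
    using maximal_independent_subset_extend[OF _ bs(2)] by metis
  have "finite B" using finite_independent[OF assms(1) B(3,2)] .
  then obtain cs where cs: "set cs = B - set bs" "distinct cs" using finite_distinct_list[of "B - set bs"] by auto
  have "span B = W" using B(2,4) finite_dim_subspace[OF assms(1)] span_subspace by blast
  then have "local.basis_list (bs @ cs) W"
    using cs bs B by (auto simp: basis_list_def Un_absorb1)
  then show thesis by (rule that)
qed

lemma ex_basis_list:
  assumes "finite_dim W" shows "\<exists>bs. local.basis_list bs W"
proof -
  have "local.basis_list [] {0}" by (simp add: basis_list_def independent_empty)
  moreover have "{0} \<subseteq> W" using finite_dim_subspace[OF assms] subspace_0 by simp
  ultimately obtain cs where "local.basis_list ([] @ cs) W" by (rule basis_list_extend[OF assms])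
  then show ?thesis by auto
qed

lemma det_on_id:
  assumes W: "finite_dim W" and f: "lin f" "\<And>x. x \<in> W \<Longrightarrow> f x = x"
  shows "local.det_on W f = 1"
proof -
  obtain bs where bs: "local.basis_list bs W" using ex_basis_list[OF W] by blast
  have sub: "set bs \<subseteq> W" using bs span_superset by (auto simp: basis_list_def)
  have "local.matrix_wrt bs f = 1\<^sub>m (length bs)"
    using bs sub f(2)
    by (intro eq_matI) (auto simp: matrix_wrt_def basis_list_def representation_basis nth_eq_iff_index_eq subset_iff)
  then show ?thesis
    using det_on_eq_det_matrix_wrt[OF bs f(1)] f(2) by (auto simp: image_subset_iff)
qed

lemma det_on_comp:
  assumes W: "finite_dim W" and f: "lin f" "f ` W \<subseteq> W" and g: "lin g" "g ` W \<subseteq> W"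
  shows "local.det_on W (\<lambda>x. f (g x)) = local.det_on W f * local.det_on W g"
proof -
  obtain bs where bs: "local.basis_list bs W" using ex_basis_list[OF W] by blast
  have b: "distinct bs" "independent (set bs)" "span (set bs) = W" using bs by (auto simp: basis_list_def)
  let ?R = "representation (set bs)"
  have in_W: "y \<in> W" if "y \<in> set bs" for y using that b span_base by blast
  have "local.matrix_wrt bs (\<lambda>x. f (g x)) = local.matrix_wrt bs f * local.matrix_wrt bs g"
  proof (rule eq_matI)
    fix i j
    assume "i < dim_row (local.matrix_wrt bs f * local.matrix_wrt bs g)"
      "j < dim_col (local.matrix_wrt bs f * local.matrix_wrt bs g)"
    then have ij: "i < length bs" "j < length bs" by (auto simp: matrix_wrt_def)
    let ?v = "g (bs ! j)"
    have v: "?v \<in> W" using g in_W ij by auto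
    have "f ?v = f (\<Sum>y\<in>set bs. scale (?R ?v y) y)"
      using sum_representation_eq[of "set bs" ?v "set bs"] b v by simp
    also have "\<dots> = (\<Sum>y\<in>set bs. scale (?R ?v y) (f y))" by (simp add: lin_simps[OF f(1)])
    finally have fv: "f ?v = (\<Sum>y\<in>set bs. scale (?R ?v y) (f y))" .
    have "scale (?R ?v y) (f y) \<in> span (set bs)" if "y \<in> set bs" for y
      using f(2) in_W[OF that] b(3) by (intro span_scale) auto
    from representation_sum[OF b(2) this, of "set bs" "\<lambda>y. y"]
    have "?R (f ?v) (bs ! i) = (\<Sum>y\<in>set bs. ?R (scale (?R ?v y) (f y)) (bs ! i))" by (simp add: fv)
    also have "\<dots> = (\<Sum>y\<in>set bs. ?R ?v y * ?R (f y) (bs ! i))"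
      using b f(2) in_W by (intro sum.cong) (auto simp: representation_scale image_subset_iff)
    also have "\<dots> = (\<Sum>k<length bs. ?R ?v (bs ! k) * ?R (f (bs ! k)) (bs ! i))"
      using b(1) by (intro sum.reindex_bij_betw[symmetric] bij_betw_nth) auto
    finally show "local.matrix_wrt bs (\<lambda>x. f (g x)) $$ (i, j) =
        (local.matrix_wrt bs f * local.matrix_wrt bs g) $$ (i, j)"
      using ij by (simp add: matrix_wrt_def scalar_prod_def mult.commute lessThan_atLeast0)
  qed (auto simp: matrix_wrt_def)
  moreover have "local.matrix_wrt bs h \<in> carrier_mat (length bs) (length bs)" for h
    by (simp add: matrix_wrt_def)
  moreover have "(\<lambda>x. f (g x)) ` W \<subseteq> W" using f(2) g(2) by auto
  ultimately show ?thesis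
    using det_on_eq_det_matrix_wrt[OF bs] f g lin_comp[OF f(1) g(1)] det_mult by metis
qed

text \<open>Invariance of the span of the first basis vectors makes the matrix block upper
  triangular.\<close>

lemma det_matrix_wrt_append:
  assumes bs: "local.basis_list (bs @ cs) W" and f: "f ` span (set bs) \<subseteq> span (set bs)"
  shows "det (local.matrix_wrt (bs @ cs) f) = det (local.matrix_wrt bs f) *
    det (mat (length cs) (length cs) (\<lambda>(i, j). representation (set (bs @ cs)) (f (cs ! j)) (cs ! i)))"
proof -
  let ?R = "representation (set (bs @ cs))"
  let ?B = "mat (length bs) (length cs) (\<lambda>(i, j). ?R (f (cs ! j)) (bs ! i))"
  let ?D = "mat (length cs) (length cs) (\<lambda>(i, j). ?R (f (cs ! j)) (cs ! i))"
  have ind: "independent (set (bs @ cs))" "distinct (bs @ cs)" using bs by (auto simp: basis_list_def)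
  have R: "?R (f b) = representation (set bs) (f b)" if "b \<in> set bs" for b
    using representation_extend[OF ind(1), of "f b" "set bs"] f that span_base by (auto simp: image_subset_iff)
  have R0: "representation (set bs) v c = 0" if "c \<in> set cs" for v c
    using representation_ne_zero[of "set bs" v c] that ind(2) by auto
  have "local.matrix_wrt (bs @ cs) f =
      four_block_mat (local.matrix_wrt bs f) ?B (0\<^sub>m (length cs) (length bs)) ?D"
    by (rule eq_matI) (auto simp: matrix_wrt_def nth_append R[simplified] R0)
  then show ?thesis
    using det_four_block_mat_lower_left_zero[of "local.matrix_wrt bs f" "length bs" ?B "length cs"]
    by (simp add: matrix_wrt_def)
qed

text \<open>In a basis of \<open>W\<close> extending one of \<open>D\<close> the lower right block
  is the identity, because \<open>f\<close> is trivial modulo \<open>D\<close>.\<close>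

lemma det_on_restrict:
  assumes W: "finite_dim W" and D: "subspace D" "D \<subseteq> W" and f: "lin f" "f ` D \<subseteq> D"
    and fD: "\<And>x. x \<in> W \<Longrightarrow> f x - x \<in> D"
  shows "local.det_on W f = local.det_on D f"
proof -
  have "finite_dim D" by (rule finite_dim_subset[OF W D])
  then obtain bs where bs: "local.basis_list bs D" using ex_basis_list by blast
  obtain cs where bc: "local.basis_list (bs @ cs) W" by (rule basis_list_extend[OF W bs D(2)])
  have b: "independent (set (bs @ cs))" "distinct (bs @ cs)" "span (set bs) = D" "span (set (bs @ cs)) = W"
    using bs bc by (auto simp: basis_list_def)
  have fW: "f ` W \<subseteq> W"
  proof (rule image_subsetI)
    fix x assume "x \<in> W"
    then have "(f x - x) + x \<in> W"
      using fD D(2) by (intro subspace_add[OF finite_dim_subspace[OF W]]) auto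
    then show "f x \<in> W" by simp
  qed
  have "representation (set (bs @ cs)) (f (cs ! j)) (cs ! i) = (if i = j then 1 else 0)"
    if ij: "i < length cs" "j < length cs" for i j
  proof -
    let ?c = "cs ! j"
    have c: "?c \<in> W" using ij b(4) span_base by (metis Un_iff nth_mem set_append)
    then have d: "f ?c - ?c \<in> D" by (rule fD)
    have "representation (set (bs @ cs)) (f ?c - ?c) = representation (set bs) (f ?c - ?c)"
      using representation_extend[OF b(1), of "f ?c - ?c" "set bs"] d b(3) by simp
    moreover have "representation (set bs) (f ?c - ?c) (cs ! i) = 0"
      using representation_ne_zero[of "set bs" "f ?c - ?c" "cs ! i"] b(2) ij by auto
    moreover have "representation (set (bs @ cs)) (f ?c - ?c + ?c) =
        (\<lambda>x. representation (set (bs @ cs)) (f ?c - ?c) x + representation (set (bs @ cs)) ?c x)"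
      using c d D(2) by (intro representation_add) (simp_all only: b(1,4), auto)
    moreover have "representation (set (bs @ cs)) ?c = (\<lambda>v. if v = ?c then 1 else 0)"
      using ij by (intro representation_basis b(1)) auto
    ultimately show ?thesis using b(2) ij by (simp add: nth_eq_iff_index_eq)
  qed
  then have "mat (length cs) (length cs) (\<lambda>(i, j). representation (set (bs @ cs)) (f (cs ! j)) (cs ! i)) =
      1\<^sub>m (length cs)"
    by (intro eq_matI) auto
  then have "det (local.matrix_wrt (bs @ cs) f) = det (local.matrix_wrt bs f)"
    using det_matrix_wrt_append[OF bc, of f] f(2) b(3) by simp
  then show ?thesis
    using det_on_eq_det_matrix_wrt[OF bs f] det_on_eq_det_matrix_wrt[OF bc f(1) fW] by simp
qed

lemma det_matrix_wrt_direct_sum: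
  assumes bc: "local.basis_list (bs @ cs) W" and f: "f ` span (set bs) \<subseteq> span (set bs)"
    "f ` span (set cs) \<subseteq> span (set cs)"
  shows "det (local.matrix_wrt (bs @ cs) f) = det (local.matrix_wrt bs f) * det (local.matrix_wrt cs f)"
proof -
  have ind: "independent (set (bs @ cs))" using bc by (auto simp: basis_list_def)
  have "representation (set (bs @ cs)) (f c) = representation (set cs) (f c)" if "c \<in> set cs" for c
    using representation_extend[OF ind, of "f c" "set cs"] f(2) that span_base by (auto simp: image_subset_iff)
  then have "mat (length cs) (length cs) (\<lambda>(i, j). representation (set (bs @ cs)) (f (cs ! j)) (cs ! i)) =
      local.matrix_wrt cs f"
    by (intro eq_matI) (auto simp: matrix_wrt_def)
  then show ?thesis using det_matrix_wrt_append[OF bc f(1)] by simp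
qed

text \<open>The sign is (-1) to the power of the dimension. Leaving it open suffices, as the
  characterization asks for the determinant up to sign.\<close>

lemma det_on_uminus:
  assumes W: "finite_dim W" and f: "lin f" "f ` W \<subseteq> W"
  shows "local.det_on W (\<lambda>x. - f x) = local.det_on W f \<or> local.det_on W (\<lambda>x. - f x) = - local.det_on W f"
proof -
  obtain bs where bs: "local.basis_list bs W" using ex_basis_list[OF W] by blast
  have b: "independent (set bs)" "span (set bs) = W" using bs by (auto simp: basis_list_def)
  have sW: "set bs \<subseteq> W" using b(2) span_superset by blast
  have "local.matrix_wrt bs (\<lambda>x. - f x) = (-1) \<cdot>\<^sub>m local.matrix_wrt bs f"
  proof (rule eq_matI)
    fix i j
    assume "i < dim_row ((-1) \<cdot>\<^sub>m local.matrix_wrt bs f)" "j < dim_col ((-1) \<cdot>\<^sub>m local.matrix_wrt bs f)"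
    then have ij: "i < length bs" "j < length bs" by (auto simp: matrix_wrt_def)
    then have "f (bs ! j) \<in> span (set bs)" using f(2) b(2) sW by (metis image_subset_iff nth_mem subsetD)
    then show "local.matrix_wrt bs (\<lambda>x. - f x) $$ (i, j) = ((-1) \<cdot>\<^sub>m local.matrix_wrt bs f) $$ (i, j)"
      using ij b(1) by (simp add: matrix_wrt_def representation_neg)
  qed (auto simp: matrix_wrt_def)
  moreover have "(\<lambda>x. - f x) ` W \<subseteq> W"
    using f(2) finite_dim_subspace[OF W] subspace_neg by auto
  ultimately have "local.det_on W (\<lambda>x. - f x) = (-1) ^ length bs * local.det_on W f"
    using det_on_eq_det_matrix_wrt[OF bs f] det_on_eq_det_matrix_wrt[OF bs endo.linear_compose_neg[OF f(1)]]
    by (simp add: matrix_wrt_def)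
  then show ?thesis by (cases "even (length bs)") simp_all
qed

text \<open>The determinant of a map that differs from the identity by finite rank. The range of f -
  1 is the least subspace to compute it on; every finite-dimensional subspace containing it gives
  the same value.\<close>

definition finitary_det :: "('b \<Rightarrow> 'b) \<Rightarrow> 'a" where
  "finitary_det f = local.det_on (range (\<lambda>x. f x - x)) f"

lemma subspace_range_minus_id:
  assumes "lin f" shows "subspace (range (\<lambda>x. f x - x))"
  using endo.linear_subspace_image[OF endo.linear_compose_sub[OF assms linear_ident] subspace_UNIV] .

lemma det_on_eq_finitary_det:
  assumes W: "finite_dim W" and f: "lin f" "range (\<lambda>x. f x - x) \<subseteq> W"
  shows "local.det_on W f = finitary_det f"
  unfolding finitary_det_def
proof (rule det_on_restrict[OF W subspace_range_minus_id[OF f(1)] f(2) f(1)])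
  show "f ` range (\<lambda>x. f x - x) \<subseteq> range (\<lambda>x. f x - x)"
    by (auto simp: lin_simps[OF f(1)])
qed auto

lemma image_subset_if_range_minus_id:
  assumes "subspace W" "range (\<lambda>x. f x - x) \<subseteq> W" shows "f ` W \<subseteq> W"
proof (rule image_subsetI)
  fix x assume "x \<in> W"
  then have "(f x - x) + x \<in> W" using assms by (intro subspace_add) auto
  then show "f x \<in> W" by simp
qed

lemma finitary_det_comp:
  assumes f: "lin f" "finite_dim (range (\<lambda>x. f x - x))" and g: "lin g" "finite_dim (range (\<lambda>x. g x - x))"
  shows "finitary_det (\<lambda>x. f (g x)) = finitary_det f * finitary_det g"
proof -
  define W where "W = span (range (\<lambda>x. f x - x) \<union> range (\<lambda>x. g x - x))"
  have W: "finite_dim W" unfolding W_def by (rule finite_dim_Un[OF f(2) g(2)])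
  have sW: "subspace W" by (rule finite_dim_subspace[OF W])
  have sub: "range (\<lambda>x. f x - x) \<subseteq> W" "range (\<lambda>x. g x - x) \<subseteq> W"
    unfolding W_def by (auto intro: span_base)
  have "f (g x) - x \<in> W" for x
  proof -
    have "(f (g x) - g x) + (g x - x) \<in> W" using sub by (intro subspace_add[OF sW]) auto
    then show ?thesis by simp
  qed
  then have fg: "range (\<lambda>x. f (g x) - x) \<subseteq> W" by auto
  show ?thesis
    using det_on_comp[OF W f(1) image_subset_if_range_minus_id[OF sW sub(1)]
        g(1) image_subset_if_range_minus_id[OF sW sub(2)]]
      det_on_eq_finitary_det[OF W f(1) sub(1)] det_on_eq_finitary_det[OF W g(1) sub(2)]
      det_on_eq_finitary_det[OF W lin_comp[OF f(1) g(1)] fg] by simp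
qed

text \<open>Everything is computed on \<open>S\<close>, where the determinants of \<open>h\<close>
  and \<open>h'\<close> are mutually inverse.\<close>

lemma finitary_det_conj:
  assumes f: "lin f" and h: "lin h" "lin h'" "\<And>x. h (h' x) = x"
    and S: "finite_dim S" "h ` S \<subseteq> S" "h' ` S \<subseteq> S" "range (\<lambda>x. f x - x) \<subseteq> S"
  shows "finitary_det (\<lambda>x. h (f (h' x))) = finitary_det f"
    "range (\<lambda>x. h (f (h' x)) - x) \<subseteq> S"
proof -
  show r: "range (\<lambda>x. h (f (h' x)) - x) \<subseteq> S"
  proof (rule image_subsetI)
    fix x
    have "f (h' x) - h' x \<in> S" using S(4) by blast
    then have "h (f (h' x) - h' x) \<in> S" using S(2) by blast
    then show "h (f (h' x)) - x \<in> S" by (simp only: lin_simps[OF h(1)] h(3))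
  qed
  have fS: "f ` S \<subseteq> S" by (rule image_subset_if_range_minus_id[OF finite_dim_subspace[OF S(1)] S(4)])
  have fhS: "(\<lambda>x. f (h' x)) ` S \<subseteq> S" using fS S(3) by auto
  have "local.det_on S h * local.det_on S h' = 1"
    using det_on_comp[OF S(1) h(1) S(2) h(2) S(3)] det_on_id[OF S(1) lin_comp[OF h(1,2)]] h(3) by simp
  then show "finitary_det (\<lambda>x. h (f (h' x))) = finitary_det f"
    using det_on_comp[OF S(1) h(1) S(2) lin_comp[OF f h(2)] fhS] det_on_comp[OF S(1) f fS h(2) S(3)]
      det_on_eq_finitary_det[OF S(1) f S(4)]
      det_on_eq_finitary_det[OF S(1) lin_comp[OF h(1) lin_comp[OF f h(2)]] r]
    by (simp add: mult.left_commute)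
qed

text \<open>\<open>a\<close> is the identity on the kernel of a - 1 in \<open>W\<close>, and a - 1
  maps \<open>W\<close> into that kernel.\<close>

lemma det_on_unipotent_index2:
  assumes W: "finite_dim W" and a: "local.unipotent_index2 a" and aW: "\<And>x. x \<in> W \<Longrightarrow> a x - x \<in> W"
  shows "local.det_on W a = 1"
proof -
  have a': "lin a" "\<And>x. a (a x - x) - (a x - x) = 0"
    using a by (auto simp: unipotent_index2_def fun_eq_iff)
  define D where "D = W \<inter> {x. a x - x = 0}"
  have "subspace {x. a x - x = 0}"
    using endo.linear_subspace_kernel[OF endo.linear_compose_sub[OF a'(1) linear_ident]] .
  then have D: "subspace D" "D \<subseteq> W"
    using finite_dim_subspace[OF W] subspace_inter by (auto simp: D_def)
  have "local.det_on W a = local.det_on D a"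
    by (rule det_on_restrict[OF W D a'(1)]) (use a'(2) aW in \<open>auto simp: D_def\<close>)
  also have "\<dots> = 1" by (rule det_on_id[OF finite_dim_subset[OF W D] a'(1)]) (auto simp: D_def)
  finally show ?thesis .
qed

text \<open>With u = a b c, the product (b u b) (a^-1 u a) collapses to (b a b) a. Its determinant
  is the square of that of \<open>u\<close>; on the other hand both b a b and \<open>a\<close> are
  unipotent of index 2 and have determinant 1 on a suitable finite-dimensional subspace.\<close>

lemma finitary_det_factorizable:
  assumes "factorizable u" and fin: "finite_dim (range (\<lambda>x. u x - x))"
  shows "finitary_det u = 1 \<or> finitary_det u = - 1"
proof -
  obtain a b c where abc: "local.unipotent_index2 a" "local.involution b" "local.involution c" "u = a \<circ> b \<circ> c"
    using assms(1) by (auto simp: factorizable_def)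
  have a: "lin a" "\<And>x. a (a x - x) - (a x - x) = 0"
    using abc(1) by (auto simp: unipotent_index2_def fun_eq_iff)
  have b: "lin b" "\<And>x. b (b x) = x" and c: "lin c" "\<And>x. c (c x) = x"
    using abc(2,3) by (auto simp: involution_def fun_eq_iff)
  have u: "lin u" "\<And>x. u x = a (b (c x))"
    using abc(4) lin_comp[OF a(1) lin_comp[OF b(1) c(1)]] by (auto simp: comp_def)
  have aa: "a (a x) = a x + a x - x" for x using a(2)[of x] by (simp add: lin_simps[OF a(1)] algebra_simps)
  \<comment> \<open>The inverse 2 - a of \<open>a\<close>, by (a - 1)^2 = 0.\<close>
  define a' where "a' x = x + x - a x" for x
  have a': "lin a'" "\<And>x. a (a' x) = x" "\<And>x. a' (a x) = x"
    unfolding a'_def using linI[of "\<lambda>x. x + x - a x"]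
    by (auto simp: lin_simps[OF a(1)] aa scale_right_distrib scale_right_diff_distrib algebra_simps)
  define D where "D = range (\<lambda>x. u x - x)"
  have D: "finite_dim D" using fin by (simp add: D_def)
  have sup: "D \<subseteq> span (D \<union> f ` D)" for f by (auto intro: span_base)
  have stab: "g ` span (D \<union> f ` D) \<subseteq> span (D \<union> f ` D)"
    if g: "lin g" and "\<And>x. x \<in> D \<Longrightarrow> g x \<in> span (D \<union> f ` D)"
      "\<And>x. x \<in> D \<Longrightarrow> g (f x) \<in> span (D \<union> f ` D)" for f g
    unfolding endo.linear_span_image[OF g, symmetric]
    by (rule span_minimal) (use that in auto)
  have Db: "finite_dim (span (D \<union> b ` D))" by (rule finite_dim_Un[OF D finite_dim_image[OF b(1) D]])
  have bS: "b ` span (D \<union> b ` D) \<subseteq> span (D \<union> b ` D)"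
    by (rule stab[OF b(1)]) (auto simp: b(2) intro: span_base)
  have ub: "finitary_det (\<lambda>x. b (u (b x))) = finitary_det u"
    "range (\<lambda>x. b (u (b x)) - x) \<subseteq> span (D \<union> b ` D)"
    using finitary_det_conj[OF u(1) b(1,1) b(2) Db bS bS] sup[of b] by (simp_all add: D_def)
  have Da: "finite_dim (span (D \<union> a ` D))" by (rule finite_dim_Un[OF D finite_dim_image[OF a(1) D]])
  have aS: "a ` span (D \<union> a ` D) \<subseteq> span (D \<union> a ` D)"
    by (rule stab[OF a(1)]) (auto simp: aa intro!: span_add span_diff intro: span_base)
  have a'S: "a' ` span (D \<union> a ` D) \<subseteq> span (D \<union> a ` D)"
    by (rule stab[OF a'(1)]) (auto simp: a'(3), auto simp: a'_def intro!: span_add span_diff intro: span_base)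
  have ua: "finitary_det (\<lambda>x. a' (u (a x))) = finitary_det u"
    "range (\<lambda>x. a' (u (a x)) - x) \<subseteq> span (D \<union> a ` D)"
    using finitary_det_conj[OF u(1) a'(1) a(1) a'(3) Da a'S aS] sup[of a] by (simp_all add: D_def)
  define F where "F x = b (a (b (a x)))" for x
  have F: "lin F" unfolding F_def by (rule lin_comp[OF b(1) lin_comp[OF a(1) lin_comp[OF b(1) a(1)]]])
  have Fu: "F x = b (u (b (a' (u (a x)))))" for x
    by (simp add: F_def u(2) a'(3) b(2) c(2))
  define ub where "ub x = b (u (b x))" for x
  define ua where "ua x = a' (u (a x))" for x
  have lub: "lin ub" unfolding ub_def by (rule lin_comp[OF b(1) lin_comp[OF u(1) b(1)]])
  have lua: "lin ua" unfolding ua_def by (rule lin_comp[OF a'(1) lin_comp[OF u(1) a(1)]])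
  note ub = ub[folded ub_def] and ua = ua[folded ua_def]
  have finF: "finite_dim (range (\<lambda>x. ub x - x))" "finite_dim (range (\<lambda>x. ua x - x))"
    using finite_dim_subset[OF Db subspace_range_minus_id[OF lub] ub(2)]
      finite_dim_subset[OF Da subspace_range_minus_id[OF lua] ua(2)] .
  have Fu: "F = (\<lambda>x. ub (ua x))" by (simp add: Fu[folded ub_def ua_def] ub_def ua_def fun_eq_iff)
  have F_det: "finitary_det F = finitary_det u * finitary_det u"
    using finitary_det_comp[OF lub finF(1) lua finF(2)] ub(1) ua(1) by (simp add: Fu)
  define G where "G = range (\<lambda>x. F x - x)"
  have "F x - x \<in> span (span (D \<union> b ` D) \<union> span (D \<union> a ` D))" for x
  proof -
    let ?y = "ua x"
    have "(ub ?y - ?y) + (?y - x) \<in> span (span (D \<union> b ` D) \<union> span (D \<union> a ` D))"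
      using ub(2) ua(2) by (intro span_add span_base) auto
    then show ?thesis by (simp add: Fu)
  qed
  then have G: "finite_dim G"
    unfolding G_def by (intro finite_dim_subset[OF finite_dim_Un[OF Db Da] subspace_range_minus_id[OF F]]) auto
  define n where "n x = a x - x" for x
  have n: "lin n" "\<And>x. n (n x) = 0" unfolding n_def using endo.linear_compose_sub[OF a(1) linear_ident] a(2) by auto
  \<comment> \<open>One image under \<open>n\<close> is enough for stability under \<open>n\<close>,
    as n^2 = 0.\<close>
  define W where "W = span (G \<union> n ` G)"
  have W: "finite_dim W" unfolding W_def by (rule finite_dim_Un[OF G finite_dim_image[OF n(1) G]])
  have nW: "n x \<in> W" if "x \<in> W" for x
  proof -
    have "n ` W \<subseteq> W" unfolding W_def endo.linear_span_image[OF n(1), symmetric]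
      by (rule span_minimal) (auto simp: n(2) intro: span_base span_zero)
    then show ?thesis using that by auto
  qed
  have sW: "subspace W" by (rule finite_dim_subspace[OF W])
  have aW: "a x - x \<in> W" if "x \<in> W" for x using nW[OF that] by (simp add: n_def)
  have GW: "G \<subseteq> W" unfolding W_def by (auto intro: span_base)
  let ?k = "\<lambda>x. b (a (b x))"
  \<comment> \<open>As b a b = F a^-1, the map b a b - 1 is the sum of (F - 1) a^-1 and a^-1 - 1,
    and both send \<open>W\<close> into itself.\<close>
  have kW: "?k x - x \<in> W" if x: "x \<in> W" for x
  proof -
    have "F (a' x) - a' x \<in> W" using GW by (auto simp: G_def)
    moreover have "F (a' x) = ?k x" by (simp add: F_def a'(2))
    moreover have "a' x - x = - n x" by (simp add: a'_def n_def)
    ultimately have "(?k x - a' x) + (a' x - x) \<in> W"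
      using nW[OF x] subspace_neg[OF sW] by (intro subspace_add[OF sW]) auto
    then show ?thesis by simp
  qed
  have k: "local.unipotent_index2 ?k"
    unfolding unipotent_index2_def fun_eq_iff
    using lin_comp[OF b(1) lin_comp[OF a(1) b(1)]]
    by (auto simp: lin_simps[OF b(1)] lin_simps[OF a(1)] b(2) aa)
  have img: "a ` W \<subseteq> W" "?k ` W \<subseteq> W"
    using subspace_add[OF sW aW] subspace_add[OF sW kW] by force+
  have "finitary_det F = local.det_on W F"
    using det_on_eq_finitary_det[OF W F] GW by (simp add: G_def)
  also have "\<dots> = local.det_on W ?k * local.det_on W a"
    unfolding F_def using det_on_comp[OF W lin_comp[OF b(1) lin_comp[OF a(1) b(1)]] img(2) a(1) img(1)] .
  also have "\<dots> = 1" using det_on_unipotent_index2[OF W k kW] det_on_unipotent_index2[OF W abc(1) aW] by simp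
  finally have "finitary_det u * finitary_det u = 1" using F_det by simp
  then show ?thesis by (simp add: square_eq_1_iff)
qed

end

section \<open>The characterization\<close>

context endomorphism_space
begin

section \<open>Determinant of a sum of companion blocks\<close>

lemma det_cyclic_block:
  assumes K: "lin K" and W: "subspace W"
    and f: "pact K f d = 0" "lead_coeff f = 1" "degree f = Suc n"
    and dvd: "\<forall>h. pact K h d \<in> W \<longrightarrow> f dvd h"
  defines "bs \<equiv> map (\<lambda>j. (K ^^ j) d) [0..<Suc n]"
  shows "det (local.matrix_wrt bs (\<lambda>v. - K v)) = coeff f 0"
proof -
  let ?D = "\<lambda>j. (K ^^ j) d"
  note cyc = cyclic_basis[OF K W f dvd]
  have set_bs: "set bs = ?D ` {..<Suc n}" by (auto simp: bs_def lessThan_atLeast0 simp del: upt_Suc)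
  have ind: "independent (set bs)" unfolding set_bs by (rule cyc(2))
  have nth: "bs ! i = ?D i" if "i < Suc n" for i
    using that unfolding bs_def by (subst nth_map) (simp_all del: upt_Suc)
  have inj: "?D i = ?D j \<longleftrightarrow> i = j" if "i < Suc n" "j < Suc n" for i j
    using cyc(1) that by (auto simp: inj_on_def)
  have D: "?D i \<in> set bs" if "i < Suc n" for i unfolding set_bs using that by blast
  have repD: "representation (set bs) (?D j) (?D i) = (if i = j then 1 else 0)" if "i < Suc n" "j < Suc n" for i j
    using representation_basis[OF ind D[OF that(2)]] inj[OF that] by simp
  define M where "M = local.matrix_wrt bs (\<lambda>v. - K v)"
  have len: "length bs = Suc n" by (simp add: bs_def)
  have M: "M \<in> carrier_mat (Suc n) (Suc n)" by (simp add: M_def matrix_wrt_def len)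
  \<comment> \<open>The negative of a companion matrix: -1 below the diagonal, and the coefficients
    of \<open>f\<close> in the last column, where two signs cancel.\<close>
  have Mij: "M $$ (i, j) = (if j = n then coeff f i else if i = Suc j then -1 else 0)"
    if ij: "i < Suc n" "j < Suc n" for i j
  proof (cases "j = n")
    case True
    have "- K (?D n) = (\<Sum>k<Suc n. scale (coeff f k) (?D k))"
      using cyclic_top_power[OF K W f dvd] by simp
    moreover have "representation (set bs) (\<Sum>k<Suc n. scale (coeff f k) (?D k)) (?D i) =
        (\<Sum>k<Suc n. representation (set bs) (scale (coeff f k) (?D k)) (?D i))"
      by (subst representation_sum[OF ind]) (auto intro: span_scale span_base D)
    moreover have "\<dots> = (\<Sum>k<Suc n. if k = i then coeff f i else 0)"
      by (rule sum.cong) (auto simp: representation_scale[OF ind span_base[OF D]] repD[OF ij(1)])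
    ultimately show ?thesis
      using ij True by (simp add: M_def matrix_wrt_def len nth del: sum.lessThan_Suc)
  next
    case False
    then have "K (?D j) = ?D (Suc j)" "Suc j < Suc n" using ij by auto
    then show ?thesis
      using ij False by (simp add: M_def matrix_wrt_def len nth representation_neg[OF ind span_base[OF D]] repD
        del: funpow.simps)
  qed
  \<comment> \<open>In the first row only the last entry can be nonzero; the sign of its position
    cancels that of its minor.\<close>
  have "mat_delete M 0 n = (-1) \<cdot>\<^sub>m 1\<^sub>m n"
    using M by (intro eq_matI) (auto simp: mat_delete_def Mij)
  then have "det (mat_delete M 0 n) = (-1) ^ n" by simp
  then have "cofactor M 0 n = 1"
    by (simp add: cofactor_def power_add[symmetric] flip: mult_2)
  moreover have "det M = (\<Sum>j<Suc n. M $$ (0, j) * cofactor M 0 j)"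
    by (rule laplace_expansion_row[OF M]) simp
  moreover have "\<dots> = (\<Sum>j<Suc n. if j = n then coeff f 0 * cofactor M 0 n else 0)"
    by (rule sum.cong) (auto simp: Mij)
  ultimately show ?thesis by (simp add: M_def del: sum.lessThan_Suc)
qed

text \<open>In a joint basis of the blocks the determinants multiply. For K = - u this identifies
  the scalar of the decomposition with the determinant of \<open>u\<close>.\<close>

lemma det_cyclic_sum:
  assumes K: "lin K"
  shows "cyclic_sum K W c \<Longrightarrow> \<exists>bs. local.basis_list bs W \<and> det (local.matrix_wrt bs (\<lambda>v. - K v)) = c"
proof (induction rule: cyclic_sum.induct)
  case zero
  have "local.basis_list [] {0}" by (simp add: basis_list_def independent_empty)
  moreover have "det (local.matrix_wrt [] (\<lambda>v. - K v)) = 1" by (rule det_dim_zero) (simp add: matrix_wrt_def)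
  ultimately show ?case by blast
next
  case (add W c f d)
  obtain cs where cs: "local.basis_list cs W" "det (local.matrix_wrt cs (\<lambda>v. - K v)) = c"
    using add.IH by blast
  obtain n where n: "degree f = Suc n" using add.hyps(4) by (cases "degree f") auto
  have W: "subspace W" "\<And>w. w \<in> W \<Longrightarrow> K w \<in> W" using cyclic_sum_subspace[OF K add.hyps(1)] by auto
  have dvd: "\<forall>h. pact K h d \<in> W \<longrightarrow> f dvd h" using add.hyps(5) by blast
  let ?D = "\<lambda>j. (K ^^ j) d"
  define bs where "bs = map ?D [0..<Suc n]"
  define U where "U = {pact K h d + w | h w. w \<in> W}"
  note f = add.hyps(2,3) n
  note cyc = cyclic_basis[OF K W(1) f dvd]
  have set_bs: "set bs = ?D ` {..<Suc n}" by (auto simp: bs_def lessThan_atLeast0 simp del: upt_Suc)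
  have "distinct bs"
    using cyc(1) by (simp add: bs_def distinct_map lessThan_atLeast0 del: upt_Suc)
  have c: "distinct cs" "independent (set cs)" "span (set cs) = W" using cs by (auto simp: basis_list_def)
  have ind: "independent (set bs)" unfolding set_bs by (rule cyc(2))
  have un: "independent (set bs \<union> set cs)" "set bs \<inter> set cs = {}"
    using independent_Un[OF ind c(2)] cyc(3) unfolding set_bs c(3) by blast+
  have "span (set bs \<union> set cs) = U"
  proof
    have "x \<in> U" if "x \<in> set bs \<union> set cs" for x
    proof (cases "x \<in> set bs")
      case True
      then obtain j where "x = pact K (monom 1 j) d + 0" unfolding set_bs by (auto simp: pact_monom[OF K])
      then show ?thesis unfolding U_def using subspace_0[OF W(1)] by blast
    next
      case False
      then have "x \<in> W" using that c(3) span_base by blast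
      moreover have "x = pact K 0 d + x" by simp
      ultimately show ?thesis unfolding U_def by blast
    qed
    then show "span (set bs \<union> set cs) \<subseteq> U"
      unfolding U_def by (intro span_minimal subspace_cyclic_extension[OF K W(1)]) (auto simp: subset_iff)
    show "U \<subseteq> span (set bs \<union> set cs)"
    proof
      fix x assume "x \<in> U"
      then obtain h w where x: "x = pact K h d + w" "w \<in> W" unfolding U_def by blast
      obtain a where a: "pact K h d = (\<Sum>j<Suc n. scale (a j) (?D j))"
        by (rule cyclic_form[OF K W(1) f dvd])
      have "pact K h d \<in> span (set bs \<union> set cs)"
        unfolding a by (intro span_sum span_scale span_base) (auto simp: set_bs)
      moreover have "w \<in> span (set bs \<union> set cs)" using x(2) c(3) span_mono[of "set cs" "set bs \<union> set cs"] by auto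
      ultimately show "x \<in> span (set bs \<union> set cs)" unfolding x(1) by (rule span_add)
    qed
  qed
  then have bc: "local.basis_list (bs @ cs) U"
    using un c(1) \<open>distinct bs\<close> by (simp add: basis_list_def)
  have K': "lin (\<lambda>v. - K v)" by (rule endo.linear_compose_neg[OF K])
  have "(\<lambda>v. - K v) ` span (set bs) \<subseteq> span (set bs)"
    unfolding endo.linear_span_image[OF K', symmetric]
  proof (rule span_minimal)
    show "(\<lambda>v. - K v) ` set bs \<subseteq> span (set bs)"
    proof clarify
      fix x assume "x \<in> set bs"
      then obtain j where j: "j < Suc n" "x = ?D j" unfolding set_bs by blast
      have D: "?D i \<in> span (set bs)" if "i < Suc n" for i using that by (intro span_base) (auto simp: set_bs)
      show "- K x \<in> span (set bs)"
      proof (cases "j = n")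
        case True
        have "- K x = (\<Sum>k<Suc n. scale (coeff f k) (?D k))"
          using cyclic_top_power[OF K W(1) f dvd] j True by simp
        then show ?thesis using D by (auto intro!: span_sum span_scale simp del: sum.lessThan_Suc)
      next
        case False
        then show ?thesis using D[of "Suc j"] j span_neg by simp
      qed
    qed
  qed simp
  moreover have "(\<lambda>v. - K v) ` span (set cs) \<subseteq> span (set cs)"
    using W subspace_neg[OF W(1)] c(3) by auto
  ultimately have "det (local.matrix_wrt (bs @ cs) (\<lambda>v. - K v)) =
      det (local.matrix_wrt bs (\<lambda>v. - K v)) * c"
    using det_matrix_wrt_direct_sum[OF bc] cs(2) by simp
  also have "det (local.matrix_wrt bs (\<lambda>v. - K v)) = coeff f 0"
    unfolding bs_def by (rule det_cyclic_block[OF K W(1) f dvd])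
  finally show ?case using bc unfolding U_def by blast
qed

text \<open>Reflection turns t - 1 into -(t - 1) and, for these values of \<open>c\<close>, t - c
  into -c (t - c); then the factor t - 1 cancels.\<close>

lemma reflect_poly_eq_smult:
  fixes p Q :: "'c::field poly"
  assumes c: "c = 1 \<or> c = -1" and pQ: "[:-1, 1:] * p = [:- c, 1:] * Q" and Q: "reflect_poly Q = Q"
  shows "reflect_poly p = smult c p"
proof -
  have eq: "[:1, -1:] * reflect_poly p = [:1, - c:] * Q"
    using arg_cong[OF pQ, of reflect_poly] c unfolding reflect_poly_mult Q
    by (auto simp: reflect_poly_pCons)
  have "[:1, - c:] * Q = smult (- c) ([:- c, 1:] * Q)" using c by auto
  also have "\<dots> = - [:-1, 1:] * smult c p"
    unfolding pQ[symmetric] by (simp only: mult_smult_right mult_minus_left smult_minus_left smult_minus_right)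
  also have "- [:-1, 1:] = [:1, -1 :: 'c:]" by simp
  finally have "[:1, -1:] * reflect_poly p = [:1, -1:] * smult c p" using eq by simp
  then show ?thesis by (simp only: mult_cancel_left) simp
qed

text \<open>In the normal form a perturbation \<open>g\<close> realizes the chain built for K = - u,
  with generator \<open>l e\<close> killed by p(g). As \<open>p\<close> is self-reciprocal up to
  sign, p(g^-1) kills \<open>l e\<close> too, and the universal property of the chain yields a map
  that fixes the generator and carries \<open>g\<close> to g^-1. Its square commutes with
  \<open>g\<close> and fixes the generator.\<close>

lemma factorizable_if_finitely_near_identity:
  assumes u: "lin u" "bij u" and Bs: "independent Bs" "span Bs = UNIV" "infinite Bs"
    and E: "independent E" "span E = range (\<lambda>x. u x - x)" "finite E"
    and det: "finitary_det u = 1 \<or> finitary_det u = -1"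
  shows "factorizable u"
proof -
  define D where "D = span E"
  have sD: "subspace D" by (simp add: D_def)
  have "|E| <o |Bs|" using E(3) Bs(3)
    by (intro finite_ordLess_infinite) (simp_all add: card_of_well_order_on Field_card_of)
  then obtain l R where l: "lin l" "\<And>d. d \<in> D \<Longrightarrow> u (l d) = l d + d" "inj_on l D"
    and disj: "l ` E \<inter> u ` l ` E = {}" "(l ` E \<union> u ` l ` E) \<inter> R = {}"
    and ind: "independent (l ` E \<union> u ` l ` E \<union> R)" "span (l ` E \<union> u ` l ` E \<union> R) = UNIV"
    and R: "\<And>r. r \<in> R \<Longrightarrow> u r = r"
    using near_identity_normal_form[OF u Bs E(1,2)] unfolding D_def by blast
  define K where "K v = - u v" for v
  have K: "lin K" unfolding K_def by (rule endo.linear_compose_neg[OF u(1)])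
  have "inj K" using u(2) by (auto simp: K_def inj_on_def bij_def)
  have uD: "u v \<in> D" if "v \<in> D" for v
  proof -
    have "u v - v \<in> D" using E(2) by (auto simp: D_def)
    then have "(u v - v) + v \<in> D" using that by (rule subspace_add[OF sD])
    then show ?thesis by simp
  qed
  have KD: "K v \<in> D" if "v \<in> D" for v using uD[OF that] subspace_neg[OF sD] by (simp add: K_def)
  obtain c where c: "cyclic_sum K D c"
    using finite_dimensional_cyclic_sum[OF K E(3) D_def[symmetric] KD] by blast
  obtain bs where bs: "local.basis_list bs D" "det (local.matrix_wrt bs (\<lambda>v. - K v)) = c"
    using det_cyclic_sum[OF K c] by blast
  have "local.det_on D u = c"
    using det_on_eq_det_matrix_wrt[OF bs(1) u(1)] uD bs(2) by (auto simp: K_def)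
  then have c1: "c = 1 \<or> c = -1" using det E(2) by (simp add: finitary_det_def D_def)
  \<comment> \<open>With \<delta> = 1 the outer factors of the telescoped product are t - 1 and t -
    c.\<close>
  obtain L e p Q where ch: "realizes_chain K D L e p" and pQ: "[:-1, 1:] * p = [:- c, 1:] * Q"
    and Q: "reflect_poly Q = Q"
    using cyclic_sum_chain[OF K c \<open>inj K\<close>, of 1] by auto
  have refl: "reflect_poly p = smult c p" by (rule reflect_poly_eq_smult[OF c1 pQ Q])
  have L: "lin L" "\<And>w. w \<in> D \<Longrightarrow> L w \<in> D" "e \<in> D" using ch by (auto simp: realizes_chain_def)
  define B where "B = l ` E \<union> u ` l ` E \<union> R"
  have B: "independent B" "span B = UNIV" using ind by (simp_all add: B_def)
  have iu: "lin (finv u)" by (rule lin_inv[OF u])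
  have [simp]: "finv u (u v) = v" "u (finv u v) = v" for v
    using u(2) by (simp_all add: bij_is_inj bij_is_surj surj_f_inv_f)
  have ul: "lin (\<lambda>v. u (l v))" by (rule lin_comp[OF u(1) l(1)])
  have injE: "inj_on l E" using l(3) inj_on_subset span_superset unfolding D_def by blast
  have [simp]: "inv_into E l (l x) = x" if "x \<in> E" for x using injE that by simp
  have ED: "x \<in> D" if "x \<in> E" for x using that by (simp add: D_def span_base)
  \<comment> \<open>Chosen so that g (u (l w)) = l (K w) + u (l (L w)): the last two terms cancel
    all of u (u (l w)) except l (K w).\<close>
  define Nw where "Nw w = u (l (L w)) - u (l w) + u (l (K w))" for w
  have Nwl: "lin Nw" unfolding Nw_def
    by (intro endo.linear_compose_add endo.linear_compose_sub ul lin_comp[OF ul L(1)] lin_comp[OF ul K])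
  define N where "N = endo.construct B (\<lambda>b. if b \<in> u ` l ` E then Nw (inv_into E l (finv u b)) else 0)"
  have N: "lin N" unfolding N_def by (rule endo.linear_construct[OF B(1)])
  have NB: "N b = (if b \<in> u ` l ` E then Nw (inv_into E l (finv u b)) else 0)" if "b \<in> B" for b
    unfolding N_def by (rule endo.construct_basis[OF B(1) that])
  have Nul: "N (u (l w)) = Nw w" if "w \<in> D" for w
    by (rule endo.linear_eq_on_span[OF lin_comp[OF N ul] Nwl _ that[unfolded D_def]])
      (subst NB, auto simp: B_def)
  have Nl: "N (l w) = 0" if "w \<in> D" for w
    by (rule endo.linear_eq_on_span[OF lin_comp[OF N l(1)] endo.linear_zero _ that[unfolded D_def]])
      (subst NB, use disj in \<open>auto simp: B_def\<close>)
  have RE: "r \<in> B" "r \<notin> l ` E" "r \<notin> u ` l ` E" if "r \<in> R" for r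
  proof -
    show "r \<in> B" using that by (simp add: B_def)
    show "r \<notin> l ` E" "r \<notin> u ` l ` E" using that disj(2) by blast+
  qed
  have NR: "N r = 0" if "r \<in> R" for r using NB[OF RE(1)[OF that]] RE(3)[OF that] by simp
  define A where "A = (\<lambda>v. u (l v)) ` D"
  have sA: "subspace A" unfolding A_def by (rule endo.linear_subspace_image[OF ul sD])
  have NwA: "Nw w \<in> A" if "w \<in> D" for w
    unfolding Nw_def using that L(2) KD by (intro subspace_add[OF sA] subspace_diff[OF sA]) (auto simp: A_def)
  have "range N \<subseteq> span ((\<lambda>b. if b \<in> u ` l ` E then Nw (inv_into E l (finv u b)) else 0) ` B)"
    unfolding N_def using endo.construct_in_span[OF B(1)] by blast
  also have "\<dots> \<subseteq> A"
    by (rule span_minimal[OF _ sA]) (use NwA ED subspace_0[OF sA] in auto)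
  finally have NA: "range N \<subseteq> A" .
  have AN: "N (finv u y) = 0" if "y \<in> A" for y using that Nl by (auto simp: A_def)
  define g where "g = (\<lambda>v. u v + N v)"
  have g: "lin g" "bij g" unfolding g_def by (rule perturbed_inverse[OF u N NA AN]; assumption)+
  define g' where "g' = finv g"
  have g': "lin g'" unfolding g'_def by (rule lin_inv[OF g])
  have gg' [simp]: "g' (g v) = v" "g (g' v) = v" for v
    using g(2) by (simp_all add: g'_def bij_is_inj bij_is_surj surj_f_inv_f)
  have "bij g'" unfolding g'_def using g(2) by (rule bij_imp_bij_inv)
  have gl: "g (l w) = u (l w)" if "w \<in> D" for w using Nl[OF that] by (simp add: g_def)
  have gul: "g (u (l w)) = l (K w) + u (l (L w))" if w: "w \<in> D" for w
  proof -
    have "u (u (l w)) = u (l w) + u w" using l(2)[OF w] by (simp add: lin_simps[OF u(1)])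
    moreover have "u w = l (K w) - u (l (K w))" using l(2)[OF KD[OF w]] by (simp add: K_def)
    ultimately show ?thesis by (simp add: g_def Nul[OF w] Nw_def)
  qed
  have rel: "\<forall>w\<in>D. g (g (l w)) = l (K w) + g (l (L w))" using gl gul L(2) by simp
  have gR: "g r = r" if "r \<in> R" for r using that R NR by (simp add: g_def)
  have pe: "pact g p (l e) = 0"
    and gen: "\<And>S. subspace S \<Longrightarrow> (\<forall>v. g v \<in> S \<longleftrightarrow> v \<in> S) \<Longrightarrow> l e \<in> S \<Longrightarrow> \<forall>w\<in>D. l w \<in> S"
    using ch g(1) l(1) rel unfolding realizes_chain_def by blast+
  have "scale c (pact g' p (l e)) = (g' ^^ degree p) (pact g p (l e))"
    using pact_reflect_poly[OF g(1) g' gg'(1), of p "l e"] unfolding refl pact_smult[OF g'] .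
  also have "(g' ^^ n) 0 = 0" for n by (induction n) (simp_all add: lin_simps[OF g'])
  then have "(g' ^^ degree p) (pact g p (l e)) = 0" by (simp only: pe)
  finally have "pact g' p (l e) = 0" using c1 by auto
  then obtain s where s: "lin s" "s e = l e" "\<And>w. w \<in> D \<Longrightarrow> g' (g' (s w)) = s (K w) + g' (s (L w))"
  proof -
    have "\<exists>s. lin s \<and> s e = l e \<and> (\<forall>w\<in>D. g' (g' (s w)) = s (K w) + g' (s (L w)))"
      using ch g' \<open>bij g'\<close> \<open>pact g' p (l e) = 0\<close> unfolding realizes_chain_def by simp
    then show thesis using that by blast
  qed
  \<comment> \<open>As g (l w) = u (l w), reversibility forces the value g^-1 (s w) at u (l
    w).\<close>
  define ph where "ph b = (if b \<in> l ` E then s (inv_into E l b)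
    else if b \<in> u ` l ` E then g' (s (inv_into E l (finv u b))) else b)" for b
  define sg where "sg = endo.construct B ph"
  have sg: "lin sg" unfolding sg_def by (rule endo.linear_construct[OF B(1)])
  have sgB: "sg b = ph b" if "b \<in> B" for b unfolding sg_def by (rule endo.construct_basis[OF B(1) that])
  have sgl: "sg (l w) = s w" if "w \<in> D" for w
    by (rule endo.linear_eq_on_span[OF lin_comp[OF sg l(1)] s(1) _ that[unfolded D_def]])
      (subst sgB, auto simp: B_def ph_def)
  have sgul: "sg (u (l w)) = g' (s w)" if "w \<in> D" for w
    by (rule endo.linear_eq_on_span[OF lin_comp[OF sg ul] lin_comp[OF g' s(1)] _ that[unfolded D_def]])
      (subst sgB, use disj in \<open>auto simp: B_def ph_def\<close>)
  have sgR: "sg r = r" if "r \<in> R" for r using sgB[OF RE(1)[OF that]] RE(2,3)[OF that] by (simp add: ph_def)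
  have gsg: "g (sg (g v)) = sg v" for v
  proof (rule lin_eq_on_basis[OF lin_comp[OF g(1) lin_comp[OF sg g(1)]] sg B(2)])
    fix b assume "b \<in> B"
    then consider x where "x \<in> D" "b = l x" | x where "x \<in> D" "b = u (l x)" | "b \<in> R"
      using ED by (auto simp: B_def)
    then show "g (sg (g b)) = sg b"
    proof cases
      case 2
      then have "sg (g b) = g' (g' (s x))"
        using s(3)[of x] KD L(2) by (simp add: gul lin_simps[OF sg] sgl sgul)
      then show ?thesis using 2 by (simp add: sgul)
    qed (simp_all add: gl sgl sgul gR sgR)
  qed
  define Fix where "Fix = {v. sg (sg v) = v}"
  have Fix: "subspace Fix" unfolding Fix_def by (rule subspaceI) (simp_all add: lin_simps[OF sg])
  have sgg': "sg (g' v) = g (sg v)" for v using gsg[of "g' v"] by simp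
  have sgg: "sg (g v) = g' (sg v)" for v using gsg[of v] by (metis gg'(1))
  have Fg: "g v \<in> Fix \<longleftrightarrow> v \<in> Fix" for v
    unfolding Fix_def by (simp add: sgg sgg') (metis gg'(1))
  have "l e \<in> Fix" by (simp add: Fix_def sgl L(3) s(2))
  then have Fl: "l w \<in> Fix" if "w \<in> D" for w using gen[OF Fix] Fg that by blast
  have "B \<subseteq> Fix"
  proof
    fix b assume "b \<in> B"
    then consider x where "x \<in> D" "b = l x" | x where "x \<in> D" "b = u (l x)" | "b \<in> R"
      using ED by (auto simp: B_def)
    then show "b \<in> Fix"
    proof cases
      case 2
      then show ?thesis using Fl Fg gl by metis
    qed (use Fl in \<open>auto simp: Fix_def sgR\<close>)
  qed
  from span_minimal[OF this Fix] have "sg (sg v) = v" for v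
    unfolding B(2) by (auto simp: Fix_def)
  then show ?thesis
    using factorizable_if_perturbation_reversible[OF u N NA AN sg] gsg by (simp add: g_def)
qed

section \<open>Maps of small rank and necessity of the scalar condition\<close>

lemma small_range_complement:
  assumes f: "lin f" and W: "subspace W" and S: "f ` W \<subseteq> span S"
  obtains C where "C \<subseteq> W" "|C| \<le>o |S|" "\<And>v. v \<in> W \<Longrightarrow> \<exists>w\<in>span C. f (v - w) = 0"
proof -
  obtain B where B: "independent B" "span B = f ` W"
    by (rule basis_of_subspace[OF endo.linear_subspace_image[OF f W]])
  have BW: "B \<subseteq> f ` W" using span_superset[of B] B(2) by simp
  have BS: "|B| \<le>o |S|" by (rule card_independent_le[OF B(1) subset_trans[OF BW S]])
  have "\<forall>b\<in>B. \<exists>w\<in>W. f w = b" using BW by blast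
  \<comment> \<open>Preimages of a basis of the image; with the kernel of \<open>f\<close> in
    \<open>W\<close> they span \<open>W\<close>.\<close>
  then obtain k where k: "\<And>b. b \<in> B \<Longrightarrow> k b \<in> W \<and> f (k b) = b" by metis
  have fk: "f ` k ` B = B" using k by (auto simp: image_iff)
  show thesis
  proof (rule that[of "k ` B"])
    show "|k ` B| \<le>o |S|" by (rule ordLeq_transitive[OF card_of_image BS])
    fix v assume "v \<in> W"
    then have "f v \<in> f ` span (k ` B)"
      unfolding endo.linear_span_image[OF f, symmetric] fk B(2) by blast
    then show "\<exists>w\<in>span (k ` B). f (v - w) = 0" by (auto simp: lin_simps[OF f])
  qed (use k in auto)
qed

text \<open>The kernel of \<open>f\<close> has a small complement, and so has the kernel of
  \<open>h\<close> within it. With a trivial common kernel the two complements would span the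
  space.\<close>

lemma small_ranges_common_kernel:
  assumes f: "lin f" "range f \<subseteq> span S" "|S| <o |Bs|" and h: "lin h" "range h \<subseteq> span T" "|T| <o |Bs|"
    and Bs: "independent Bs" "infinite Bs"
  obtains v where "v \<noteq> 0" "f v = 0" "h v = 0"
proof -
  obtain C where C: "|C| \<le>o |S|" "\<And>v. \<exists>w\<in>span C. f (v - w) = 0"
    using small_range_complement[OF f(1) subspace_UNIV f(2)] by auto
  have ker: "subspace {v. f v = 0}" by (rule endo.linear_subspace_kernel[OF f(1)])
  obtain C' where C': "C' \<subseteq> {v. f v = 0}" "|C'| \<le>o |T|" "\<And>v. f v = 0 \<Longrightarrow> \<exists>w\<in>span C'. h (v - w) = 0"
    by (rule small_range_complement[OF h(1) ker, of T]) (use h(2) in auto)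
  show thesis
  proof (rule ccontr)
    assume "\<not> thesis"
    then have zero: "v = 0" if "f v = 0" "h v = 0" for v using that \<open>\<And>v. v \<noteq> 0 \<Longrightarrow> f v = 0 \<Longrightarrow> h v = 0 \<Longrightarrow> thesis\<close> by blast
    have "v \<in> span (C \<union> C')" for v
    proof -
      obtain w where w: "w \<in> span C" "f (v - w) = 0" using C(2) by blast
      obtain w' where w': "w' \<in> span C'" "h (v - w - w') = 0" using C'(3)[OF w(2)] by blast
      have "f w' = 0" using span_minimal[OF C'(1) ker] w'(1) by auto
      then have "f (v - w - w') = 0" using w(2) by (simp add: lin_simps[OF f(1)])
      then have "v - w - w' = 0" using zero w'(2) by blast
      then have "v = w + w'" by (simp add: algebra_simps)
      then show ?thesis
        using w(1) w'(1) span_mono[of C "C \<union> C'"] span_mono[of C' "C \<union> C'"] by (auto intro: span_add)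
    qed
    then have "|Bs| \<le>o |C \<union> C'|" by (intro card_independent_le[OF Bs(1)]) auto
    moreover have "|C \<union> C'| <o |Bs|"
      by (rule card_of_Un_ordLess_infinite[OF Bs(2)]) (use C(1) C'(2) f(3) h(3) ordLeq_ordLess_trans in blast)+
    ultimately show False using not_ordLess_ordLeq by blast
  qed
qed

text \<open>The map x = b c = a^-1 u satisfies (x - k)^2 = 0 up to small rank, and b x b = x^-1
  gives the same for x^-1. A common kernel vector leads to an eigenvector of \<open>x\<close> for
  \<open>k\<close> that is killed by (1 - k x)^2, whence (1 - k^2)^2 = 0.\<close>

lemma factorizable_near_scalar:
  assumes "factorizable u" and Bs: "independent Bs" "infinite Bs"
    and E: "range (\<lambda>x. u x - scale k x) \<subseteq> span E" "|E| <o |Bs|"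
  shows "k\<^sup>2 = 1"
proof -
  obtain a b c where abc: "local.unipotent_index2 a" "local.involution b" "local.involution c" "u = a \<circ> b \<circ> c"
    using assms(1) by (auto simp: factorizable_def)
  have a: "lin a" "\<And>x. a (a x - x) - (a x - x) = 0"
    using abc(1) by (auto simp: unipotent_index2_def fun_eq_iff)
  have b: "lin b" "\<And>x. b (b x) = x" and c: "lin c" "\<And>x. c (c x) = x"
    using abc(2,3) by (auto simp: involution_def fun_eq_iff)
  have u: "\<And>x. u x = a (b (c x))" using abc(4) by simp
  have ul: "lin u" using lin_comp[OF a(1) lin_comp[OF b(1) c(1)]] abc(4) by (simp add: comp_def)
  define n where "n x = a x - x" for x
  have n: "lin n" "\<And>x. n (n x) = 0" unfolding n_def using endo.linear_compose_sub[OF a(1) linear_ident] a(2) by auto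
  define a' where "a' x = x - n x" for x
  have a': "lin a'" unfolding a'_def by (rule endo.linear_compose_sub[OF linear_ident n(1)])
  have a'a: "a' (a x) = x" for x
    using n(2)[of x] by (simp add: a'_def n_def lin_simps[OF a(1)] algebra_simps)
  define x where "x v = b (c v)" for v
  have x: "lin x" unfolding x_def by (rule lin_comp[OF b(1) c(1)])
  have xu: "x v = a' (u v)" for v by (simp add: x_def u a'a)
  define s where "s v = u v - scale k v" for v
  have s: "s v \<in> span E" for v using E(1) by (auto simp: s_def)
  \<comment> \<open>Up to small rank x - k is - k n, and n^2 = 0.\<close>
  have xk: "x v - scale k v = a' (s v) - scale k (n v)" for v
    by (simp add: xu s_def lin_simps[OF a'] a'_def lin_simps[OF n(1)] scale_right_diff_distrib)
  define f where "f v = x (x v - scale k v) - scale k (x v - scale k v)" for v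
  have xkl: "lin (\<lambda>v. x v - scale k v)" by (rule endo.linear_compose_sub[OF x linear_scale_self])
  have f: "lin f" unfolding f_def
    by (rule endo.linear_compose_sub[OF lin_comp[OF x xkl] endo.linear_compose_scale_right[OF xkl]])
  have na': "n (a' v) = n v" for v by (simp add: a'_def lin_simps[OF n(1)] n(2))
  define S where "S = n ` E \<union> a' ` E"
  have "f v \<in> span S" for v
  proof -
    have "f v = a' (s (x v - scale k v)) - scale k (n (s v))"
      unfolding f_def xk[of "x v - scale k v"] by (simp add: xk lin_simps[OF n(1)] n(2) na')
    moreover have "a' (s w) \<in> span S" for w
    proof -
      have "a' (s w) \<in> span (a' ` E)" using s unfolding endo.linear_span_image[OF a'] by blast
      then show ?thesis unfolding S_def using span_mono[of "a' ` E" "n ` E \<union> a' ` E"] by blast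
    qed
    moreover have "n (s w) \<in> span S" for w
    proof -
      have "n (s w) \<in> span (n ` E)" using s unfolding endo.linear_span_image[OF n(1)] by blast
      then show ?thesis unfolding S_def using span_mono[of "n ` E" "n ` E \<union> a' ` E"] by blast
    qed
    ultimately show ?thesis by (simp add: span_diff span_scale)
  qed
  then have fS: "range f \<subseteq> span S" by auto
  have S: "|S| <o |Bs|" unfolding S_def
    by (rule card_of_Un_ordLess_infinite[OF Bs(2)]) (use E(2) card_of_image ordLeq_ordLess_trans in blast)+
  have bf: "lin (\<lambda>v. b (f (b v)))" by (rule lin_comp[OF b(1) lin_comp[OF f b(1)]])
  have bS: "range (\<lambda>v. b (f (b v))) \<subseteq> span (b ` S)"
    using fS unfolding endo.linear_span_image[OF b(1)] by auto
  have bSc: "|b ` S| <o |Bs|" using S card_of_image ordLeq_ordLess_trans by blast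
  obtain v where v: "v \<noteq> 0" "f v = 0" "b (f (b v)) = 0"
    by (rule small_ranges_common_kernel[OF f fS S bf bS bSc Bs])
  define y where "y w = c (b w)" for w
  have xy: "x (y w) = w" for w by (simp add: x_def y_def b(2) c(2))
  \<comment> \<open>This is (1 - k x)^2, the product of x^2 and (x^-1 - k)^2.\<close>
  define G where "G w = w - scale k (x w) - scale k (x w) + scale k (scale k (x (x w)))" for w
  have "b (f (b w)) = y (y w) - scale k (y w) - scale k (y w - scale k w)" for w
    by (simp add: f_def x_def y_def lin_simps[OF b(1)] lin_simps[OF c(1)] b(2) c(2))
  then have "x (x (y (y v) - scale k (y v) - scale k (y v - scale k v))) = 0"
    using v(3) by (simp add: lin_simps[OF x])
  then have Gv: "G v = 0"
    by (simp add: G_def lin_simps[OF x] xy scale_right_diff_distrib algebra_simps del: scale_scale)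
  have eigen: "k\<^sup>2 = 1" if "x w = scale k w" "G w = 0" "w \<noteq> 0" for w
  proof -
    have "G w = scale (1 - k * k - k * k + k * k * (k * k)) w"
      by (simp only: G_def that(1) endo.linear_scale[OF x] scale_left_diff_distrib scale_left_distrib
        scale_one scale_scale[symmetric])
    also have "1 - k * k - k * k + k * k * (k * k) = (1 - k * k) * (1 - k * k)"
      by (simp add: algebra_simps)
    finally have "scale ((1 - k * k) * (1 - k * k)) w = G w" ..
    then show ?thesis using that(2,3) by (simp add: power2_eq_square)
  qed
  \<comment> \<open>Since (x - k)^2 kills \<open>v\<close>, either \<open>v\<close> or this vector
    is an eigenvector; \<open>G\<close> kills it as well because \<open>G\<close> commutes with x -
    k.\<close>
  define w where "w = x v - scale k v"
  have xw: "x w = scale k w" using v(2) by (simp add: f_def w_def)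
  have "G w = x (G v) - scale k (G v)"
    by (simp add: G_def w_def lin_simps[OF x] scale_right_diff_distrib scale_right_distrib algebra_simps)
  then have Gw: "G w = 0" using Gv by (simp add: lin_simps[OF x])
  show ?thesis
  proof (cases "w = 0")
    case True
    then show ?thesis using eigen[OF _ Gv v(1)] by (simp add: w_def)
  qed (rule eigen[OF xw Gw])
qed

text \<open>The sign is absorbed by the first involution. This reduces the scalar -1 to the scalar
  1.\<close>

lemma factorizable_uminus: "factorizable (\<lambda>x. - u x) \<Longrightarrow> factorizable u"
proof -
  assume "factorizable (\<lambda>x. - u x)"
  then obtain a b c where abc: "local.unipotent_index2 a" "local.involution b" "local.involution c"
    "(\<lambda>x. - u x) = a \<circ> b \<circ> c" by (auto simp: factorizable_def)
  have a: "lin a" and b: "lin b" "\<And>x. b (b x) = x"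
    using abc(1,2) by (auto simp: unipotent_index2_def involution_def fun_eq_iff)
  have "local.involution (\<lambda>x. - b x)"
    using endo.linear_compose_neg[OF b(1)] b by (auto simp: involution_def fun_eq_iff lin_simps[OF b(1)])
  moreover have "u = a \<circ> (\<lambda>x. - b x) \<circ> c"
  proof
    fix x
    have "- u x = a (b (c x))" using fun_cong[OF abc(4), of x] by simp
    then have "u x = - a (b (c x))" by (metis minus_minus)
    then show "u x = (a \<circ> (\<lambda>x. - b x) \<circ> c) x" by (simp add: lin_simps[OF a])
  qed
  ultimately show "factorizable u" using abc(1,3) unfolding factorizable_def by blast
qed

section \<open>Cardinal ranks expressed through bases, and the equivalence\<close>

lemma crank_small_iff:
  assumes f: "lin f" and Bs: "independent Bs" "span Bs = UNIV"
  shows "local.crank f <o local.cdim UNIV \<longleftrightarrow> (\<exists>E. independent E \<and> span E = range f \<and> |E| <o |Bs| )"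
    (is "_ \<longleftrightarrow> ?R")
proof -
  have U: "local.cdim UNIV =o |Bs|" using cdim_eq_card_of_basis[OF Bs] .
  obtain E0 where E0: "independent E0" "span E0 = range f"
    by (rule basis_of_subspace[OF endo.linear_subspace_image[OF f subspace_UNIV]])
  show ?thesis
  proof
    assume "local.crank f <o local.cdim UNIV"
    moreover have "local.crank f =o |E0|" unfolding crank_def by (rule cdim_eq_card_of_basis[OF E0])
    ultimately have "|E0| <o |Bs|" using U ordIso_ordLess_trans ordIso_symmetric ordLess_ordIso_trans by blast
    then show ?R using E0 by blast
  next
    assume ?R
    then obtain E where E: "independent E" "span E = range f" "|E| <o |Bs|" by blast
    have "local.crank f =o |E|" unfolding crank_def by (rule cdim_eq_card_of_basis[OF E(1,2)])
    then show "local.crank f <o local.cdim UNIV"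
      using E(3) U ordIso_ordLess_trans ordIso_symmetric ordLess_ordIso_trans by blast
  qed
qed

lemma crank_finite_iff:
  assumes f: "lin f"
  shows "local.crank f <o natLeq \<longleftrightarrow> (\<exists>E. independent E \<and> span E = range f \<and> finite E)"
proof -
  obtain E0 where E0: "independent E0" "span E0 = range f"
    by (rule basis_of_subspace[OF endo.linear_subspace_image[OF f subspace_UNIV]])
  have iff: "local.crank f <o natLeq \<longleftrightarrow> finite E" if "independent E" "span E = range f" for E
    using cdim_eq_card_of_basis[OF that] finite_iff_ordLess_natLeq[of E]
      ordIso_ordLess_trans[of "local.crank f" "|E|" natLeq] ordIso_ordLess_trans[of "|E|" "local.crank f" natLeq]
      ordIso_symmetric unfolding crank_def by blast
  then show ?thesis using E0 by blast
qed

lemma factorizable_iff_near_identity: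
  assumes u: "lin u" "bij u" and Bs: "independent Bs" "span Bs = UNIV" "infinite Bs"
    and E: "independent E" "span E = range (\<lambda>x. u x - x)" "|E| <o |Bs|"
  shows "factorizable u \<longleftrightarrow> (finite E \<longrightarrow> finitary_det u \<in> {1, -1})"
proof (cases "finite E")
  case True
  then have "finite_dim (range (\<lambda>x. u x - x))" using E(2) by (auto simp: finite_dim_def)
  then show ?thesis
    using True finitary_det_factorizable factorizable_if_finitely_near_identity[OF u Bs E(1,2)] by auto
next
  case False
  then show ?thesis using factorizable_if_infinitely_near_identity[OF u Bs E] by simp
qed

theorem factorizable_iff:
  assumes u: "lin u" "bij u" and Bs: "independent Bs" "span Bs = UNIV" "infinite Bs"
  shows "factorizable u \<longleftrightarrow>
    \<not> (\<exists>k. local.crank (\<lambda>x. u x - scale k x) <o local.cdim UNIV \<and> k\<^sup>2 \<noteq> 1) \<and>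
    \<not> (\<exists>k\<in>{1, -1}. local.crank (\<lambda>x. u x - scale k x) <o natLeq \<and>
      local.det_on (range (\<lambda>x. u x - scale k x)) u \<notin> {1, -1})"
proof -
  have uk: "lin (\<lambda>x. u x - scale k x)" for k
    by (rule endo.linear_compose_sub[OF u(1) linear_scale_self])
  \<comment> \<open>Passing to the negative exchanges the scalars 1 and -1 and keeps the
    ranges.\<close>
  define u' where "u' x = - u x" for x
  have u': "lin u'" "bij u'"
  proof -
    show "lin u'" unfolding u'_def by (rule endo.linear_compose_neg[OF u(1)])
    show "bij u'" unfolding u'_def using bij_comp[OF u(2) bij_uminus] by (simp add: comp_def)
  qed
  have "(\<lambda>x. - u' x) = u" "(\<lambda>x. - u x) = u'" by (auto simp: u'_def)
  then have fact': "factorizable u \<longleftrightarrow> factorizable u'"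
    using factorizable_uminus[of u] factorizable_uminus[of u'] by auto
  have range': "range (\<lambda>x. u x - scale (-1) x) = range (\<lambda>x. u' x - x)"
  proof (rule antisym; rule image_subsetI)
    show "u x - scale (-1) x \<in> range (\<lambda>x. u' x - x)" for x
      by (rule range_eqI[of _ _ "- x"]) (simp add: u'_def lin_simps[OF u(1)])
    show "u' x - x \<in> range (\<lambda>x. u x - scale (-1) x)" for x
      by (rule range_eqI[of _ _ "- x"]) (simp add: u'_def lin_simps[OF u(1)])
  qed
  \<comment> \<open>The two determinants may differ in sign, under which the set of admissible
    values is stable.\<close>
  have det': "local.det_on (range (\<lambda>x. u x - scale (-1) x)) u \<in> {1, -1} \<longleftrightarrow> finitary_det u' \<in> {1, -1}"
    if "finite E" "span E = range (\<lambda>x. u' x - x)" for E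
  proof -
    have fd: "finite_dim (range (\<lambda>x. u' x - x))" using that by (auto simp: finite_dim_def)
    have "u' ` range (\<lambda>x. u' x - x) \<subseteq> range (\<lambda>x. u' x - x)" by (auto simp: lin_simps[OF u'(1)])
    from det_on_uminus[OF fd u'(1) this] show ?thesis
      unfolding range' finitary_det_def by (auto simp: u'_def minus_equation_iff)
  qed
  note near = factorizable_iff_near_identity[OF u Bs] and near' = factorizable_iff_near_identity[OF u' Bs]
  have small: "|E| <o |Bs|" if "finite E" for E :: "'b set" using that Bs(3)
    by (intro finite_ordLess_infinite) (simp_all add: card_of_well_order_on Field_card_of)
  show ?thesis
  proof
    assume fac: "factorizable u"
    have "k\<^sup>2 = 1" if k: "local.crank (\<lambda>x. u x - scale k x) <o local.cdim UNIV" for k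
    proof -
      obtain E where E: "span E = range (\<lambda>x. u x - scale k x)" "|E| <o |Bs|"
        using iffD1[OF crank_small_iff[OF uk Bs(1,2)] k] by (elim exE conjE)
      show ?thesis by (rule factorizable_near_scalar[OF fac Bs(1,3) eq_refl[OF E(1)[symmetric]] E(2)])
    qed
    moreover have "local.det_on (range (\<lambda>x. u x - scale k x)) u \<in> {1, -1}"
      if k: "k \<in> {1, -1}" "local.crank (\<lambda>x. u x - scale k x) <o natLeq" for k
    proof -
      obtain E where E: "independent E" "span E = range (\<lambda>x. u x - scale k x)" "finite E"
        using iffD1[OF crank_finite_iff[OF uk] k(2)] by (elim exE conjE)
      show ?thesis
      proof (cases "k = 1")
        case True
        then show ?thesis using near[OF E(1) _ small[OF E(3)]] E(2,3) fac by (simp add: finitary_det_def)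
      next
        case False
        then have k: "k = -1" using k by simp
        show ?thesis
          using det'[OF E(3)] near'[OF E(1) _ small[OF E(3)]] E(2,3) fac fact' unfolding k range' by blast
      qed
    qed
    ultimately show "\<not> (\<exists>k. local.crank (\<lambda>x. u x - scale k x) <o local.cdim UNIV \<and> k\<^sup>2 \<noteq> 1) \<and>
      \<not> (\<exists>k\<in>{1, -1}. local.crank (\<lambda>x. u x - scale k x) <o natLeq \<and>
        local.det_on (range (\<lambda>x. u x - scale k x)) u \<notin> {1, -1})" by blast
  next
    assume "\<not> (\<exists>k. local.crank (\<lambda>x. u x - scale k x) <o local.cdim UNIV \<and> k\<^sup>2 \<noteq> 1) \<and>
      \<not> (\<exists>k\<in>{1, -1}. local.crank (\<lambda>x. u x - scale k x) <o natLeq \<and>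
        local.det_on (range (\<lambda>x. u x - scale k x)) u \<notin> {1, -1})"
    then have i: "\<And>k. local.crank (\<lambda>x. u x - scale k x) <o local.cdim UNIV \<Longrightarrow> k\<^sup>2 = 1"
      and ii: "\<And>k. k \<in> {1, -1} \<Longrightarrow> local.crank (\<lambda>x. u x - scale k x) <o natLeq \<Longrightarrow>
        local.det_on (range (\<lambda>x. u x - scale k x)) u \<in> {1, -1}" by blast+
    show "factorizable u"
    \<comment> \<open>If \<open>u\<close> is close to some scalar, the first condition forces this
      scalar to be 1 or -1; otherwise \<open>u\<close> is far from all scalars.\<close>
    proof (cases "\<exists>k. local.crank (\<lambda>x. u x - scale k x) <o local.cdim UNIV")
      case True
      then obtain k where k: "local.crank (\<lambda>x. u x - scale k x) <o local.cdim UNIV" by blast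
      then obtain E where E: "independent E" "span E = range (\<lambda>x. u x - scale k x)" "|E| <o |Bs|"
        using iffD1[OF crank_small_iff[OF uk Bs(1,2)] k] by (elim exE conjE)
      have k1: "k = 1 \<or> k = -1" using i[OF k] by (simp add: power2_eq_1_iff)
      have d: "local.det_on (range (\<lambda>x. u x - scale k x)) u \<in> {1, -1}" if "finite E"
      proof (rule ii)
        show "k \<in> {1, -1}" using k1 by simp
        show "local.crank (\<lambda>x. u x - scale k x) <o natLeq"
          by (rule iffD2[OF crank_finite_iff[OF uk]], intro exI[of _ E] conjI E that)
      qed
      show ?thesis
      proof (cases "k = 1")
        case True
        then show ?thesis using near[OF E(1) _ E(3)] E(2) d by (simp add: finitary_det_def)
      next
        case False
        then have k: "k = -1" using k1 by simp
        show ?thesis using near'[OF E(1) _ E(3)] det'[of E] E(2) d fact' unfolding k range' by blast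
      qed
    next
      case False
      \<comment> \<open>A small set whose span merely contains the range still bounds the
        rank.\<close>
      have "\<not> range (\<lambda>x. u x - scale k x) \<subseteq> span E" if E: "|E| <o |Bs|" for k E
      proof
        assume sub: "range (\<lambda>x. u x - scale k x) \<subseteq> span E"
        obtain F where F: "independent F" "span F = range (\<lambda>x. u x - scale k x)"
          by (rule basis_of_subspace[OF endo.linear_subspace_image[OF uk subspace_UNIV]])
        have "F \<subseteq> span E" using sub span_superset[of F] unfolding F(2) by (rule subset_trans[rotated])
        then have "|F| <o |Bs|" by (rule ordLeq_ordLess_trans[OF card_independent_le[OF F(1)] E])
        with F have "local.crank (\<lambda>x. u x - scale k x) <o local.cdim UNIV"
          by (intro iffD2[OF crank_small_iff[OF uk Bs(1,2)]] exI[of _ F] conjI)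
        then show False using False by blast
      qed
      then show ?thesis by (rule factorizable_if_far_from_scalars[OF u Bs])
    qed
  qed
qed

end

theorem theorem1p9:
  fixes scale :: "'a::field \<Rightarrow> 'b::ab_group_add \<Rightarrow> 'b"
    and u :: "'b \<Rightarrow> 'b"
  assumes "vector_space scale"
    and "\<not> (\<exists>B. finite_dimensional_vector_space scale B)"
    and "u \<in> vector_space.GL scale"
  shows "(\<exists>a b c. vector_space.unipotent_index2 scale a \<and>
            vector_space.involution scale b \<and> vector_space.involution scale c \<and>
            u = a \<circ> b \<circ> c) \<longleftrightarrow>
         \<not> (\<exists>l. vector_space.crank scale (\<lambda>x. u x - scale l x) <o vector_space.cdim scale UNIV \<and>
              l\<^sup>2 \<noteq> 1) \<and>
         \<not> (\<exists>l\<in>{1, -1}. vector_space.crank scale (\<lambda>x. u x - scale l x) <o natLeq \<and>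
              vector_space.det_on scale (range (\<lambda>x. u x - scale l x)) u \<notin> {1, -1})"
proof -
  interpret V: endomorphism_space scale by (rule endomorphism_space.intro) (fact assms(1))
  have u: "V.lin u" "bij u" using assms(3) by (auto simp: V.GL_def)
  obtain Bs where Bs: "V.independent Bs" "V.span Bs = UNIV"
    using V.maximal_independent_subset[of UNIV] by (metis top.extremum_uniqueI)
  have "infinite Bs"
  proof
    assume "finite Bs"
    then have "finite_dimensional_vector_space scale Bs"
      using Bs by unfold_locales auto
    then show False using assms(2) by blast
  qed
  from V.factorizable_iff[OF u Bs this] show ?thesis unfolding V.factorizable_def .
qed

end
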